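(* Let $K$ be a local field of characteristic $p>0$, and let $G$ be one of the groups $Q_8$, $D_8$ (if $p=2$) or $H(p^3)$, $M(p^3)$ (if $p>2$). An extension $L/K$ is a totally ramified Galois extension with $\mathrm{Gal}(L/K)\cong G$ if and only if $L=K(x_1,x_2,x_3)$ where \[x_1^p-x_1=\kappa_1,\qquad x_2^p-x_2=\kappa_2,\qquad x_3^p-x_3=\mathfrak{s}(x_1,x_2)+\kappa_3,\] for some $\kappa_1,\kappa_2,\kappa_3\in K$ such that $v_K(\kappa_i)=-b_i<0$ with $p\nmid b_i$ for $i=1,2$, and such that, if $b_1=b_2$, then $\kappa_1,\kappa_2$ represent $\mathbb{F}_p$-linearly independent cosets in $\kappa_2\mathcal{O}_K/\kappa_2\mathcal{M}_K$; here \[\mathfrak{s}(x_1,x_2)=-\kappa_2x_1+\begin{cases}\kappa_1x_1+\kappa_2x_2 & G=Q_8,\\ \kappa_1x_1 & G=D_8,\\ 0 & G=H(p^3),\\ S(x_1,\kappa_1) & G=M(p^3).\end{cases}\] Furthermore, the Galois group $\mathrm{Gal}(L/K)=\langle\sigma_1,\sigma_2,\sigma_3\rangle$ (with $\sigma_1,\sigma_2$ generators satisfying the given presentation of $G$ and $\sigma_3=[\sigma_1,\sigma_2]$) is determined by $(\sigma_i-1)x_j=\delta_{ij}$, the Kronecker delta, for all pairs $(i,j)$ with $1\le i,j\le 3$ except $(i,j)=(1,3)$ and $(i,j)=(2,3)$, for which \[(\sigma_1-1)x_3=-x_2+\begin{cases}x_1 & G=Q_8,\\ x_1 & G=D_8,\\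 0 & G=H(p^3),\\ S(x_1,1) & G=M(p^3),\end{cases}\qquad (\sigma_2-1)x_3=\begin{cases}x_2 & G=Q_8,\\ 0 & G=D_8,\ H(p^3),\ M(p^3).\end{cases}\]
   Context: A local field of characteristic $p$ here means a field of characteristic $p$ that is complete with respect to a discrete valuation and has perfect residue field. $v_K$ is the valuation normalized so that $v_K(K^\times)=\mathbb{Z}$, $\mathcal{O}_K$ the ring of integers, $\mathcal{M}_K$ its maximal ideal. The elements $x_i$ lie in a separable closure of $K$. $S(X_1,X_2)=\frac{X_1^p+X_2^p-(X_1+X_2)^p}{p}\in\mathbb{Z}[X_1,X_2]$ (evaluated in characteristic $p$ by reducing its integer coefficients mod $p$). Commutators are $[\sigma_1,\sigma_2]=\sigma_1^{-1}\sigma_2^{-1}\sigma_1\sigma_2$. The nonabelian groups of order $p^3$ are presented as follows. For $p=2$: $Q_8=\langle\sigma_1,\sigma_2:\sigma_1^4=1,\ \sigma_1^2=\sigma_2^2=[\sigma_1,\sigma_2]\rangle$ and $D_8=\langle\sigma_1,\sigma_2:\sigma_1^4=\sigma_2^2=1,\ \sigma_1^2=[\sigma_1,\sigma_2]\rangle$. For $p>2$: $H(p^3)=\langle\sigma_1,\sigma_2:\sigma_1^p=\sigma_2^p=[\sigma_1,\sigma_2]^p=1,\ [\sigma_1,\sigma_2]\in Z(H(p^3))\rangle$ and $M(p^3)=\langle\sigma_1,\sigma_2:\sigma_1^{p^2}=\sigma_2^p=1,\ \sigma_1^p=[\sigma_1,\sigma_2]\rangle$. In every case $\sigma_3=[\sigma_1,\sigma_2]$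 generates the center, which has order $p$. *)

theory Defs
  imports "HOL-Algebra.Algebra" "HOL-Algebra.Algebraic_Closure_Type"
begin

section \<open>Subfields of an ambient field and their Galois groups\<close>

text \<open>
  All fields are subsets of one ambient field, the type \<open>'a\<close>; the main result assumes that
  \<open>'a\<close> is a separable closure of the base field \<open>K\<close>. Elements are handled with type class
  arithmetic; \<open>\<Omega>\<close> is the same field as a HOL-Algebra record, used for subfields, degrees,
  adjunction and quotient rings.
\<close>

abbreviation \<Omega> :: "'a::field ring" where
  "\<Omega> \<equiv> ring_of_type_algebra"

definition field_degree :: "'a::field set \<Rightarrow> 'a set \<Rightarrow> nat" where
  "field_degree K L = ring.dim \<Omega> K L"

definition adjoin :: "'a::field set \<Rightarrow> 'a set \<Rightarrow> 'a set" where
  "adjoin K A = generate_field \<Omega> (K \<union> A)"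

definition field_extension :: "'a::field set \<Rightarrow> 'a set \<Rightarrow> bool" where
  "field_extension K L \<longleftrightarrow> subfield K \<Omega> \<and> subfield L \<Omega> \<and> K \<subseteq> L"

definition separable_poly :: "'a::field poly \<Rightarrow> bool" where
  "separable_poly f \<longleftrightarrow> coprime f (pderiv f)"

definition separable_over :: "'a::field set \<Rightarrow> 'a \<Rightarrow> bool" where
  "separable_over K x \<longleftrightarrow>
     (\<exists>f. f \<noteq> 0 \<and> (\<forall>i. coeff f i \<in> K) \<and> separable_poly f \<and> poly f x = 0)"

text \<open>The type \<open>'a\<close> itself is a separable closure of \<open>K\<close>.\<close>

definition UNIV_separable_closure_of :: "'a::field set \<Rightarrow> bool" where
  "UNIV_separable_closure_of K \<longleftrightarrow>
     field_extension K UNIV \<and> (\<forall>x. separable_over K x) \<and>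
     (\<forall>f::'a poly. degree f > 0 \<and> separable_poly f \<longrightarrow> (\<exists>x. poly f x = 0))"

text \<open>
  The product of automorphisms is composition, \<open>(\<sigma> \<tau>) x = \<sigma> (\<tau> x)\<close>; automorphisms of \<open>L\<close>
  are represented by functions that are \<open>undefined\<close> outside \<open>L\<close>.
\<close>

definition Gal :: "'a::field set \<Rightarrow> 'a set \<Rightarrow> ('a \<Rightarrow> 'a) monoid" where
  "Gal K L = (BijGroup L)\<lparr>carrier :=
     {\<sigma> \<in> Bij L. (\<forall>x\<in>L. \<forall>y\<in>L. \<sigma> (x + y) = \<sigma> x + \<sigma> y \<and> \<sigma> (x * y) = \<sigma> x * \<sigma> y) \<and>
                (\<forall>x\<in>K. \<sigma> x = x)}\<rparr>"

lemma group_Gal: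
  assumes "field_extension K L"
  shows "group (Gal K L)"
proof -
  interpret B: group "BijGroup L" by (rule group_BijGroup)
  have subr: "subring L \<Omega>" using assms subfieldE(1) unfolding field_extension_def by blast
  let ?H = "{\<sigma> \<in> Bij L. (\<forall>x\<in>L. \<forall>y\<in>L. \<sigma> (x + y) = \<sigma> x + \<sigma> y \<and> \<sigma> (x * y) = \<sigma> x * \<sigma> y) \<and>
                (\<forall>x\<in>K. \<sigma> x = x)}"
  have KL: "K \<subseteq> L" using assms by (simp add: field_extension_def)
  have add: "x + y \<in> L" and mult: "x * y \<in> L" if "x \<in> L" "y \<in> L" for x y
    using subringE(6,7)[OF subr that] by (simp_all add: ring_of_type_algebra_def)
  have "subgroup ?H (BijGroup L)"
  proof (rule B.subgroupI)
    show "?H \<subseteq> carrier (BijGroup L)" by (auto simp: BijGroup_def)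
    have "(\<lambda>x\<in>L. x) \<in> ?H" using KL by (auto simp: id_Bij add mult)
    then show "?H \<noteq> {}" by blast
    fix a assume a: "a \<in> ?H"
    then have aB: "a \<in> Bij L" by simp
    then have bij: "bij_betw a L L" by (simp add: Bij_def)
    let ?b = "\<lambda>x\<in>L. inv_into L a x"
    have inv: "inv\<^bsub>BijGroup L\<^esub> a = ?b" using aB by (rule inv_BijGroup)
    have bL: "?b x \<in> L" "a (?b x) = x" if "x \<in> L" for x
      using that bij by (auto simp: Bij_inv_into_mem[OF aB] bij_betw_inv_into_right)
    have inj: "x = y" if "a x = a y" "x \<in> L" "y \<in> L" for x y
      using that bij by (auto simp: bij_betw_def inj_on_def)
    have hom: "a (u + w) = a u + a w" "a (u * w) = a u * a w" if "u \<in> L" "w \<in> L" for u w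
      using a that by auto
    have fixK: "a x = x" if "x \<in> K" for x using a that by auto
    have "?b (x + y) = ?b x + ?b y \<and> ?b (x * y) = ?b x * ?b y" if xy: "x \<in> L" "y \<in> L" for x y
    proof
      show "?b (x + y) = ?b x + ?b y"
      proof (rule inj)
        show "a (?b (x + y)) = a (?b x + ?b y)"
          unfolding hom(1)[OF bL(1)[OF xy(1)] bL(1)[OF xy(2)]]
            bL(2)[OF xy(1)] bL(2)[OF xy(2)] by (rule bL(2)[OF add[OF xy]])
      qed (rule bL(1)[OF add[OF xy]], rule add[OF bL(1)[OF xy(1)] bL(1)[OF xy(2)]])
      show "?b (x * y) = ?b x * ?b y"
      proof (rule inj)
        show "a (?b (x * y)) = a (?b x * ?b y)"
          unfolding hom(2)[OF bL(1)[OF xy(1)] bL(1)[OF xy(2)]]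
            bL(2)[OF xy(1)] bL(2)[OF xy(2)] by (rule bL(2)[OF mult[OF xy]])
      qed (rule bL(1)[OF mult[OF xy]], rule mult[OF bL(1)[OF xy(1)] bL(1)[OF xy(2)]])
    qed
    moreover have "?b x = x" if "x \<in> K" for x
    proof (rule inj)
      have x: "x \<in> L" using that KL by blast
      show "a (?b x) = a x" unfolding bL(2)[OF x] fixK[OF that] ..
      show "?b x \<in> L" by (rule bL(1)[OF x])
      show "x \<in> L" by (rule x)
    qed
    ultimately show "inv\<^bsub>BijGroup L\<^esub> a \<in> ?H"
      unfolding inv using restrict_inv_into_Bij[OF aB] by blast
    fix b assume b: "b \<in> ?H"
    have bm: "b x \<in> L" if "x \<in> L" for x
      using b that Bij_imp_funcset by blast
    show "a \<otimes>\<^bsub>BijGroup L\<^esub> b \<in> ?H"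
      using a b KL by (auto simp: BijGroup_def compose_Bij compose_eq add mult bm subsetD)
  qed
  then show ?thesis
    using B.subgroup_imp_group by (simp add: Gal_def)
qed

definition galois_extension :: "'a::field set \<Rightarrow> 'a set \<Rightarrow> bool" where
  "galois_extension K L \<longleftrightarrow>
     field_extension K L \<and> (\<forall>x\<in>L. separable_over K x) \<and>
     {x\<in>L. \<forall>\<sigma>\<in>carrier (Gal K L). \<sigma> x = x} = K"


section \<open>Local fields of characteristic \<open>p\<close>\<close>

text \<open>
  A valuation is an integer-valued function whose value at \<open>0\<close> is irrelevant; \<open>val_ge v n x\<close>
  means \<open>v x \<ge> n\<close> with the convention \<open>v 0 = \<infinity>\<close>.
\<close>

definition normalized_valuation :: "'a::field set \<Rightarrow> ('a \<Rightarrow> int) \<Rightarrow> bool" where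
  "normalized_valuation F v \<longleftrightarrow>
     (\<forall>x\<in>F - {0}. \<forall>y\<in>F - {0}. v (x * y) = v x + v y) \<and>
     (\<forall>x\<in>F - {0}. \<forall>y\<in>F - {0}. x + y \<noteq> 0 \<longrightarrow> min (v x) (v y) \<le> v (x + y)) \<and>
     v ` (F - {0}) = UNIV"

definition val_ge :: "('a::field \<Rightarrow> int) \<Rightarrow> int \<Rightarrow> 'a \<Rightarrow> bool" where
  "val_ge v n x \<longleftrightarrow> x = 0 \<or> n \<le> v x"

definition valuation_complete :: "'a::field set \<Rightarrow> ('a \<Rightarrow> int) \<Rightarrow> bool" where
  "valuation_complete F v \<longleftrightarrow>
     (\<forall>s::nat \<Rightarrow> 'a. (\<forall>n. s n \<in> F) \<and> (\<forall>N. \<exists>n0. \<forall>m\<ge>n0. \<forall>n\<ge>n0. val_ge v N (s m - s n))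
        \<longrightarrow> (\<exists>l\<in>F. \<forall>N. \<exists>n0. \<forall>n\<ge>n0. val_ge v N (s n - l)))"

definition val_ring :: "'a::field set \<Rightarrow> ('a \<Rightarrow> int) \<Rightarrow> 'a set" where
  "val_ring F v = {x\<in>F. val_ge v 0 x}"

definition val_ideal :: "'a::field set \<Rightarrow> ('a \<Rightarrow> int) \<Rightarrow> 'a set" where
  "val_ideal F v = {x\<in>F. val_ge v 1 x}"

definition residue_field :: "'a::field set \<Rightarrow> ('a \<Rightarrow> int) \<Rightarrow> 'a set ring" where
  "residue_field F v = (\<Omega>\<lparr>carrier := val_ring F v\<rparr>) Quot (val_ideal F v)"

text \<open>Perfectness of a field of characteristic \<open>p\<close>: the Frobenius map is surjective.\<close>

definition perfect_char :: "nat \<Rightarrow> ('b, 'm) ring_scheme \<Rightarrow> bool" where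
  "perfect_char p R \<longleftrightarrow> (\<forall>a\<in>carrier R. \<exists>b\<in>carrier R. b [^]\<^bsub>R\<^esub> p = a)"

definition local_field_char :: "nat \<Rightarrow> 'a::field set \<Rightarrow> ('a \<Rightarrow> int) \<Rightarrow> bool" where
  "local_field_char p K v \<longleftrightarrow>
     p > 0 \<and> CHAR('a) = p \<and> subfield K \<Omega> \<and>
     normalized_valuation K v \<and> valuation_complete K v \<and> perfect_char p (residue_field K v)"

text \<open>
  The ramification index of \<open>L/K\<close> is the integer \<open>e\<close> such that the normalized valuation
  \<open>w\<close> of \<open>L\<close> restricts to \<open>e\<close> times the normalized valuation \<open>v\<close> of \<open>K\<close>.
\<close>

definition totally_ramified :: "'a::field set \<Rightarrow> ('a \<Rightarrow> int) \<Rightarrow> 'a set \<Rightarrow> bool" where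
  "totally_ramified K v L \<longleftrightarrow>
     field_extension K L \<and> ring.finite_dimension \<Omega> K L \<and>
     (\<exists>w. normalized_valuation L w \<and>
          (\<forall>x\<in>K - {0}. w x = int (field_degree K L) * v x))"


section \<open>Groups presented by two generators\<close>

datatype gen = Gen1 | Gen2

text \<open>The letter \<open>(g, False)\<close> stands for the generator \<open>g\<close> and \<open>(g, True)\<close> for its inverse.\<close>

type_synonym gword = "(gen \<times> bool) list"

definition w1 :: gword where "w1 = [(Gen1, False)]"
definition w2 :: gword where "w2 = [(Gen2, False)]"

definition w_inv :: "gword \<Rightarrow> gword" where
  "w_inv w = rev (map (\<lambda>(g, e). (g, \<not> e)) w)"

definition w_pow :: "gword \<Rightarrow> nat \<Rightarrow> gword" where
  "w_pow w n = concat (replicate n w)"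

definition w_comm :: "gword \<Rightarrow> gword \<Rightarrow> gword" where
  "w_comm u v = w_inv u @ w_inv v @ u @ v"

inductive word_eq :: "(gword \<times> gword) set \<Rightarrow> gword \<Rightarrow> gword \<Rightarrow> bool"
  for R :: "(gword \<times> gword) set" where
  refl: "word_eq R u u"
| sym: "word_eq R u v \<Longrightarrow> word_eq R v u"
| trans: "word_eq R u v \<Longrightarrow> word_eq R v w \<Longrightarrow> word_eq R u w"
| append: "word_eq R u u' \<Longrightarrow> word_eq R v v' \<Longrightarrow> word_eq R (u @ v) (u' @ v')"
| cancel: "word_eq R [(g, e), (g, \<not> e)] []"
| relation: "(u, v) \<in> R \<Longrightarrow> word_eq R u v"

definition word_class :: "(gword \<times> gword) set \<Rightarrow> gword \<Rightarrow> gword set" where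
  "word_class R w = {u. word_eq R w u}"

definition presented_group :: "(gword \<times> gword) set \<Rightarrow> gword set monoid" where
  "presented_group R =
     \<lparr>carrier = range (word_class R),
      monoid.mult = (\<lambda>A B. \<Union>u\<in>A. \<Union>v\<in>B. word_class R (u @ v)),
      one = word_class R []\<rparr>"

lemma word_class_eq_iff: "word_class R u = word_class R v \<longleftrightarrow> word_eq R u v"
  unfolding word_class_def
  by (auto intro: word_eq.intros)

lemma presented_group_mult:
  "word_class R u \<otimes>\<^bsub>presented_group R\<^esub> word_class R v = word_class R (u @ v)"
  unfolding presented_group_def word_class_def
  by (auto intro: word_eq.intros)

lemma word_eq_inv_left: "word_eq R (w_inv w @ w) []"
proof (induction w)
  case Nil
  show ?case by (simp add: w_inv_def word_eq.refl)
next
  case (Cons a w)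
  obtain g e where a: "a = (g, e)" by (cases a)
  have "word_eq R [(g, \<not> e), (g, \<not> \<not> e)] []" by (rule word_eq.cancel)
  then have "word_eq R (w_inv w @ [(g, \<not> e), (g, e)] @ w) (w_inv w @ [] @ w)"
    by (intro word_eq.append word_eq.refl) simp
  then show ?case
    using Cons.IH word_eq.trans by (fastforce simp: w_inv_def a)
qed

lemma group_presented_group: "group (presented_group R)"
proof (rule groupI)
  fix x assume "x \<in> carrier (presented_group R)"
  then obtain w where x: "x = word_class R w" by (auto simp: presented_group_def)
  have "word_class R (w_inv w) \<otimes>\<^bsub>presented_group R\<^esub> x = \<one>\<^bsub>presented_group R\<^esub>"
    unfolding x presented_group_mult using word_eq_inv_left[of R w]
    by (simp add: presented_group_def word_class_eq_iff)
  then show "\<exists>y\<in>carrier (presented_group R). y \<otimes>\<^bsub>presented_group R\<^esub> x = \<one>\<^bsub>presented_group R\<^esub>"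
    by (auto simp: presented_group_def)
next
  have one: "\<one>\<^bsub>presented_group R\<^esub> = word_class R []" by (simp add: presented_group_def)
  have carr: "carrier (presented_group R) = range (word_class R)" by (simp add: presented_group_def)
  show "\<one>\<^bsub>presented_group R\<^esub> \<in> carrier (presented_group R)" by (simp add: one carr)
  show "x \<otimes>\<^bsub>presented_group R\<^esub> y \<in> carrier (presented_group R)"
    if "x \<in> carrier (presented_group R)" "y \<in> carrier (presented_group R)" for x y
    using that by (auto simp: carr presented_group_mult)
  show "x \<otimes>\<^bsub>presented_group R\<^esub> y \<otimes>\<^bsub>presented_group R\<^esub> z = x \<otimes>\<^bsub>presented_group R\<^esub> (y \<otimes>\<^bsub>presented_group R\<^esub> z)"
    if "x \<in> carrier (presented_group R)" "y \<in> carrier (presented_group R)"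
       "z \<in> carrier (presented_group R)" for x y z
    using that by (auto simp: carr presented_group_mult)
  show "\<one>\<^bsub>presented_group R\<^esub> \<otimes>\<^bsub>presented_group R\<^esub> x = x"
    if "x \<in> carrier (presented_group R)" for x
    using that by (auto simp: carr one presented_group_mult)
qed


section \<open>The nonabelian groups of order \<open>p\<^sup>3\<close>\<close>

datatype nonabelian_p3 = Q8 | D8 | Hp3 | Mp3

definition available_for :: "nat \<Rightarrow> nonabelian_p3 \<Rightarrow> bool" where
  "available_for p G \<longleftrightarrow> (p = 2 \<and> G \<in> {Q8, D8}) \<or> (p > 2 \<and> G \<in> {Hp3, Mp3})"

text \<open>
  A pair \<open>(u, v)\<close> is the relation \<open>u = v\<close>. In \<open>Hp3\<close> the condition that the commutator be
  central says that it commutes with every word.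
\<close>

fun p3_relations :: "nat \<Rightarrow> nonabelian_p3 \<Rightarrow> (gword \<times> gword) set" where
  "p3_relations p Q8 =
     {(w_pow w1 4, []), (w_pow w1 2, w_pow w2 2), (w_pow w2 2, w_comm w1 w2)}"
| "p3_relations p D8 =
     {(w_pow w1 4, []), (w_pow w2 2, []), (w_pow w1 2, w_comm w1 w2)}"
| "p3_relations p Hp3 =
     {(w_pow w1 p, []), (w_pow w2 p, []), (w_pow (w_comm w1 w2) p, [])}
     \<union> range (\<lambda>w. (w_comm w1 w2 @ w, w @ w_comm w1 w2))"
| "p3_relations p Mp3 =
     {(w_pow w1 (p\<^sup>2), []), (w_pow w2 p, []), (w_pow w1 p, w_comm w1 w2)}"

definition p3_group :: "nat \<Rightarrow> nonabelian_p3 \<Rightarrow> gword set monoid" where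
  "p3_group p G = presented_group (p3_relations p G)"

definition group_comm :: "('b, 'm) monoid_scheme \<Rightarrow> 'b \<Rightarrow> 'b \<Rightarrow> 'b" where
  "group_comm G a b = inv\<^bsub>G\<^esub> a \<otimes>\<^bsub>G\<^esub> inv\<^bsub>G\<^esub> b \<otimes>\<^bsub>G\<^esub> a \<otimes>\<^bsub>G\<^esub> b"

definition satisfy_presentation ::
  "nat \<Rightarrow> nonabelian_p3 \<Rightarrow> ('b, 'm) monoid_scheme \<Rightarrow> 'b \<Rightarrow> 'b \<Rightarrow> bool" where
  "satisfy_presentation p G \<Gamma> a b \<longleftrightarrow>
     (\<exists>\<phi>\<in>iso (p3_group p G) \<Gamma>.
        \<phi> (word_class (p3_relations p G) w1) = a \<and> \<phi> (word_class (p3_relations p G) w2) = b)"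


section \<open>The polynomial \<open>S\<close> and the defining equations\<close>

text \<open>
  \<open>\<int>[X\<^sub>1,X\<^sub>2]\<close> is rendered as \<open>\<int>[X\<^sub>1][X\<^sub>2]\<close>. The division below is exact for
  prime \<open>p\<close>; see the lemma that follows it.
\<close>

definition S_poly :: "nat \<Rightarrow> int poly poly" where
  "S_poly p = (let X1 = [:[:0, 1:]:]; X2 = [:0, 1:]
               in (X1 ^ p + X2 ^ p - (X1 + X2) ^ p) div of_nat p)"

lemma S_poly_mult_prime:
  assumes "Factorial_Ring.prime p"
  shows "of_nat p * S_poly p = [:[:0, 1:]:] ^ p + [:0, 1:] ^ p - ([:[:0, 1:]:] + [:0, 1:]) ^ p"
proof -
  let ?X1 = "[:[:0, 1:]:] :: int poly poly" and ?X2 = "[:0, 1:] :: int poly poly"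
  let ?f = "\<lambda>k. of_nat (p choose k) * ?X1 ^ k * ?X2 ^ (p - k)"
  have p: "p > 0" using assms prime_gt_0_nat by blast
  have "(?X1 + ?X2) ^ p = (\<Sum>k\<le>p. ?f k)" by (rule binomial_ring)
  also have "{..p} = insert 0 (insert p {1..<p})" using p by auto
  also have "sum ?f \<dots> = ?f 0 + (?f p + sum ?f {1..<p})" using p by simp
  finally have eq: "?X1 ^ p + ?X2 ^ p - (?X1 + ?X2) ^ p = - sum ?f {1..<p}" by simp
  have "of_nat p dvd sum ?f {1..<p}"
  proof (rule dvd_sum)
    fix k assume k: "k \<in> {1..<p}"
    then have "p dvd (p choose k)" using assms by (intro dvd_choose_prime) auto
    then have "(of_nat p :: int poly poly) dvd of_nat (p choose k)"
      by (metis dvd_def of_nat_mult)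
    then show "of_nat p dvd ?f k" by (simp add: dvd_mult2)
  qed
  then have "of_nat p dvd ?X1 ^ p + ?X2 ^ p - (?X1 + ?X2) ^ p" by (simp only: eq dvd_minus_iff)
  then show ?thesis by (simp only: S_poly_def Let_def dvd_mult_div_cancel)
qed

definition S_eval :: "nat \<Rightarrow> 'a::field \<Rightarrow> 'a \<Rightarrow> 'a" where
  "S_eval p a b = poly (map_poly (\<lambda>q. poly (map_poly of_int q) a) (S_poly p)) b"

definition s_term :: "nat \<Rightarrow> nonabelian_p3 \<Rightarrow> 'a::field \<Rightarrow> 'a \<Rightarrow> 'a \<Rightarrow> 'a \<Rightarrow> 'a" where
  "s_term p G \<kappa>1 \<kappa>2 x1 x2 = - \<kappa>2 * x1 +
     (case G of Q8 \<Rightarrow> \<kappa>1 * x1 + \<kappa>2 * x2 | D8 \<Rightarrow> \<kappa>1 * x1 | Hp3 \<Rightarrow> 0 | Mp3 \<Rightarrow> S_eval p x1 \<kappa>1)"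

text \<open>
  The cosets of \<open>\<kappa>1\<close> and \<open>\<kappa>2\<close> modulo \<open>\<kappa>2 * val_ideal K v\<close> are linearly independent over
  the prime field, as a family (so in particular they are distinct).
\<close>

definition leading_independent ::
  "nat \<Rightarrow> 'a::field set \<Rightarrow> ('a \<Rightarrow> int) \<Rightarrow> 'a \<Rightarrow> 'a \<Rightarrow> bool" where
  "leading_independent p K v \<kappa>1 \<kappa>2 \<longleftrightarrow>
     (\<forall>m n::int. of_int m * \<kappa>1 + of_int n * \<kappa>2 \<in> (\<lambda>y. \<kappa>2 * y) ` val_ideal K v
        \<longrightarrow> int p dvd m \<and> int p dvd n)"

definition defining_data ::
  "nat \<Rightarrow> nonabelian_p3 \<Rightarrow> 'a::field set \<Rightarrow> ('a \<Rightarrow> int) \<Rightarrow>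
   'a \<Rightarrow> 'a \<Rightarrow> 'a \<Rightarrow> 'a \<Rightarrow> 'a \<Rightarrow> 'a \<Rightarrow> bool" where
  "defining_data p G K v \<kappa>1 \<kappa>2 \<kappa>3 x1 x2 x3 \<longleftrightarrow>
     \<kappa>1 \<in> K \<and> \<kappa>2 \<in> K \<and> \<kappa>3 \<in> K \<and>
     x1 ^ p - x1 = \<kappa>1 \<and> x2 ^ p - x2 = \<kappa>2 \<and> x3 ^ p - x3 = s_term p G \<kappa>1 \<kappa>2 x1 x2 + \<kappa>3 \<and>
     (\<exists>b1 b2 :: nat.
        \<kappa>1 \<noteq> 0 \<and> v \<kappa>1 = - int b1 \<and> 0 < b1 \<and> \<not> p dvd b1 \<and>
        \<kappa>2 \<noteq> 0 \<and> v \<kappa>2 = - int b2 \<and> 0 < b2 \<and> \<not> p dvd b2 \<and>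
        (b1 = b2 \<longrightarrow> leading_independent p K v \<kappa>1 \<kappa>2))"

definition prescribed_action ::
  "nat \<Rightarrow> nonabelian_p3 \<Rightarrow> 'a::field \<Rightarrow> 'a \<Rightarrow> 'a \<Rightarrow>
   ('a \<Rightarrow> 'a) \<Rightarrow> ('a \<Rightarrow> 'a) \<Rightarrow> ('a \<Rightarrow> 'a) \<Rightarrow> bool" where
  "prescribed_action p G x1 x2 x3 \<sigma>1 \<sigma>2 \<sigma>3 \<longleftrightarrow>
     \<sigma>1 x1 - x1 = 1 \<and> \<sigma>1 x2 - x2 = 0 \<and>
     \<sigma>1 x3 - x3 = - x2 + (case G of Q8 \<Rightarrow> x1 | D8 \<Rightarrow> x1 | Hp3 \<Rightarrow> 0 | Mp3 \<Rightarrow> S_eval p x1 1) \<and>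
     \<sigma>2 x1 - x1 = 0 \<and> \<sigma>2 x2 - x2 = 1 \<and>
     \<sigma>2 x3 - x3 = (case G of Q8 \<Rightarrow> x2 | D8 \<Rightarrow> 0 | Hp3 \<Rightarrow> 0 | Mp3 \<Rightarrow> 0) \<and>
     \<sigma>3 x1 - x1 = 0 \<and> \<sigma>3 x2 - x2 = 0 \<and> \<sigma>3 x3 - x3 = 1"

end

theory Submission
  imports Defs
begin

text \<open>
  Write \<open>\<wp>(x) = x\<^sup>p - x\<close>. Two observations allow all four groups to be treated at once. First, each
  of them is given by the relations \<open>\<sigma>1\<^sup>p = \<sigma>3\<^bsup>e1\<^esup>\<close>, \<open>\<sigma>2\<^sup>p = \<sigma>3\<^bsup>e2\<^esup>\<close> and \<open>\<sigma>3\<^sup>p = 1\<close> with a central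
  commutator \<open>\<sigma>3 = [\<sigma>1, \<sigma>2]\<close> and exponents \<open>e1, e2\<close> in \<open>{0, 1}\<close>. Secondly, \<open>S(x, y) = x y\<close> in
  characteristic \<open>2\<close>, so that in all cases the equation for \<open>x3\<close> reads
  \<open>\<wp>(x3) = - \<kappa>2 x1 + e1 S(x1, \<kappa>1) + e2 S(x2, \<kappa>2) + \<kappa>3\<close>. The polynomial \<open>S\<close> is the carry in the
  addition of Witt vectors of length two; its cocycle identity (\<open>carry_cocycle\<close>) and the sum
  \<open>\<Sum> S(x + i, 1) = 1\<close> over the prime field (\<open>sum_carry_shift\<close>) make the prescribed automorphisms
  compatible with the equations and give them the right orders.

  From equations to extensions, the field \<open>L\<close> is built by three Artin-Schreier steps. The
  automorphisms extend from one step to the next (\<open>extend_automorphism\<close>), and \<open>x3\<close> is a proper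
  generator since the extensions of \<open>\<sigma>1\<close> and \<open>\<sigma>2\<close> do not commute on it. The Galois group is then
  read off from the translations of the generators (locale \<open>galois_core\<close>). For total ramification,
  each step is normalized so that its right hand side has a pole of order prime to \<open>p\<close>, in which case
  the valuation extends explicitly (locale \<open>ramified_step\<close>), or is integral. The latter case can be
  pushed down to \<open>K\<close>, since residues come from \<open>K\<close> and \<open>\<wp>\<close> is onto the maximal ideal
  (\<open>tot_ram_tower_step\<close>). It is impossible for \<open>x2\<close> by the hypothesis on the poles of \<open>\<kappa>1\<close> and
  \<open>\<kappa>2\<close>, and for \<open>x3\<close> because an element of \<open>L\<close> with image under \<open>\<wp>\<close> in \<open>K\<close> is fixed by the
  commutator \<open>\<sigma>3\<close>.

  From extensions to equations, the elements \<open>x1, x2, x3\<close> with the prescribed action exist by an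
  additive Hilbert 90 for the presented group (\<open>additive_hilbert_90\<close>): solving for \<open>x\<close> means finding a
  common fixed point of two affine maps, and these satisfy the relations of the group. They generate
  \<open>L\<close>, and by total ramification no nontrivial combination of \<open>\<kappa>1 = \<wp>(x1)\<close> and \<open>\<kappa>2 = \<wp>(x2)\<close> is integral
  modulo \<open>\<wp>(K)\<close>. Translating \<open>x1\<close> and \<open>x2\<close> by elements of \<open>K\<close> gives them poles of order prime to
  \<open>p\<close>. If the orders agree and the leading terms are dependent, one generator is replaced by a
  combination with a smaller pole, chosen so that an automorphism of the group realizes the change
  (\<open>add_multiple_odd\<close>, \<open>add_generators_even\<close>); explicit corrections of \<open>x3\<close> keep the shape of its equation.
\<close>


section \<open>Subfields and adjunction in type-class notation\<close>

lemma \<Omega>_simps: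
  "carrier (\<Omega> :: 'a::field ring) = UNIV" "\<zero>\<^bsub>\<Omega>\<^esub> = (0::'a)" "\<one>\<^bsub>\<Omega>\<^esub> = (1::'a)"
  "x \<oplus>\<^bsub>\<Omega>\<^esub> y = x + (y::'a)" "x \<otimes>\<^bsub>\<Omega>\<^esub> y = x * (y::'a)"
  by (simp_all add: ring_of_type_algebra_def)

lemma field_\<Omega>: "field (\<Omega> :: 'a::field ring)"
  by (rule field_from_type_algebra)

lemma \<Omega>_uminus: "\<ominus>\<^bsub>\<Omega>\<^esub> x = - (x::'a::field)"
proof -
  interpret field "\<Omega> :: 'a ring" by (rule field_\<Omega>)
  show ?thesis by (rule minus_equality) (simp_all add: \<Omega>_simps)
qed

lemma \<Omega>_inverse:
  assumes "x \<noteq> (0::'a::field)"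
  shows "inv\<^bsub>\<Omega>\<^esub> x = inverse x"
proof -
  interpret field "\<Omega> :: 'a ring" by (rule field_\<Omega>)
  show ?thesis by (rule inv_unique'[symmetric]) (use assms in \<open>simp_all add: \<Omega>_simps\<close>)
qed

lemma subfield_closed:
  fixes F :: "'a::field set"
  assumes "subfield F \<Omega>"
  shows subfield_0: "0 \<in> F" and subfield_1: "1 \<in> F"
    and subfield_add: "\<And>x y. x \<in> F \<Longrightarrow> y \<in> F \<Longrightarrow> x + y \<in> F"
    and subfield_mult: "\<And>x y. x \<in> F \<Longrightarrow> y \<in> F \<Longrightarrow> x * y \<in> F"
    and subfield_uminus: "\<And>x. x \<in> F \<Longrightarrow> - x \<in> F"
    and subfield_inverse: "\<And>x. x \<in> F \<Longrightarrow> inverse x \<in> F"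
proof -
  interpret field "\<Omega> :: 'a ring" by (rule field_\<Omega>)
  note r = subringE[OF subfieldE(1)[OF assms]]
  show "0 \<in> F" "1 \<in> F" using r(2,3) by (simp_all add: \<Omega>_simps)
  show "x + y \<in> F" "x * y \<in> F" if "x \<in> F" "y \<in> F" for x y
    using r(6,7)[OF that] by (simp_all add: \<Omega>_simps)
  show "- x \<in> F" if "x \<in> F" for x using r(5)[OF that] by (simp add: \<Omega>_uminus)
  show "inverse x \<in> F" if "x \<in> F" for x
    using subfield_m_inv(1)[OF assms, of x] that \<open>0 \<in> F\<close>
    by (cases "x = 0") (auto simp: \<Omega>_simps \<Omega>_inverse)
qed

lemma subfield_diff: "subfield F \<Omega> \<Longrightarrow> x \<in> F \<Longrightarrow> y \<in> F \<Longrightarrow> x - y \<in> F" for x :: "'a::field"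
  using subfield_add[of F x "- y"] subfield_uminus[of F y] by simp

lemma subfield_divide: "subfield F \<Omega> \<Longrightarrow> x \<in> F \<Longrightarrow> y \<in> F \<Longrightarrow> x / y \<in> F" for x :: "'a::field"
  by (simp add: divide_inverse subfield_mult subfield_inverse)

lemma subfield_power: "subfield F \<Omega> \<Longrightarrow> x \<in> F \<Longrightarrow> x ^ n \<in> F" for x :: "'a::field"
  by (induction n) (auto simp: subfield_1 subfield_mult)

lemma subfield_sum: "subfield F \<Omega> \<Longrightarrow> (\<And>i. i \<in> A \<Longrightarrow> f i \<in> F) \<Longrightarrow> sum f A \<in> F"
  for f :: "'b \<Rightarrow> 'a::field"
  by (induction A rule: infinite_finite_induct) (auto simp: subfield_0 subfield_add)

lemma subfield_of_nat: "subfield F \<Omega> \<Longrightarrow> (of_nat n :: 'a::field) \<in> F"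
  by (induction n) (auto simp: subfield_0 subfield_1 subfield_add)

lemma subfield_of_int: "subfield F \<Omega> \<Longrightarrow> (of_int n :: 'a::field) \<in> F"
  by (cases n) (auto simp: subfield_of_nat subfield_uminus simp del: of_nat_Suc)

lemmas subfield_intros = subfield_0 subfield_1 subfield_add subfield_mult subfield_uminus
  subfield_inverse subfield_diff subfield_divide subfield_power subfield_sum subfield_of_nat
  subfield_of_int

lemma subfieldI:
  fixes F :: "'a::field set"
  assumes "1 \<in> F" "\<And>x y. x \<in> F \<Longrightarrow> y \<in> F \<Longrightarrow> x + y \<in> F"
    "\<And>x y. x \<in> F \<Longrightarrow> y \<in> F \<Longrightarrow> x * y \<in> F" "\<And>x. x \<in> F \<Longrightarrow> - x \<in> F"
    "\<And>x. x \<in> F \<Longrightarrow> x \<noteq> 0 \<Longrightarrow> inverse x \<in> F"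
  shows "subfield F \<Omega>"
proof -
  interpret field "\<Omega> :: 'a ring" by (rule field_\<Omega>)
  show ?thesis
  proof (rule subfieldI')
    show "subring F \<Omega>"
      by (rule subringI) (use assms in \<open>auto simp: \<Omega>_simps \<Omega>_uminus\<close>)
    show "inv\<^bsub>\<Omega>\<^esub> k \<in> F" if "k \<in> F - {\<zero>\<^bsub>\<Omega>\<^esub>}" for k
      using that assms(5) by (auto simp: \<Omega>_simps \<Omega>_inverse)
  qed
qed

lemma adjoin_subfield: "subfield (adjoin F A) \<Omega>" for F :: "'a::field set"
  unfolding adjoin_def by (rule field.generate_field_is_subfield[OF field_\<Omega>]) (simp add: \<Omega>_simps)

lemma subset_adjoin: "F \<subseteq> adjoin F A" "A \<subseteq> adjoin F A" for F :: "'a::field set"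
  unfolding adjoin_def by (auto intro: generate_field.incl)

lemma adjoin_least:
  fixes F :: "'a::field set"
  assumes "subfield M \<Omega>" "F \<subseteq> M" "A \<subseteq> M"
  shows "adjoin F A \<subseteq> M"
  unfolding adjoin_def
  by (rule field.generate_field_min_subfield1[OF field_\<Omega>]) (use assms in \<open>auto simp: \<Omega>_simps\<close>)

lemma adjoin_eqI:
  fixes F :: "'a::field set"
  assumes "A \<subseteq> adjoin F B" "B \<subseteq> adjoin F A"
  shows "adjoin F A = adjoin F B"
  using assms by (intro subset_antisym adjoin_least adjoin_subfield subset_adjoin)

lemma adjoin_adjoin: "adjoin (adjoin F A) B = adjoin F (A \<union> B)" for F :: "'a::field set"
proof (rule subset_antisym)
  have A: "A \<subseteq> adjoin F (A \<union> B)" and B: "B \<subseteq> adjoin F (A \<union> B)"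
    using subset_adjoin(2)[of "A \<union> B" F] by auto
  show "adjoin (adjoin F A) B \<subseteq> adjoin F (A \<union> B)"
    by (intro adjoin_least adjoin_subfield subset_adjoin A B)
  have "A \<subseteq> adjoin (adjoin F A) B" "F \<subseteq> adjoin (adjoin F A) B"
    using subset_adjoin(1)[of "adjoin F A" B] subset_adjoin(1)[of F A] subset_adjoin(2)[of A F] by blast+
  then show "adjoin F (A \<union> B) \<subseteq> adjoin (adjoin F A) B"
    by (intro adjoin_least adjoin_subfield Un_least subset_adjoin)
qed

lemma field_extension_adjoin: "subfield F \<Omega> \<Longrightarrow> field_extension F (adjoin F A)"
  for F :: "'a::field set"
  by (simp add: field_extension_def adjoin_subfield subset_adjoin)


section \<open>The Witt vector carry polynomial\<close>

text \<open>
  \<open>carry p a b\<close> is the second Witt component of the sum of the Teichmueller representatives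
  of \<open>a\<close> and \<open>b\<close>, as an explicit sum that makes sense in every commutative ring. Identities for
  it are proved in polynomial rings over \<open>\<int>\<close>, where \<open>p\<close> can be cancelled, and are then
  transported to characteristic \<open>p\<close> by evaluation.
\<close>

definition carry :: "nat \<Rightarrow> 'r::comm_ring_1 \<Rightarrow> 'r \<Rightarrow> 'r" where
  "carry p a b = - (\<Sum>k\<in>{1..<p}. of_nat ((p choose k) div p) * a ^ k * b ^ (p - k))"

lemma of_nat_mult_carry:
  assumes "Factorial_Ring.prime p"
  shows "of_nat p * carry p a b = a ^ p + b ^ p - (a + b) ^ p"
proof -
  have p: "p > 0" using assms prime_gt_0_nat by blast
  let ?f = "\<lambda>k. of_nat (p choose k) * a ^ k * b ^ (p - k)"
  have "(a + b) ^ p = (\<Sum>k\<le>p. ?f k)" by (rule binomial_ring)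
  also have "{..p} = insert 0 (insert p {1..<p})" using p by auto
  also have "sum ?f \<dots> = ?f 0 + (?f p + sum ?f {1..<p})" using p by simp
  finally have eq: "a ^ p + b ^ p - (a + b) ^ p = - sum ?f {1..<p}" by simp
  have "of_nat p * (of_nat ((p choose k) div p) * a ^ k * b ^ (p - k)) = ?f k"
    if "k \<in> {1..<p}" for k
  proof -
    have "p dvd (p choose k)" using that assms by (intro dvd_choose_prime) auto
    then have "p * ((p choose k) div p) = (p choose k)" by simp
    then show ?thesis by (metis (no_types, lifting) mult.assoc of_nat_mult)
  qed
  then have "of_nat p * (\<Sum>k\<in>{1..<p}. of_nat ((p choose k) div p) * a ^ k * b ^ (p - k)) = sum ?f {1..<p}"
    unfolding sum_distrib_left by (intro sum.cong) auto
  then show ?thesis by (simp add: carry_def eq)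
qed

definition ring_hom_type :: "('r::comm_ring_1 \<Rightarrow> 's::comm_ring_1) \<Rightarrow> bool" where
  "ring_hom_type h \<longleftrightarrow>
     h 1 = 1 \<and> (\<forall>x y. h (x + y) = h x + h y) \<and> (\<forall>x y. h (x * y) = h x * h y)"

lemma ring_hom_type_simps:
  assumes "ring_hom_type h"
  shows "h 0 = 0" "h 1 = 1" "h (x + y) = h x + h y" "h (x * y) = h x * h y" "h (- x) = - h x"
    "h (x - y) = h x - h y" "h (x ^ n) = h x ^ n" "h (of_nat n) = of_nat n"
    "h (sum f A) = (\<Sum>i\<in>A. h (f i))"
proof -
  show 1: "h 1 = 1" and add: "h (x + y) = h x + h y" and mult: "h (x * y) = h x * h y" for x y
    using assms by (auto simp: ring_hom_type_def)
  show 0: "h 0 = 0" using add[of 0 0] by simp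
  show neg: "h (- x) = - h x" for x using add[of x "- x"] 0 by (simp add: eq_neg_iff_add_eq_0 add.commute)
  show "h (x - y) = h x - h y" using add[of x "- y"] neg by simp
  show "h (x ^ n) = h x ^ n" by (induction n) (auto simp: 1 mult)
  show "h (of_nat n) = of_nat n" by (induction n) (auto simp: 1 0 add)
  show "h (sum f A) = (\<Sum>i\<in>A. h (f i))"
    by (induction A rule: infinite_finite_induct) (auto simp: 0 add)
qed

lemma carry_hom: "ring_hom_type h \<Longrightarrow> h (carry p a b) = carry p (h a) (h b)"
  by (simp add: carry_def ring_hom_type_simps)

lemma ring_hom_type_of_int: "ring_hom_type (of_int :: int \<Rightarrow> 'r::comm_ring_1)"
  by (simp add: ring_hom_type_def)

lemma ring_hom_type_eval:
  assumes h: "ring_hom_type h"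
  shows "ring_hom_type (\<lambda>f. poly (map_poly h f) x)"
proof -
  let ?e = "\<lambda>f. poly (map_poly h f) x"
  have C: "?e (pCons a f) = h a + x * ?e f" for a f
    by (simp add: map_poly_pCons ring_hom_type_simps[OF h])
  have add: "?e (f + g) = ?e f + ?e g" for f g
    by (induction f g rule: poly_induct2) (simp_all add: C ring_hom_type_simps[OF h] algebra_simps)
  have smult: "?e (smult a g) = h a * ?e g" for a g
    by (induction g) (simp_all add: C ring_hom_type_simps[OF h] algebra_simps)
  have "?e (f * g) = ?e f * ?e g" for f g
    by (induction f) (simp_all add: C add smult ring_hom_type_simps[OF h] algebra_simps)
  moreover have "?e 1 = 1" unfolding one_pCons by (simp add: C ring_hom_type_simps[OF h])
  ultimately show ?thesis by (simp add: ring_hom_type_def add)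
qed

text \<open>
  Both sides come from polynomials over \<open>\<int>\<close> that agree after multiplication by \<open>p\<close>.
\<close>

lemma S_eval_eq_carry:
  assumes "Factorial_Ring.prime p"
  shows "S_eval p a b = carry p a (b :: 'a::field)"
proof -
  let ?X1 = "[:[:0, 1:]:] :: int poly poly" and ?X2 = "[:0, 1:] :: int poly poly"
  have "of_nat p * S_poly p = of_nat p * carry p ?X1 ?X2"
    unfolding S_poly_mult_prime[OF assms] of_nat_mult_carry[OF assms] ..
  then have "S_poly p = carry p ?X1 ?X2"
    using prime_gt_0_nat[OF assms] by (subst (asm) mult_cancel_left) simp
  moreover have h: "ring_hom_type (\<lambda>f. poly (map_poly (\<lambda>q. poly (map_poly of_int q) a) f) b)"
    by (intro ring_hom_type_eval ring_hom_type_of_int)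
  ultimately show ?thesis
    by (simp add: S_eval_def carry_hom[OF h] map_poly_pCons)
qed

text \<open>
  Associativity of Witt vector addition: in \<open>\<int>[X,Y,Z]\<close> both sides become
  \<open>X\<^sup>p + Y\<^sup>p + Z\<^sup>p - (X + Y + Z)\<^sup>p\<close> after multiplication by \<open>p\<close>.
\<close>

lemma carry_cocycle:
  fixes a b c :: "'r::comm_ring_1"
  assumes p: "Factorial_Ring.prime p"
  shows "carry p a b + carry p (a + b) c = carry p a (b + c) + carry p b c"
proof -
  define x1 x2 x3 :: "int poly poly poly" where "x1 = [:[:[:0, 1:]:]:]" and "x2 = [:[:0, 1:]:]" and "x3 = [:0, 1:]"
  define h :: "int poly poly poly \<Rightarrow> 'r" where
    "h f = poly (map_poly (\<lambda>q. poly (map_poly (\<lambda>q. poly (map_poly of_int q) a) q) b) f) c" for f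
  have h: "ring_hom_type h" unfolding h_def[abs_def]
    by (intro ring_hom_type_eval ring_hom_type_of_int)
  have x123: "h x1 = a" "h x2 = b" "h x3 = c" by (simp_all add: h_def x1_def x2_def x3_def map_poly_pCons)
  have "of_nat p * (carry p x1 x2 + carry p (x1 + x2) x3) = of_nat p * (carry p x1 (x2 + x3) + carry p x2 x3)"
    unfolding distrib_left of_nat_mult_carry[OF p] by (simp add: algebra_simps)
  then have "carry p x1 x2 + carry p (x1 + x2) x3 = carry p x1 (x2 + x3) + carry p x2 x3"
    using prime_gt_0_nat[OF p] by (subst (asm) mult_cancel_left) simp
  then have "h (carry p x1 x2 + carry p (x1 + x2) x3) = h (carry p x1 (x2 + x3) + carry p x2 x3)" by simp
  then show ?thesis by (simp add: ring_hom_type_simps[OF h] carry_hom[OF h] x123)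
qed

lemma carry_0_right: "carry p a 0 = 0"
  by (auto simp: carry_def power_0_left intro!: sum.neutral)

lemma carry_2: "carry 2 a b = - (a * b)"
  by (simp add: carry_def numeral_2_eq_2)


section \<open>Fields of characteristic \<open>p\<close> and the operator \<open>x\<^sup>p - x\<close>\<close>

locale char_p =
  fixes p :: nat and T :: "'a::field itself"
  assumes CHAR: "CHAR('a) = p" and prime_p: "Factorial_Ring.prime p"
begin

abbreviation wp :: "'a \<Rightarrow> 'a" where "wp x \<equiv> x ^ p - x"

lemma p_gt_1: "p > 1" and p_gt_0: "p > 0"
  using prime_gt_1_nat[OF prime_p] by auto

lemma of_nat_eq_0: "of_nat n = (0::'a) \<longleftrightarrow> p dvd n"
  using of_nat_eq_0_iff_char_dvd[where 'a = 'a] CHAR by simp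

lemma of_nat_p [simp]: "of_nat p = (0::'a)"
  by (simp add: of_nat_eq_0)

lemma of_int_eq_0: "of_int n = (0::'a) \<longleftrightarrow> int p dvd n"
proof (cases n)
  case (nonneg m) then show ?thesis by (simp add: of_nat_eq_0)
next
  case (neg m)
  have "of_nat (Suc m) = (0::'a) \<longleftrightarrow> p dvd Suc m" by (rule of_nat_eq_0)
  moreover have "int p dvd - int (Suc m) \<longleftrightarrow> p dvd Suc m" by (simp only: dvd_minus_iff int_dvd_int_iff)
  ultimately show ?thesis unfolding neg by (simp only: of_int_minus of_int_of_nat_eq neg_equal_0_iff_equal)
qed

lemma frob_add: "(x + y) ^ p = x ^ p + y ^ p" for x y :: 'a
  by (rule freshmans_dream) (simp_all add: CHAR prime_p)

lemma frob_sum: "(sum f A) ^ p = (\<Sum>i\<in>A. f i ^ p)" for f :: "'b \<Rightarrow> 'a"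
  by (rule freshmans_dream_sum) (simp_all add: CHAR prime_p)

lemma frob_minus: "(- x) ^ p = - (x ^ p)" for x :: 'a
  by (rule minus_power_prime_CHAR) (simp_all add: CHAR prime_p)

lemma frob_diff: "(x - y) ^ p = x ^ p - y ^ p" for x y :: 'a
  using frob_add[of x "- y"] frob_minus[of y] by simp

lemma frob_of_nat: "(of_nat n :: 'a) ^ p = of_nat n"
  using p_gt_0 by (induction n) (simp_all add: frob_add)

lemma frob_of_int: "(of_int n :: 'a) ^ p = of_int n"
  by (cases n) (simp_all add: frob_of_nat frob_minus del: of_nat_Suc)

lemma frob_carry: "carry p a b ^ p = carry p (a ^ p) (b ^ p)" for a b :: 'a
  by (simp add: carry_def frob_minus frob_sum power_mult_distrib frob_of_nat mult.commute flip: power_mult)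

lemma wp_add: "wp (x + y) = wp x + wp y" and wp_diff: "wp (x - y) = wp x - wp y"
  by (simp_all add: frob_add frob_diff)

lemma wp_of_int_mult: "wp (of_int n * x) = of_int n * wp x"
  by (simp add: power_mult_distrib frob_of_int algebra_simps)

lemma of_nat_inj_less_p: "i < p \<Longrightarrow> j < p \<Longrightarrow> of_nat i = (of_nat j :: 'a) \<Longrightarrow> i = j"
proof (induction i j rule: linorder_wlog)
  case (le i j)
  then have "of_nat (j - i) = (0::'a)" by (simp add: of_nat_diff)
  then have "p dvd j - i" by (simp add: of_nat_eq_0)
  then show ?case using le by (auto dest: dvd_imp_le)
qed auto

lemma card_of_nat: "card ((of_nat :: nat \<Rightarrow> 'a) ` {..<p}) = p"
  using of_nat_inj_less_p by (subst card_image) (auto simp: inj_on_def)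

text \<open>
  The prime field already supplies \<open>p\<close> roots of \<open>X\<^sup>p - X\<close>.
\<close>

lemma wp_eq_0_imp:
  assumes "wp z = 0"
  obtains i where "i < p" "z = of_nat i"
proof -
  define f :: "'a poly" where "f = monom 1 p - monom 1 1"
  have c: "coeff f p = 1" using p_gt_1 by (simp add: f_def)
  then have f0: "f \<noteq> 0" by auto
  have d: "degree f \<le> p" unfolding f_def
    using p_gt_0 by (intro degree_diff_le) (auto intro: order_trans[OF degree_monom_le])
  let ?N = "(of_nat :: nat \<Rightarrow> 'a) ` {..<p}"
  have root: "poly f x = 0 \<longleftrightarrow> wp x = 0" for x by (simp add: f_def poly_monom)
  have fin: "finite {x. poly f x = 0}" using f0 by (rule poly_roots_finite)
  have sub: "?N \<subseteq> {x. poly f x = 0}" by (auto simp: root frob_of_nat)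
  have "card {x. poly f x = 0} \<le> p" using card_poly_roots_bound[OF f0] d by simp
  then have "?N = {x. poly f x = 0}" using fin sub by (intro card_seteq) (auto simp: card_of_nat)
  moreover have "z \<in> {x. poly f x = 0}" using assms by (simp add: root)
  ultimately show ?thesis using that by blast
qed

text \<open>
  Telescoping the cocycle identity turns the sum into the same sum at \<open>x = 0\<close>, which is an
  integer: \<open>p\<close> times it telescopes to \<open>p - p\<^sup>p\<close>.
\<close>

lemma sum_carry_shift: "(\<Sum>i<p. carry p (x + of_nat i) 1) = (1::'a)"
proof -
  have "(\<Sum>i<n. carry p (x + of_nat i) 1) = carry p x (of_nat n) + (\<Sum>i<n. carry p (of_nat i) (1::'a))" for n
  proof (induction n)
    case 0
    show ?case using carry_0_right[of p x] by simp
  next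
    case (Suc n)
    show ?case using carry_cocycle[OF prime_p, of x "of_nat n" 1]
      by (simp add: Suc algebra_simps)
  qed
  from this[of p] have "(\<Sum>i<p. carry p (x + of_nat i) 1) = (\<Sum>i<p. carry p (of_nat i) (1::'a))"
    by (simp add: carry_0_right)
  also have "\<dots> = of_int (\<Sum>i<p. carry p (of_nat i) (1::int))"
    by (simp add: carry_hom[OF ring_hom_type_of_int])
  also have "(\<Sum>i<p. carry p (of_nat i) (1::int)) = 1 - int p ^ (p - 1)"
  proof -
    have "int p * (\<Sum>i<n. carry p (of_nat i) 1) = int n - int n ^ p" for n
    proof (induction n)
      case 0
      show ?case using p_gt_0 by simp
    next
      case (Suc n)
      show ?case using of_nat_mult_carry[OF prime_p, of "int n" 1]
        by (simp add: Suc algebra_simps)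
    qed
    from this[of p] have "int p * (\<Sum>i<p. carry p (of_nat i) 1) = int p * (1 - int p ^ (p - 1))"
      using p_gt_0 by (simp add: algebra_simps flip: power_Suc)
    then show ?thesis using p_gt_0 by simp
  qed
  also have "of_int (1 - int p ^ (p - 1)) = (1::'a)"
    using p_gt_1 by (simp add: power_0_left)
  finally show ?thesis .
qed

end

lemma carry_closed: "subfield F \<Omega> \<Longrightarrow> a \<in> F \<Longrightarrow> b \<in> F \<Longrightarrow> carry p a b \<in> F" for a :: "'a::field"
  unfolding carry_def by (intro subfield_intros) auto


section \<open>Linear combinations and dimension\<close>

definition lin_span :: "'a::field set \<Rightarrow> (nat \<Rightarrow> 'a) \<Rightarrow> nat \<Rightarrow> 'a set" where
  "lin_span F u n = {(\<Sum>i<n. c i * u i) | c. \<forall>i. c i \<in> F}"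

definition lin_indep :: "'a::field set \<Rightarrow> (nat \<Rightarrow> 'a) \<Rightarrow> nat \<Rightarrow> bool" where
  "lin_indep F u n \<longleftrightarrow> (\<forall>c. (\<forall>i. c i \<in> F) \<longrightarrow> (\<Sum>i<n. c i * u i) = 0 \<longrightarrow> (\<forall>i<n. c i = 0))"

lemma Span_eq_lin_span:
  fixes F :: "'a::field set"
  assumes F: "subfield F \<Omega>"
  shows "ring.Span \<Omega> F (map u (rev [0..<n])) = lin_span F u n"
proof -
  interpret field "\<Omega> :: 'a ring" by (rule field_\<Omega>)
  show ?thesis
  proof (induction n)
    case 0
    show ?case using subfield_0[OF F] by (auto simp: lin_span_def \<Omega>_simps)
  next
    case (Suc n)
    have "Span F (map u (rev [0..<Suc n])) = line_extension F (u n) (lin_span F u n)"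
      using Suc by simp
    also have "\<dots> = lin_span F u (Suc n)"
    proof (intro Set.set_eqI iffI)
      fix x assume "x \<in> line_extension F (u n) (lin_span F u n)"
      then obtain k c where k: "k \<in> F" "\<forall>i. c i \<in> F" "x = k * u n + (\<Sum>i<n. c i * u i)"
        by (auto simp: line_extension_mem_iff lin_span_def \<Omega>_simps)
      then show "x \<in> lin_span F u (Suc n)"
        by (auto simp: lin_span_def intro!: exI[of _ "c(n := k)"])
    next
      fix x assume "x \<in> lin_span F u (Suc n)"
      then obtain c where "\<forall>i. c i \<in> F" "x = c n * u n + (\<Sum>i<n. c i * u i)"
        by (auto simp: lin_span_def add.commute)
      then show "x \<in> line_extension F (u n) (lin_span F u n)"
        unfolding line_extension_mem_iff lin_span_def \<Omega>_simps by blast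
    qed
    finally show ?case .
  qed
qed

lemma independent_iff_lin_indep:
  fixes F :: "'a::field set"
  assumes F: "subfield F \<Omega>" and "lin_indep F u n"
  shows "ring.independent \<Omega> F (map u (rev [0..<n]))"
proof -
  interpret field "\<Omega> :: 'a ring" by (rule field_\<Omega>)
  show ?thesis using assms(2)
  proof (induction n)
    case 0
    show ?case by simp
  next
    case (Suc n)
    have "lin_indep F u n" unfolding lin_indep_def
    proof (intro allI impI)
      fix c i assume c: "\<forall>i. c i \<in> F" "(\<Sum>i<n. c i * u i) = 0" and i: "i < n"
      have "(\<Sum>i<Suc n. (c(n := 0)) i * u i) = 0" "\<forall>i. (c(n := 0)) i \<in> F"
        using c subfield_0[OF F] by auto
      then have "(c(n := 0)) i = 0" using Suc.prems i unfolding lin_indep_def by (meson less_SucI)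
      then show "c i = 0" using i by simp
    qed
    have "u n \<notin> lin_span F u n"
    proof
      assume "u n \<in> lin_span F u n"
      then obtain c where c: "\<forall>i. c i \<in> F" "u n = (\<Sum>i<n. c i * u i)" by (auto simp: lin_span_def)
      have "(\<Sum>i<Suc n. (c(n := - 1)) i * u i) = 0" "\<forall>i. (c(n := - 1)) i \<in> F"
        using c subfield_1[OF F] subfield_uminus[OF F] by auto
      then have "(c(n := - 1)) n = 0" using Suc.prems unfolding lin_indep_def by blast
      then show False by simp
    qed
    then have "u n \<notin> Span F (map u (rev [0..<n]))" by (subst Span_eq_lin_span[OF F])
    with \<open>lin_indep F u n\<close> have "independent F (u n # map u (rev [0..<n]))"
      by (intro li_Cons Suc.IH) (simp add: \<Omega>_simps)
    then show ?case by simp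
  qed
qed

lemma dimension_lin_span:
  fixes F :: "'a::field set"
  assumes "subfield F \<Omega>" "lin_indep F u n"
  shows "ring.dimension \<Omega> n F (lin_span F u n)"
proof -
  interpret field "\<Omega> :: 'a ring" by (rule field_\<Omega>)
  show ?thesis
    using dimension_independent[OF independent_iff_lin_indep[OF assms]]
    by (simp only: Span_eq_lin_span[OF assms(1)] length_map length_rev length_upt diff_zero)
qed


section \<open>Field homomorphisms defined on a subfield\<close>

definition hom_on :: "'a::field set \<Rightarrow> ('a \<Rightarrow> 'a) \<Rightarrow> bool" where
  "hom_on E \<tau> \<longleftrightarrow> \<tau> 1 = 1 \<and> (\<forall>x\<in>E. \<forall>y\<in>E. \<tau> (x + y) = \<tau> x + \<tau> y \<and> \<tau> (x * y) = \<tau> x * \<tau> y)"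

definition automorphism_on :: "'a::field set \<Rightarrow> ('a \<Rightarrow> 'a) \<Rightarrow> bool" where
  "automorphism_on E \<tau> \<longleftrightarrow> hom_on E \<tau> \<and> \<tau> ` E = E"

lemma hom_on_mono: "hom_on E \<tau> \<Longrightarrow> F \<subseteq> E \<Longrightarrow> hom_on F \<tau>"
  unfolding hom_on_def by blast

lemma hom_on_id: "hom_on E (\<lambda>x. x)"
  by (simp add: hom_on_def)

lemma
  fixes E :: "'a::field set"
  assumes h: "hom_on E \<tau>" and E: "subfield E \<Omega>"
  shows hom_on_1: "\<tau> 1 = 1" and hom_on_0: "\<tau> 0 = 0"
    and hom_on_add: "\<And>x y. x \<in> E \<Longrightarrow> y \<in> E \<Longrightarrow> \<tau> (x + y) = \<tau> x + \<tau> y"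
    and hom_on_mult: "\<And>x y. x \<in> E \<Longrightarrow> y \<in> E \<Longrightarrow> \<tau> (x * y) = \<tau> x * \<tau> y"
    and hom_on_uminus: "\<And>x. x \<in> E \<Longrightarrow> \<tau> (- x) = - \<tau> x"
    and hom_on_diff: "\<And>x y. x \<in> E \<Longrightarrow> y \<in> E \<Longrightarrow> \<tau> (x - y) = \<tau> x - \<tau> y"
    and hom_on_power: "\<And>x n. x \<in> E \<Longrightarrow> \<tau> (x ^ n) = \<tau> x ^ n"
    and hom_on_of_nat: "\<And>n. \<tau> (of_nat n) = of_nat n"
    and hom_on_sum: "\<And>(f :: 'b \<Rightarrow> 'a) A. (\<And>i. i \<in> A \<Longrightarrow> f i \<in> E) \<Longrightarrow> \<tau> (sum f A) = (\<Sum>i\<in>A. \<tau> (f i))"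
    and hom_on_inverse: "\<And>x. x \<in> E \<Longrightarrow> \<tau> (inverse x) = inverse (\<tau> x)"
    and hom_on_inj: "inj_on \<tau> E"
    and hom_on_carry: "\<And>a b. a \<in> E \<Longrightarrow> b \<in> E \<Longrightarrow> \<tau> (carry q a b) = carry q (\<tau> a) (\<tau> b)"
proof -
  note cl = subfield_intros[OF E]
  show 1: "\<tau> 1 = 1" and add: "\<And>x y. x \<in> E \<Longrightarrow> y \<in> E \<Longrightarrow> \<tau> (x + y) = \<tau> x + \<tau> y"
    and mult: "\<And>x y. x \<in> E \<Longrightarrow> y \<in> E \<Longrightarrow> \<tau> (x * y) = \<tau> x * \<tau> y"
    using h by (auto simp: hom_on_def)
  show 0: "\<tau> 0 = 0" using add[OF cl(1) cl(1)] by (metis add_0 add_cancel_right_left)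
  show neg: "\<tau> (- x) = - \<tau> x" if "x \<in> E" for x
    using add[of x "- x"] that cl 0 by (simp add: eq_neg_iff_add_eq_0 add.commute)
  show diff: "\<tau> (x - y) = \<tau> x - \<tau> y" if "x \<in> E" "y \<in> E" for x y
    using add[of x "- y"] that cl neg by simp
  show pow: "\<tau> (x ^ n) = \<tau> x ^ n" if "x \<in> E" for x n
    using that cl by (induction n) (auto simp: 1 mult)
  show nat: "\<tau> (of_nat n) = of_nat n" for n
    using cl by (induction n) (auto simp: 1 0 add)
  show sum: "\<tau> (sum f A) = (\<Sum>i\<in>A. \<tau> (f i))" if "\<And>i. i \<in> A \<Longrightarrow> f i \<in> E" for f :: "'c \<Rightarrow> 'a" and A
    using that cl(10)[of _ f] by (induction A rule: infinite_finite_induct) (auto simp: 0 add)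
  show inv: "\<tau> (inverse x) = inverse (\<tau> x)" if "x \<in> E" for x
  proof (cases "x = 0")
    case False
    then have "\<tau> x * \<tau> (inverse x) = 1" using mult[of x "inverse x"] that cl 1 by simp
    then show ?thesis by (rule inverse_unique[symmetric])
  qed (simp add: 0)
  show "inj_on \<tau> E"
  proof (rule inj_onI)
    fix x y assume xy: "x \<in> E" "y \<in> E" "\<tau> x = \<tau> y"
    then have z: "\<tau> (x - y) = 0" by (simp add: diff)
    have "x - y = 0"
    proof (rule ccontr)
      assume "x - y \<noteq> 0"
      then have "\<tau> (x - y) * \<tau> (inverse (x - y)) = 1"
        using mult[of "x - y" "inverse (x - y)"] xy cl 1 by simp
      then show False using z by simp
    qed
    then show "x = y" by simp
  qed
  show "\<tau> (carry q a b) = carry q (\<tau> a) (\<tau> b)" if ab: "a \<in> E" "b \<in> E" for a b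
  proof -
    let ?f = "\<lambda>k. of_nat ((q choose k) div q) * a ^ k * b ^ (q - k)"
    have f: "?f k \<in> E" for k by (intro cl ab)
    have "\<tau> (carry q a b) = - \<tau> (sum ?f {1..<q})" unfolding carry_def by (intro neg cl f)
    also have "\<tau> (sum ?f {1..<q}) = (\<Sum>k\<in>{1..<q}. \<tau> (?f k))" by (intro sum f)
    also have "\<dots> = (\<Sum>k\<in>{1..<q}. of_nat ((q choose k) div q) * \<tau> a ^ k * \<tau> b ^ (q - k))"
      using ab cl(9) cl(11) cl(4) by (simp add: mult pow nat)
    finally show ?thesis by (simp add: carry_def)
  qed
qed


section \<open>Artin-Schreier extensions\<close>

definition coeffs_in :: "'a::field set \<Rightarrow> 'a poly \<Rightarrow> bool" where
  "coeffs_in F f \<longleftrightarrow> (\<forall>i. coeff f i \<in> F)"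

lemma coeffs_in_closed:
  fixes F :: "'a::field set"
  assumes F: "subfield F \<Omega>"
  shows "coeffs_in F f \<Longrightarrow> coeffs_in F g \<Longrightarrow> coeffs_in F (f - g)"
    and "coeffs_in F f \<Longrightarrow> a \<in> F \<Longrightarrow> coeffs_in F (smult a f)"
    and "coeffs_in F f \<Longrightarrow> coeffs_in F g \<Longrightarrow> coeffs_in F (pcompose f g)"
proof -
  have add: "coeffs_in F (f + g)" and mult: "coeffs_in F (f * g)"
    if "coeffs_in F f" "coeffs_in F g" for f g
    using that by (auto simp: coeffs_in_def coeff_mult intro!: subfield_intros[OF F])
  show "coeffs_in F (f - g)" if "coeffs_in F f" "coeffs_in F g"
    using that by (auto simp: coeffs_in_def intro!: subfield_diff[OF F])
  show "coeffs_in F (smult a f)" if "coeffs_in F f" "a \<in> F"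
    using that by (auto simp: coeffs_in_def intro!: subfield_mult[OF F])
  show "coeffs_in F (pcompose f g)" if f: "coeffs_in F f" and g: "coeffs_in F g"
    using f
  proof (induction f)
    case 0
    then show ?case by simp
  next
    case (pCons a f)
    have a: "a \<in> F" using pCons.prems by (auto simp: coeffs_in_def dest: spec[of _ 0])
    have "coeffs_in F f" unfolding coeffs_in_def
    proof
      fix i show "coeff f i \<in> F"
        using pCons.prems by (auto simp: coeffs_in_def dest: spec[of _ "Suc i"])
    qed
    moreover have "coeffs_in F [:a:]" using a subfield_0[OF F]
      by (auto simp: coeffs_in_def coeff_pCons split: nat.splits)
    ultimately show ?case
      unfolding pcompose_pCons by (intro add mult g pCons.IH)
  qed
qed

lemma sum_monom_coeff: "coeff (\<Sum>i<n. monom (c i) i) j = (if j < n then c j else 0)"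
  by (simp add: coeff_sum)

lemma poly_sum_monom: "poly (\<Sum>i<n. monom (c i) i) x = (\<Sum>i<n. c i * x ^ i)"
  for x :: "'a::field"
  by (simp add: poly_sum poly_monom)

lemma degree_sum_monom: "n > 0 \<Longrightarrow> degree (\<Sum>i<n. monom (c i) i) < n"
  by (rule le_less_trans[OF degree_le[of "n - 1"]]) (auto simp: sum_monom_coeff)

context char_p
begin

text \<open>
  Let \<open>f\<close> be a nonzero polynomial over \<open>F\<close> of minimal degree \<open>d\<close> with root \<open>y\<close>, made monic. Raising
  the equation \<open>f(y) = 0\<close> to the \<open>p\<close>-th power and using \<open>y\<^sup>p = y + a\<close> gives another monic
  polynomial of degree \<open>d\<close> with root \<open>y\<close>, so the two coincide. Comparing the coefficients of degree
  \<open>d - 1\<close> shows \<open>c - c\<^sup>p = d a\<close>, hence \<open>-c/d\<close> is a root of \<open>X\<^sup>p - X - a\<close> in \<open>F\<close> if \<open>d < p\<close>, and so is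
  \<open>y\<close>, which differs from it by an element of the prime field.
\<close>

lemma no_small_polynomial:
  fixes y :: 'a
  assumes F: "subfield F \<Omega>" and y: "y \<notin> F" "wp y \<in> F"
    and f: "coeffs_in F f" "degree f < p" "poly f y = 0"
  shows "f = 0"
proof (rule ccontr)
  define Q where "Q f \<longleftrightarrow> coeffs_in F f \<and> poly f y = 0 \<and> f \<noteq> 0" for f
  assume "f \<noteq> 0"
  then have "Q f" using f by (simp add: Q_def)
  then obtain f1 where f1: "Q f1" "\<And>g. Q g \<Longrightarrow> degree f1 \<le> degree g"
    using ex_has_least_nat[of Q f degree] by auto
  define g where "g = smult (inverse (lead_coeff f1)) f1"
  define d where "d = degree g"
  have lc1: "lead_coeff f1 \<noteq> 0" using f1 by (simp add: Q_def)
  have dg: "degree g = degree f1" using lc1 by (simp add: g_def)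
  have g: "coeffs_in F g" "poly g y = 0" "coeff g d = 1"
  proof -
    have "lead_coeff f1 \<in> F" using f1(1) by (auto simp: Q_def coeffs_in_def)
    then show "coeffs_in F g" unfolding g_def
      using f1(1) by (intro coeffs_in_closed[OF F] subfield_inverse[OF F]) (auto simp: Q_def)
    show "poly g y = 0" using f1(1) by (simp add: g_def Q_def)
    show "coeff g d = 1" unfolding d_def dg using lc1 by (simp add: g_def)
  qed
  have dp: "d < p" using f1(2)[OF \<open>Q f\<close>] f(2) dg by (simp add: d_def)
  have d0: "d > 0"
  proof (rule ccontr)
    assume "\<not> d > 0"
    then obtain c where "g = [:c:]" using degree_eq_zeroE[of g] by (auto simp: d_def)
    then show False using g by (simp add: d_def)
  qed
  define a where "a = wp y"
  have a: "a \<in> F" "y ^ p = y + a" using y by (auto simp: a_def)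
  define h where "h = (\<Sum>i\<le>d. smult (coeff g i ^ p) ([:a, 1:] ^ i))"
  have ch: "coeff h j = (\<Sum>i\<le>d. coeff g i ^ p * (of_nat (i choose j) * a ^ (i - j)))" for j
  proof -
    have "coeff ([:a, 1:] ^ i) j = of_nat (i choose j) * a ^ (i - j)" for i
    proof (cases "j \<le> i")
      case False
      have "degree ([:a, 1:] ^ i) \<le> i" using degree_power_le[of "[:a, 1:]" i] by simp
      then show ?thesis using False by (simp add: coeff_eq_0 binomial_eq_0)
    qed (simp add: coeff_linear_poly_power)
    then show ?thesis by (simp add: h_def coeff_sum)
  qed
  have hF: "coeffs_in F h" unfolding coeffs_in_def ch using g(1) a(1)
    by (auto simp: coeffs_in_def intro!: subfield_intros[OF F])
  have "poly h y = (\<Sum>i\<le>d. (coeff g i * y ^ i) ^ p)"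
    unfolding h_def poly_sum by (rule sum.cong)
      (auto simp: poly_power a(2)[symmetric] add.commute[of a] power_mult_distrib mult.commute simp flip: power_mult)
  also have "\<dots> = (poly g y) ^ p" by (simp add: poly_altdef d_def frob_sum)
  finally have hy: "poly h y = 0" using g p_gt_0 by simp
  have hd: "coeff h d = 1"
  proof -
    have "coeff h d = (\<Sum>i\<in>{d}. coeff g i ^ p * (of_nat (i choose d) * a ^ (i - d)))"
      unfolding ch by (intro sum.mono_neutral_right) (auto simp: binomial_eq_0)
    then show ?thesis using g by simp
  qed
  have hd1: "coeff h (d - 1) = coeff g (d - 1) ^ p + of_nat d * a"
  proof -
    have "coeff h (d - 1) = (\<Sum>i\<in>{d - 1, d}. coeff g i ^ p * (of_nat (i choose (d - 1)) * a ^ (i - (d - 1))))"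
      unfolding ch
    proof (intro sum.mono_neutral_right ballI)
      fix i assume "i \<in> {..d} - {d - 1, d}"
      then have "i choose (d - 1) = 0" by (intro binomial_eq_0) auto
      then show "coeff g i ^ p * (of_nat (i choose (d - 1)) * a ^ (i - (d - 1))) = 0"
        by (simp only: of_nat_0 mult_zero_left mult_zero_right)
    qed auto
    moreover have "d choose (d - 1) = d" using d0 by (cases d) auto
    ultimately show ?thesis using g d0 by simp
  qed
  have deg_h: "degree h \<le> d" by (rule degree_le) (auto simp: ch binomial_eq_0 intro!: sum.neutral)
  have "h - g = 0"
  proof (rule ccontr)
    assume n: "h - g \<noteq> 0"
    have "degree (h - g) \<le> d" using deg_h by (intro degree_diff_le) (auto simp: d_def)
    moreover have "degree (h - g) \<noteq> d"
    proof
      assume "degree (h - g) = d"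
      then have "lead_coeff (h - g) = 0" using hd g by simp
      then have "h - g = 0" by (simp only: leading_coeff_0_iff)
      then show False using n by blast
    qed
    ultimately have "degree (h - g) < degree f1" using dg by (simp add: d_def)
    moreover have "Q (h - g)" unfolding Q_def
      using n hF g hy by (auto intro!: coeffs_in_closed[OF F])
    ultimately show False using f1(2) by fastforce
  qed
  define c where "c = coeff g (d - 1)"
  have c: "c - c ^ p = of_nat d * a" 
  proof -
    have "h = g" using \<open>h - g = 0\<close> by simp
    then show ?thesis using hd1 unfolding c_def by (metis add_diff_cancel_left')
  qed
  have dn: "(of_nat d :: 'a) \<noteq> 0" using d0 dp by (auto simp: of_nat_eq_0 dest: dvd_imp_le)
  define t where "t = - c / of_nat d"
  have t: "t \<in> F" using g(1) by (auto simp: t_def c_def coeffs_in_def intro!: subfield_intros[OF F])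
  have "wp t = (c - c ^ p) / of_nat d"
    by (simp add: t_def power_divide frob_minus frob_of_nat diff_divide_distrib)
  then have "wp t = a" using c dn by simp
  then have "wp (y - t) = 0" by (simp add: wp_diff a_def)
  then obtain i where "y - t = of_nat i" by (rule wp_eq_0_imp)
  then have "y = of_nat i + t" by (simp add: algebra_simps)
  then show False using y(1) t by (auto intro!: subfield_intros[OF F])
qed

lemma powers_lin_indep:
  fixes y :: 'a
  assumes F: "subfield F \<Omega>" and y: "y \<notin> F" "wp y \<in> F"
  shows "lin_indep F (\<lambda>i. y ^ i) p"
  unfolding lin_indep_def
proof (intro allI impI)
  fix c i assume c: "\<forall>i. c i \<in> F" "(\<Sum>i<p. c i * y ^ i) = 0" and i: "i < p"
  have "(\<Sum>i<p. monom (c i) i) = 0"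
    using c subfield_0[OF F] degree_sum_monom[OF p_gt_0, of c]
    by (intro no_small_polynomial[OF assms]) (auto simp: coeffs_in_def sum_monom_coeff poly_sum_monom)
  then show "c i = 0" using sum_monom_coeff[of c p i] i by simp
qed

lemma powers_unique:
  fixes y :: 'a
  assumes F: "subfield F \<Omega>" and y: "y \<notin> F" "wp y \<in> F"
    and c: "\<forall>i. c i \<in> F" "\<forall>i. c' i \<in> F" "(\<Sum>i<p. c i * y ^ i) = (\<Sum>i<p. c' i * y ^ i)" and i: "i < p"
  shows "c i = c' i"
proof -
  have "(\<Sum>i<p. (c i - c' i) * y ^ i) = 0" using c(3) by (simp add: left_diff_distrib sum_subtractf)
  moreover have "\<forall>i. c i - c' i \<in> F" using c by (auto intro: subfield_diff[OF F])
  ultimately have "\<forall>i<p. c i - c' i = 0"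
    using powers_lin_indep[OF F y] unfolding lin_indep_def by (elim allE[of _ "\<lambda>i. c i - c' i"]) blast
  then show ?thesis using i by simp
qed

text \<open>Multiplication by \<open>y\<close> in the basis of powers of \<open>y\<close>, where \<open>y\<^sup>p = y + a\<close>.\<close>

definition shift_coeffs :: "'a \<Rightarrow> (nat \<Rightarrow> 'a) \<Rightarrow> nat \<Rightarrow> 'a" where
  "shift_coeffs a c i =
     (if i = 0 then c (p - 1) * a else c (i - 1) + (if i = 1 then c (p - 1) else 0))"

lemma mult_powers_sum:
  assumes "y ^ p = y + a"
  shows "y * (\<Sum>i<p. c i * y ^ i) = (\<Sum>i<p. shift_coeffs a c i * y ^ i)"
proof -
  obtain q where q: "p = Suc (Suc q)" using p_gt_1 by (cases p; cases "p - 1") auto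
  define s where "s = shift_coeffs a c"
  have s: "s 0 = c (Suc q) * a" "s (Suc 0) = c 0 + c (Suc q)" "s (Suc (Suc i)) = c (Suc i)" for i
    unfolding s_def shift_coeffs_def by (simp_all add: q)
  have "(\<Sum>i<p. s i * y ^ i) = s 0 + (s (Suc 0) * y + (\<Sum>i<q. s (Suc (Suc i)) * y ^ Suc (Suc i)))"
    unfolding q sum.lessThan_Suc_shift by simp
  also have "\<dots> = c (Suc q) * (y + a) + (c 0 * y + (\<Sum>i<q. c (Suc i) * y ^ Suc (Suc i)))"
    unfolding s by (simp add: algebra_simps)
  also have "c 0 * y + (\<Sum>i<q. c (Suc i) * y ^ Suc (Suc i)) = (\<Sum>i<Suc q. c i * y ^ Suc i)"
    unfolding sum.lessThan_Suc_shift by simp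
  also have "c (Suc q) * (y + a) + \<dots> = (\<Sum>i<p. c i * y ^ Suc i)"
    using assms unfolding q by (simp only: sum.lessThan_Suc add.commute)
  also have "\<dots> = y * (\<Sum>i<p. c i * y ^ i)" by (simp add: sum_distrib_left algebra_simps)
  finally show ?thesis unfolding s_def ..
qed

lemma shift_coeffs_closed: "subfield F \<Omega> \<Longrightarrow> a \<in> F \<Longrightarrow> \<forall>i. c i \<in> F \<Longrightarrow> \<forall>i. shift_coeffs a c i \<in> F"
  by (auto simp: shift_coeffs_def intro: subfield_intros)

text \<open>
  The span of \<open>1, y, \<dots>, y\<^bsup>p-1\<^esup>\<close> is closed under multiplication by \<open>y\<close>, so it is the ring generated by
  \<open>y\<close>. Having finite dimension, this ring is algebraic over \<open>F\<close> and therefore a field.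
\<close>

lemma adjoin_eq_lin_span:
  fixes y :: 'a
  assumes F: "subfield F \<Omega>" and y: "y \<notin> F" "wp y \<in> F"
  shows "adjoin F {y} = lin_span F (\<lambda>i. y ^ i) p"
    and "ring.dimension \<Omega> p F (adjoin F {y})"
proof -
  interpret field "\<Omega> :: 'a ring" by (rule field_\<Omega>)
  let ?E = "lin_span F (\<lambda>i. y ^ i) p" and ?S = "simple_extension F y"
  have dim: "dimension p F ?E" by (rule dimension_lin_span[OF F powers_lin_indep[OF F y]])
  define a where "a = wp y"
  have a: "a \<in> F" "y ^ p = y + a" using y by (auto simp: a_def)
  have sub: "subring ?S \<Omega>"
    by (rule simple_extension_is_subring[OF subfieldE(1)[OF F]]) (simp add: \<Omega>_simps)
  have FS: "F \<subseteq> ?S" by (rule simple_extension_incl) (simp_all add: \<Omega>_simps)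
  have yS: "y \<in> ?S" by (rule simple_extension_mem[OF subfieldE(1)[OF F]]) (simp add: \<Omega>_simps)
  have "?S = ?E"
  proof
    show "?S \<subseteq> ?E"
    proof
      fix x assume "x \<in> ?S"
      then show "x \<in> ?E"
      proof (induction rule: simple_extension.induct)
        case zero
        show ?case using subfield_0[OF F] by (auto simp: lin_span_def \<Omega>_simps intro!: exI[of _ "\<lambda>_. 0"])
      next
        case (lin k1 k2)
        then obtain c where c: "\<forall>i. c i \<in> F" "k1 = (\<Sum>i<p. c i * y ^ i)" by (auto simp: lin_span_def)
        define c' where "c' i = shift_coeffs a c i + (if i = 0 then k2 else 0)" for i
        have "k1 * y + k2 = (\<Sum>i<p. shift_coeffs a c i * y ^ i) + (\<Sum>i<p. (if i = 0 then k2 else 0) * y ^ i)"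
        proof -
          have "(\<Sum>i<p. (if i = 0 then k2 else 0) * y ^ i) = k2"
            using p_gt_0 by (simp add: if_distrib[of "\<lambda>x. x * _"] sum.delta cong: if_cong)
          then show ?thesis using mult_powers_sum[OF a(2), of c] c(2) by (simp add: mult.commute)
        qed
        also have "\<dots> = (\<Sum>i<p. c' i * y ^ i)" by (simp add: c'_def sum.distrib distrib_right)
        finally have "k1 * y + k2 = (\<Sum>i<p. c' i * y ^ i)" .
        moreover have "\<forall>i. c' i \<in> F"
          using shift_coeffs_closed[OF F a(1) c(1)] lin(2) subfield_add[OF F] subfield_0[OF F]
          by (simp add: c'_def)
        ultimately show ?case by (auto simp: lin_span_def \<Omega>_simps)
      qed
    qed
    have S: "0 \<in> ?S" "1 \<in> ?S" "\<And>u v. u \<in> ?S \<Longrightarrow> v \<in> ?S \<Longrightarrow> u + v \<in> ?S" "\<And>u v. u \<in> ?S \<Longrightarrow> v \<in> ?S \<Longrightarrow> u * v \<in> ?S"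
      using subringE[OF sub] by (simp_all add: \<Omega>_simps)
    have "y ^ i \<in> ?S" for i by (induction i) (auto intro: S yS)
    then have "c i * y ^ i \<in> ?S" if "\<forall>i. c i \<in> F" for c i using that FS by (intro S(4)) auto
    then have "(\<Sum>i<n. c i * y ^ i) \<in> ?S" if "\<forall>i. c i \<in> F" for c n
      using that by (induction n) (auto intro: S)
    then show "?E \<subseteq> ?S" by (auto simp: lin_span_def)
  qed
  then have "(algebraic over F) y"
    using finite_dimension_imp_algebraic[OF F _ finite_dimensionI[OF dim]] sub yS by simp
  then have "subfield ?E \<Omega>"
    using simple_extension_is_subfield[OF F, of y] \<open>?S = ?E\<close> by (simp add: \<Omega>_simps)
  then have "adjoin F {y} \<subseteq> ?E"
    by (rule adjoin_least) (use FS yS \<open>?S = ?E\<close> in auto)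
  moreover have "?S \<subseteq> adjoin F {y}"
    by (rule simple_extension_subring_incl[OF subfieldE(1)[OF adjoin_subfield]])
       (use subset_adjoin(1)[of F "{y}"] subset_adjoin(2)[of "{y}" F] in auto)
  ultimately show "adjoin F {y} = ?E" using \<open>?S = ?E\<close> by simp
  then show "dimension p F (adjoin F {y})" using dim by simp
qed

text \<open>
  The extension applies \<open>\<tau>\<close> to the coefficients and sends \<open>y\<close> to \<open>y' = y + d\<close>. The hypothesis on \<open>d\<close> says
  that \<open>y'\<^sup>p - y'\<close> is the image of \<open>y\<^sup>p - y\<close>, which is what compatibility with multiplication by \<open>y\<close>
  requires; multiplicativity in general follows by additivity. The map is onto because \<open>y\<close> is the
  image of \<open>y - d'\<close> when \<open>\<tau> d' = d\<close>.
\<close>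

lemma extend_automorphism:
  fixes y d :: 'a
  assumes F: "subfield F \<Omega>" and y: "y \<notin> F" "wp y \<in> F"
    and \<tau>: "automorphism_on F \<tau>" and d: "d \<in> F" "wp d = \<tau> (wp y) - wp y"
  obtains \<tau>' where "automorphism_on (adjoin F {y}) \<tau>'" "\<tau>' y = y + d" "\<And>x. x \<in> F \<Longrightarrow> \<tau>' x = \<tau> x"
proof -
  let ?E = "adjoin F {y}"
  note E_eq = adjoin_eq_lin_span(1)[OF F y]
  have hom: "hom_on F \<tau>" and surj: "\<tau> ` F = F" using \<tau> by (auto simp: automorphism_on_def)
  note h = hom_on_1[OF hom F] hom_on_0[OF hom F] hom_on_add[OF hom F] hom_on_mult[OF hom F]
  have \<tau>F: "\<tau> x \<in> F" if "x \<in> F" for x using surj that by blast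
  define y' where "y' = y + d"
  define co where "co e = (SOME c. (\<forall>i. c i \<in> F) \<and> e = (\<Sum>i<p. c i * y ^ i))" for e
  define \<tau>' where "\<tau>' e = (\<Sum>i<p. \<tau> (co e i) * y' ^ i)" for e
  have \<tau>': "\<tau>' (\<Sum>i<p. c i * y ^ i) = (\<Sum>i<p. \<tau> (c i) * y' ^ i)" if "\<forall>i. c i \<in> F" for c
  proof -
    let ?e = "\<Sum>i<p. c i * y ^ i"
    have "(\<forall>i. co ?e i \<in> F) \<and> ?e = (\<Sum>i<p. co ?e i * y ^ i)"
      unfolding co_def by (rule someI[of _ c]) (use that in simp)
    then have "co ?e i = c i" if "i < p" for i
      using powers_unique[OF F y, of "co ?e" c i] that \<open>\<forall>i. c i \<in> F\<close> by auto
    then show ?thesis by (simp add: \<tau>'_def)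
  qed
  have in_E: "\<exists>c. (\<forall>i. c i \<in> F) \<and> e = (\<Sum>i<p. c i * y ^ i)" if "e \<in> ?E" for e
    using that unfolding E_eq lin_span_def by blast
  have EI: "(\<Sum>i<p. c i * y ^ i) \<in> ?E" if "\<forall>i. c i \<in> F" for c
    unfolding E_eq lin_span_def using that by blast
  have fixF: "\<tau>' x = \<tau> x" if x: "x \<in> F" for x
  proof -
    let ?c = "\<lambda>i. if i = 0 then x else 0"
    have "\<tau>' (\<Sum>i<p. ?c i * y ^ i) = (\<Sum>i<p. \<tau> (?c i) * y' ^ i)"
      using x subfield_0[OF F] by (intro \<tau>') auto
    moreover have "(\<Sum>i<p. ?c i * y ^ i) = x" "(\<Sum>i<p. \<tau> (?c i) * y' ^ i) = \<tau> x"
      using p_gt_0 h(2) by (simp_all add: if_distrib[of "\<lambda>x. x * _"] if_distrib[of \<tau>] sum.delta cong: if_cong)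
    ultimately show ?thesis by simp
  qed
  have ty: "\<tau>' y = y'"
  proof -
    let ?c = "\<lambda>i. if i = 1 then 1 else 0"
    have "\<tau>' (\<Sum>i<p. ?c i * y ^ i) = (\<Sum>i<p. \<tau> (?c i) * y' ^ i)"
      using subfield_0[OF F] subfield_1[OF F] by (intro \<tau>') auto
    moreover have "(\<Sum>i<p. ?c i * y ^ i) = y" "(\<Sum>i<p. \<tau> (?c i) * y' ^ i) = y'"
      using p_gt_1 h(1,2) by (simp_all add: if_distrib[of "\<lambda>x. x * _"] if_distrib[of \<tau>] sum.delta cong: if_cong)
    ultimately show ?thesis by simp
  qed
  have add: "\<tau>' (e + f) = \<tau>' e + \<tau>' f" if ef: "e \<in> ?E" "f \<in> ?E" for e f
  proof -
    obtain c c' where c: "\<forall>i. c i \<in> F" "e = (\<Sum>i<p. c i * y ^ i)"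
      and c': "\<forall>i. c' i \<in> F" "f = (\<Sum>i<p. c' i * y ^ i)"
      using in_E[OF ef(1)] in_E[OF ef(2)] by blast
    have "e + f = (\<Sum>i<p. (c i + c' i) * y ^ i)" by (simp add: c c' sum.distrib distrib_right)
    also have "\<tau>' \<dots> = (\<Sum>i<p. \<tau> (c i + c' i) * y' ^ i)"
      using c c' subfield_add[OF F] by (intro \<tau>') auto
    also have "\<dots> = (\<Sum>i<p. \<tau> (c i) * y' ^ i) + (\<Sum>i<p. \<tau> (c' i) * y' ^ i)"
      using c c' h(3) by (simp add: sum.distrib distrib_right)
    finally show ?thesis using \<tau>'[OF c(1)] \<tau>'[OF c'(1)] c(2) c'(2) by simp
  qed
  have E: "subfield ?E \<Omega>" and FE: "F \<subseteq> ?E" and yE: "y \<in> ?E"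
    using adjoin_subfield subset_adjoin[of F "{y}"] subset_adjoin(2)[of "{y}" F] by auto
  have scal: "\<tau>' (x * e) = \<tau> x * \<tau>' e" if x: "x \<in> F" and e: "e \<in> ?E" for x e
  proof -
    obtain c where c: "\<forall>i. c i \<in> F" "e = (\<Sum>i<p. c i * y ^ i)" using in_E[OF e] by blast
    have "x * e = (\<Sum>i<p. (x * c i) * y ^ i)" by (simp add: c sum_distrib_left mult.assoc)
    also have "\<tau>' \<dots> = (\<Sum>i<p. \<tau> (x * c i) * y' ^ i)"
      using c x subfield_mult[OF F] by (intro \<tau>') auto
    also have "\<dots> = \<tau> x * (\<Sum>i<p. \<tau> (c i) * y' ^ i)"
      using c x h(4) by (simp add: sum_distrib_left mult.assoc)
    finally show ?thesis using \<tau>'[OF c(1)] c(2) by simp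
  qed
  define a where "a = wp y"
  have a: "a \<in> F" "y ^ p = y + a" using y by (auto simp: a_def)
  have y'p: "y' ^ p = y' + \<tau> a"
    using d(2) by (simp add: y'_def frob_add a_def algebra_simps)
  have by_y: "\<tau>' (y * e) = y' * \<tau>' e" if e: "e \<in> ?E" for e
  proof -
    obtain c where c: "\<forall>i. c i \<in> F" "e = (\<Sum>i<p. c i * y ^ i)" using in_E[OF e] by blast
    have "\<tau>' (y * e) = (\<Sum>i<p. \<tau> (shift_coeffs a c i) * y' ^ i)"
      unfolding c(2) mult_powers_sum[OF a(2)] by (intro \<tau>' shift_coeffs_closed F a c)
    also have "(\<lambda>i. \<tau> (shift_coeffs a c i)) = shift_coeffs (\<tau> a) (\<lambda>i. \<tau> (c i))"
      using c(1) a(1) h subfield_0[OF F] by (auto simp: shift_coeffs_def fun_eq_iff)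
    also have "(\<Sum>i<p. shift_coeffs (\<tau> a) (\<lambda>i. \<tau> (c i)) i * y' ^ i) = y' * \<tau>' e"
      unfolding mult_powers_sum[OF y'p, symmetric] \<tau>'[OF c(1), symmetric] c(2) ..
    finally show ?thesis .
  qed
  have by_pow: "\<tau>' (y ^ i * e) = y' ^ i * \<tau>' e" if e: "e \<in> ?E" for i e
  proof (induction i)
    case (Suc i)
    have "y ^ i * e \<in> ?E" using yE e by (intro subfield_intros[OF E])
    then show ?case using by_y[of "y ^ i * e"] Suc by (simp add: mult.assoc)
  qed simp
  have zero: "\<tau>' 0 = 0" using fixF[of 0] subfield_0[OF F] h(2) by simp
  have sum: "\<tau>' (sum f A) = (\<Sum>i\<in>A. \<tau>' (f i))" if "\<And>i. i \<in> A \<Longrightarrow> f i \<in> ?E" for f and A :: "nat set"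
    using that subfield_sum[OF E, of _ f]
    by (induction A rule: infinite_finite_induct) (auto simp: zero add)
  have mult: "\<tau>' (e * f) = \<tau>' e * \<tau>' f" if ef: "e \<in> ?E" "f \<in> ?E" for e f
  proof -
    obtain c where c: "\<forall>i. c i \<in> F" "e = (\<Sum>i<p. c i * y ^ i)" using in_E[OF ef(1)] by blast
    have in1: "y ^ i * f \<in> ?E" for i by (intro subfield_mult[OF E] subfield_power[OF E] yE ef)
    have in2: "c i * (y ^ i * f) \<in> ?E" for i using c FE by (intro subfield_mult[OF E _ in1]) auto
    have "e * f = (\<Sum>i<p. c i * (y ^ i * f))" by (simp add: c sum_distrib_right mult.assoc)
    also have "\<tau>' \<dots> = (\<Sum>i<p. \<tau>' (c i * (y ^ i * f)))" by (intro sum in2)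
    also have "\<dots> = (\<Sum>i<p. \<tau> (c i) * (y' ^ i * \<tau>' f))"
      using c by (simp add: scal[OF _ in1] by_pow[OF ef(2)])
    also have "\<dots> = \<tau>' e * \<tau>' f" using \<tau>'[OF c(1)] c(2) by (simp add: sum_distrib_right mult.assoc)
    finally show ?thesis .
  qed
  have hom': "hom_on ?E \<tau>'" using add mult fixF[of 1] subfield_1[OF F] h(1) by (simp add: hom_on_def)
  have dE: "d \<in> ?E" "y' \<in> ?E" using d FE yE subfield_add[OF E] by (auto simp: y'_def)
  have "\<tau>' e \<in> ?E" if e: "e \<in> ?E" for e
  proof -
    obtain c where c: "\<forall>i. c i \<in> F" "e = (\<Sum>i<p. c i * y ^ i)" using in_E[OF e] by blast
    show ?thesis unfolding c(2) \<tau>'[OF c(1)] using c(1) \<tau>F FE dE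
      by (intro subfield_intros[OF E]) auto
  qed
  moreover have "\<exists>f\<in>?E. \<tau>' f = e" if e: "e \<in> ?E" for e
  proof -
    obtain c where c: "\<forall>i. c i \<in> F" "e = (\<Sum>i<p. c i * y ^ i)" using in_E[OF e] by blast
    have "\<forall>i. \<exists>b. b \<in> F \<and> \<tau> b = c i" using surj c(1) by (metis imageE)
    then obtain b where b: "\<And>i. b i \<in> F" "\<And>i. \<tau> (b i) = c i" by metis
    obtain d' where d': "d' \<in> F" "\<tau> d' = d" using surj d(1) by (metis imageE)
    define z where "z = y - d'"
    have z: "z \<in> ?E" using d' FE yE subfield_diff[OF E] by (auto simp: z_def)
    have tz: "\<tau>' z = y" using hom_on_diff[OF hom' E, of y d'] d' FE yE fixF ty
      by (auto simp: z_def y'_def)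
    have bE: "b i \<in> ?E" for i using b FE by auto
    have in3: "b i * z ^ i \<in> ?E" for i by (intro subfield_intros[OF E] bE z)
    have "\<tau>' (\<Sum>i<p. b i * z ^ i) = (\<Sum>i<p. \<tau>' (b i * z ^ i))" by (intro sum in3)
    also have "\<dots> = (\<Sum>i<p. c i * y ^ i)"
      using mult[OF bE subfield_power[OF E z]] hom_on_power[OF hom' E z] fixF[OF b(1)] b(2) tz by simp
    finally have "\<tau>' (\<Sum>i<p. b i * z ^ i) = e" using c by simp
    then show ?thesis using subfield_sum[OF E, of "{..<p}" "\<lambda>i. b i * z ^ i"] in3 by blast
  qed
  ultimately have "automorphism_on ?E \<tau>'" using hom' by (auto simp: automorphism_on_def image_iff)
  then show ?thesis using that ty fixF by (auto simp: y'_def)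
qed

text \<open>
  An element is a polynomial \<open>f(y)\<close> of degree below \<open>p\<close>; invariance says \<open>f(X + 1) = f(X)\<close>, so that
  \<open>f\<close> takes the value \<open>f(0)\<close> on the whole prime field and must be constant.
\<close>

lemma fixed_by_translation:
  fixes y :: 'a
  assumes F: "subfield F \<Omega>" and y: "y \<notin> F" "wp y \<in> F"
    and \<tau>: "hom_on (adjoin F {y}) \<tau>" "\<And>x. x \<in> F \<Longrightarrow> \<tau> x = x" "\<tau> y = y + 1"
    and e: "e \<in> adjoin F {y}" "\<tau> e = e"
  shows "e \<in> F"
proof -
  note E = adjoin_subfield[of F "{y}"]
  obtain c where c: "\<forall>i. c i \<in> F" "e = (\<Sum>i<p. c i * y ^ i)"
    using e(1) unfolding adjoin_eq_lin_span(1)[OF F y] lin_span_def by blast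
  define f where "f = (\<Sum>i<p. monom (c i) i)"
  have f: "coeffs_in F f" "degree f < p" "poly f y = e"
    using c subfield_0[OF F] degree_sum_monom[OF p_gt_0, of c]
    by (auto simp: f_def coeffs_in_def sum_monom_coeff poly_sum_monom)
  have FE: "F \<subseteq> adjoin F {y}" and yE: "y \<in> adjoin F {y}"
    using subset_adjoin(1)[of F "{y}"] subset_adjoin(2)[of "{y}" F] by auto
  have cE: "c i \<in> adjoin F {y}" for i using c(1) FE by auto
  have "\<tau> e = (\<Sum>i<p. \<tau> (c i * y ^ i))"
    unfolding c(2) by (intro hom_on_sum[OF \<tau>(1) E] subfield_intros[OF E] cE yE)
  also have "\<dots> = (\<Sum>i<p. c i * (y + 1) ^ i)"
    using hom_on_mult[OF \<tau>(1) E cE subfield_power[OF E yE]] hom_on_power[OF \<tau>(1) E yE] c(1) \<tau>(2,3)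
    by simp
  finally have "poly f (y + 1) = e" using e(2) by (simp add: f_def poly_sum_monom)
  define g where "g = pcompose f [:1, 1:] - f"
  have "coeffs_in F [:1, 1:]" using subfield_0[OF F] subfield_1[OF F]
    by (auto simp: coeffs_in_def coeff_pCons split: nat.splits)
  then have "coeffs_in F g" unfolding g_def by (intro coeffs_in_closed[OF F] f)
  moreover have "degree g < p" unfolding g_def
    using f(2) by (intro degree_diff_less) (auto simp: degree_pcompose)
  moreover have "poly g y = 0"
    using f(3) \<open>poly f (y + 1) = e\<close> by (simp add: g_def poly_pcompose add.commute)
  ultimately have "g = 0" by (rule no_small_polynomial[OF F y])
  then have inv: "pcompose f [:1, 1:] = f" by (simp add: g_def)
  have sh: "poly f (1 + x) = poly f x" for x
    using arg_cong[OF inv, of "\<lambda>f. poly f x"] by (simp add: poly_pcompose)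
  have val: "poly f (of_nat i) = poly f 0" for i by (induction i) (simp_all add: sh)
  define h where "h = f - [:poly f 0:]"
  have "h = 0"
  proof (rule ccontr)
    assume "h \<noteq> 0"
    have "(of_nat :: nat \<Rightarrow> 'a) ` {..<p} \<subseteq> {x. poly h x = 0}" by (auto simp: h_def val)
    then have "p \<le> card {x. poly h x = 0}"
      using card_mono[OF poly_roots_finite[OF \<open>h \<noteq> 0\<close>]] by (metis card_of_nat)
    also have "\<dots> \<le> degree h" using \<open>h \<noteq> 0\<close> by (rule card_poly_roots_bound)
    also have "\<dots> < p" unfolding h_def using f(2) by (intro degree_diff_less) auto
    finally show False by simp
  qed
  then have "f = [:poly f 0:]" by (simp add: h_def)
  have "poly [:poly f 0:] y = poly f 0" by simp
  then have "e = poly f 0" using f(3) \<open>f = [:poly f 0:]\<close> by argo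
  moreover have "poly f 0 \<in> F" using f(1) by (simp add: coeffs_in_def poly_0_coeff_0)
  ultimately show ?thesis by simp
qed

end


section \<open>Complete discretely valued fields\<close>

locale valued_subfield =
  fixes F :: "'a::field set" and w :: "'a \<Rightarrow> int"
  assumes F: "subfield F \<Omega>" and nv: "normalized_valuation F w"
begin

lemmas Fcl = subfield_intros[OF F]

lemma val_mult: "x \<in> F \<Longrightarrow> y \<in> F \<Longrightarrow> x \<noteq> 0 \<Longrightarrow> y \<noteq> 0 \<Longrightarrow> w (x * y) = w x + w y"
  using nv by (auto simp: normalized_valuation_def)

lemma ex_val: obtains x where "x \<in> F" "x \<noteq> 0" "w x = n"
proof -
  have "n \<in> w ` (F - {0})" using nv by (simp add: normalized_valuation_def)
  then show ?thesis using that by blast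
qed

lemma val_1: "w 1 = 0"
  using val_mult[of 1 1] Fcl by simp

lemma val_uminus: "w (- x) = w x" if "x \<in> F"
proof (cases "x = 0")
  case False
  have "w (- 1) + w (- 1) = 0" using val_mult[of "- 1" "- 1"] Fcl val_1 by simp
  then have "w (- 1) = 0" by simp
  then show ?thesis using val_mult[of "- 1" x] that False Fcl by simp
qed simp

lemma val_power: "x \<in> F \<Longrightarrow> x \<noteq> 0 \<Longrightarrow> w (x ^ n) = int n * w x"
  by (induction n) (simp_all add: val_1 val_mult Fcl algebra_simps)

lemma val_inverse: "x \<in> F \<Longrightarrow> x \<noteq> 0 \<Longrightarrow> w (inverse x) = - w x"
  using val_mult[of x "inverse x"] val_1 Fcl by simp

lemma val_ge_mono: "val_ge w n x \<Longrightarrow> m \<le> n \<Longrightarrow> val_ge w m x"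
  by (auto simp: val_ge_def)

lemma val_ge_0 [simp]: "val_ge w n 0"
  by (simp add: val_ge_def)

lemma val_ge_uminus: "x \<in> F \<Longrightarrow> val_ge w n x \<Longrightarrow> val_ge w n (- x)"
  by (auto simp: val_ge_def val_uminus)

lemma val_ge_add:
  assumes "x \<in> F" "y \<in> F" "val_ge w n x" "val_ge w n y"
  shows "val_ge w n (x + y)"
proof (cases "x = 0 \<or> y = 0 \<or> x + y = 0")
  case False
  then have "min (w x) (w y) \<le> w (x + y)"
    using assms nv unfolding normalized_valuation_def by blast
  then show ?thesis using False assms by (auto simp: val_ge_def)
qed (use assms in \<open>auto simp: val_ge_def\<close>)

lemma val_ge_diff: "x \<in> F \<Longrightarrow> y \<in> F \<Longrightarrow> val_ge w n x \<Longrightarrow> val_ge w n y \<Longrightarrow> val_ge w n (x - y)"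
  using val_ge_add[of x "- y" n] val_ge_uminus[of y n] Fcl by simp

lemma val_ge_mult:
  "x \<in> F \<Longrightarrow> y \<in> F \<Longrightarrow> val_ge w m x \<Longrightarrow> val_ge w n y \<Longrightarrow> val_ge w (m + n) (x * y)"
  by (cases "x = 0 \<or> y = 0") (auto simp: val_ge_def val_mult)

lemma val_ge_power: "x \<in> F \<Longrightarrow> val_ge w n x \<Longrightarrow> val_ge w (int k * n) (x ^ k)"
  by (cases "x = 0"; cases "k = 0") (auto simp: val_ge_def val_power val_1 mult_left_mono)

lemma val_ge_sum:
  "(\<And>i. i \<in> A \<Longrightarrow> f i \<in> F) \<Longrightarrow> (\<And>i. i \<in> A \<Longrightarrow> val_ge w n (f i)) \<Longrightarrow> val_ge w n (sum f A)"
  by (induction A rule: infinite_finite_induct) (auto intro!: val_ge_add Fcl)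

lemma val_ge_of_nat: "val_ge w 0 (of_nat n)"
  by (induction n) (auto intro!: val_ge_add Fcl simp: val_ge_def[of w 0 1] val_1)

lemma val_ge_of_int: "val_ge w 0 (of_int n)"
  by (cases n) (auto simp: val_ge_of_nat intro!: val_ge_uminus Fcl simp del: of_nat_Suc)

lemma val_diff_eq:
  assumes "x \<in> F" "y \<in> F" "x \<noteq> 0" "val_ge w (w x + 1) y"
  shows "x - y \<noteq> 0 \<and> w (x - y) = w x"
proof -
  have ne: "\<not> val_ge w (w x + 1) x" using assms by (simp add: val_ge_def)
  have "val_ge w (w x) (x - y)"
    using assms val_ge_mono[OF assms(4)] by (intro val_ge_diff) (auto simp: val_ge_def)
  moreover have "\<not> val_ge w (w x + 1) (x - y)"
    using val_ge_add[of "x - y" y "w x + 1"] ne assms Fcl by auto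
  ultimately show ?thesis by (auto simp: val_ge_def)
qed

lemma eq_0_of_val_ge: "(\<And>n. val_ge w n x) \<Longrightarrow> x = 0"
  unfolding val_ge_def by (metis add_le_same_cancel1 not_one_le_zero)

end

text \<open>
  The residue field enters only through this elementwise form of perfectness, which is easy to
  carry along a totally ramified tower.
\<close>

locale complete_dvf = valued_subfield F w for F :: "'a::field set" and w +
  fixes p :: nat
  assumes char_eq: "CHAR('a) = p" and char_prime: "Factorial_Ring.prime p"
    and complete: "valuation_complete F w"
    and residue_perfect: "\<And>a. a \<in> F \<Longrightarrow> val_ge w 0 a \<Longrightarrow> \<exists>b\<in>F. val_ge w 0 b \<and> val_ge w 1 (a - b ^ p)"

sublocale complete_dvf \<subseteq> char_p p "TYPE('a)"
  by unfold_locales (rule char_eq, rule char_prime)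

context complete_dvf
begin

lemma frob_0 [simp]: "0 ^ p = (0::'a)"
  using p_gt_0 by simp

lemma p_ge_2: "2 \<le> int p"
  using p_gt_1 by simp

lemma val_ge_wp: "x \<in> F \<Longrightarrow> 0 \<le> n \<Longrightarrow> val_ge w n x \<Longrightarrow> val_ge w n (wp x)"
proof (rule val_ge_diff)
  assume x: "x \<in> F" "0 \<le> n" "val_ge w n x"
  have "n \<le> int p * n" using x(2) p_gt_0 mult_right_mono[of 1 "int p" n] by simp
  then show "val_ge w n (x ^ p)" using val_ge_mono[OF val_ge_power[OF x(1,3)]] by blast
qed (auto intro: Fcl)

lemma val_wp_neg:
  assumes "x \<in> F" "\<not> val_ge w 0 (wp x)"
  shows "x \<noteq> 0 \<and> w x < 0 \<and> wp x \<noteq> 0 \<and> w (wp x) = int p * w x"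
proof -
  have neg: "x \<noteq> 0" "w x < 0" using val_ge_wp[of x 0] assms by (auto simp: val_ge_def)
  have "int p * w x + 1 \<le> w x"
    using neg(2) mult_right_mono_neg[OF p_ge_2, of "w x"] by linarith
  then have "val_ge w (w (x ^ p) + 1) x" using assms neg by (simp add: val_power val_ge_def)
  then show ?thesis using val_diff_eq[of "x ^ p" x] assms neg by (simp add: Fcl val_power)
qed

text \<open>
  A pole whose order is divisible by \<open>p\<close> can be lowered: perfectness of the residue field makes
  the leading coefficient a \<open>p\<close>-th power. The last part of the conclusion is what allows a pole
  that is already small to stay small.
\<close>

lemma reduce_mod_wp:
  assumes "a \<in> F"
  obtains h where "h \<in> F"
    "val_ge w 0 (a - wp h) \<or> (a - wp h \<noteq> 0 \<and> w (a - wp h) < 0 \<and> \<not> int p dvd w (a - wp h))"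
    "\<And>n. n \<le> 0 \<Longrightarrow> val_ge w n a \<Longrightarrow> val_ge w n (a - wp h)"
proof -
  define P where "P a h \<longleftrightarrow> h \<in> F \<and>
    (val_ge w 0 (a - wp h) \<or> (a - wp h \<noteq> 0 \<and> w (a - wp h) < 0 \<and> \<not> int p dvd w (a - wp h))) \<and>
    (\<forall>n\<le>0. val_ge w n a \<longrightarrow> val_ge w n (a - wp h))" for a h
  have "\<exists>h. P a h" using assms
  proof (induction "nat (- w a)" arbitrary: a rule: less_induct)
    case less
    show ?case
    proof (cases "val_ge w 0 a \<or> \<not> int p dvd w a")
      case True
      have "P a 0" unfolding P_def using True Fcl(1) by (auto simp: val_ge_def)
      then show ?thesis by blast
    next
      case False
      then have a0: "a \<noteq> 0" "w a < 0" by (auto simp: val_ge_def)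
      from False obtain m where m: "w a = int p * m" by (auto simp: dvd_def)
      then have m0: "m < 0" using a0 p_gt_0 by (simp add: mult_less_0_iff)
      obtain u where u: "u \<in> F" "u \<noteq> 0" "w u = m" by (rule ex_val)
      \<comment> \<open>If \<open>b\<^sup>p\<close> has the residue of the unit \<open>c\<close>, then \<open>(u b)\<^sup>p\<close> is the leading term of \<open>a\<close>.\<close>
      define c where "c = a * inverse (u ^ p)"
      have c: "c \<in> F" unfolding c_def by (intro Fcl less.prems u)
      have wc: "w c = 0"
        unfolding c_def using u a0 less.prems m by (simp add: val_mult val_inverse val_power Fcl)
      obtain b where b: "b \<in> F" "val_ge w 0 b" "val_ge w 1 (c - b ^ p)"
        using residue_perfect[OF c] wc by (auto simp: val_ge_def)
      define a1 where "a1 = a - wp (u * b)"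
      have a1_eq: "a1 = u ^ p * (c - b ^ p) + u * b"
        using u by (simp add: a1_def c_def power_mult_distrib algebra_simps)
      have "val_ge w (w a + 1) (u ^ p * (c - b ^ p))"
        using val_ge_mult[of "u ^ p" "c - b ^ p" "w a" 1] b c u m
        by (simp add: Fcl val_ge_def[of w "int p * m"] val_power)
      moreover have "val_ge w (w a + 1) (u * b)"
      proof (rule val_ge_mono)
        show "val_ge w (m + 0) (u * b)" using u b by (intro val_ge_mult) (auto simp: val_ge_def)
        show "w a + 1 \<le> m + 0"
          using m m0 mult_right_mono_neg[OF p_ge_2, of m] by linarith
      qed
      ultimately have ge: "val_ge w (w a + 1) a1"
        unfolding a1_eq using u b c by (intro val_ge_add Fcl)
      have a1F: "a1 \<in> F" unfolding a1_def by (intro Fcl less.prems u b)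
      have "\<exists>h. P a1 h"
      proof (cases "val_ge w 0 a1")
        case True
        have "P a1 0" unfolding P_def using True Fcl(1) by (auto simp: val_ge_def)
        then show ?thesis by blast
      next
        case False
        then have "nat (- w a1) < nat (- w a)" using ge a0 by (auto simp: val_ge_def)
        then show ?thesis using less.hyps a1F by blast
      qed
      then obtain h where h: "P a1 h" by blast
      have eq: "a - wp (u * b + h) = a1 - wp h" by (simp add: wp_add a1_def)
      have "P a (u * b + h)" unfolding P_def eq
      proof (intro conjI allI impI)
        show "u * b + h \<in> F" using h u b by (auto simp: P_def intro!: Fcl)
        show "val_ge w 0 (a1 - wp h) \<or>
          (a1 - wp h \<noteq> 0 \<and> w (a1 - wp h) < 0 \<and> \<not> int p dvd w (a1 - wp h))"
          using h by (simp add: P_def)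
        fix n :: int assume n: "n \<le> 0" "val_ge w n a"
        then have "n \<le> w a" using a0 by (simp add: val_ge_def)
        then have "val_ge w n a1" using val_ge_mono[OF ge] by simp
        then show "val_ge w n (a1 - wp h)" using h n by (simp add: P_def)
      qed
      then show ?thesis by blast
    qed
  qed
  then show ?thesis using that unfolding P_def by blast
qed

text \<open>The solution is the limit of \<open>- a - a\<^sup>p - a\<^bsup>p\<^sup>2\<^esup> - \<dots>\<close>.\<close>

lemma wp_surj_maximal_ideal:
  assumes a: "a \<in> F" "val_ge w 1 a"
  obtains h where "h \<in> F" "val_ge w 1 h" "wp h = a"
proof -
  define s where "s n = - (\<Sum>k<n. a ^ (p ^ k))" for n
  have sF: "s n \<in> F" for n unfolding s_def by (intro Fcl a)
  have term_ge: "val_ge w (int k + 1) (a ^ (p ^ k))" for k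
  proof (rule val_ge_mono)
    show "val_ge w (int (p ^ k) * 1) (a ^ (p ^ k))" using a by (rule val_ge_power)
    have "k + 1 \<le> p ^ k"
    proof (induction k)
      case (Suc k)
      have "Suc k + 1 \<le> 2 * (k + 1)" by simp
      also have "\<dots> \<le> p * p ^ k" using Suc p_gt_1 by (intro mult_mono) auto
      finally show ?case by simp
    qed simp
    then show "int k + 1 \<le> int (p ^ k) * 1" by linarith
  qed
  have tail: "val_ge w (int n0) (s n - s n0)" if "n \<ge> n0" for n n0
    using that
  proof (induction n rule: dec_induct)
    case (step n)
    have eq: "s (Suc n) - s n0 = (s n - s n0) - a ^ (p ^ n)" by (simp add: s_def)
    have "val_ge w (int n0) (a ^ (p ^ n))"
      using step.hyps by (intro val_ge_mono[OF term_ge]) simp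
    then show ?case unfolding eq by (intro val_ge_diff Fcl sF a step.IH)
  qed simp
  have "\<exists>l\<in>F. \<forall>N. \<exists>n0. \<forall>n\<ge>n0. val_ge w N (s n - l)"
  proof (rule complete[unfolded valuation_complete_def, rule_format], intro conjI allI)
    show "s n \<in> F" for n by (rule sF)
    show "\<exists>n0. \<forall>m\<ge>n0. \<forall>n\<ge>n0. val_ge w N (s m - s n)" for N
    proof (intro exI allI impI)
      fix m n assume "m \<ge> nat N" "n \<ge> nat N"
      then have "val_ge w (int (nat N)) ((s m - s (nat N)) - (s n - s (nat N)))"
        by (intro val_ge_diff tail Fcl sF)
      then show "val_ge w N (s m - s n)" by (auto elim: val_ge_mono)
    qed
  qed
  then obtain l where l: "l \<in> F" "\<And>N. \<exists>n0. \<forall>n\<ge>n0. val_ge w N (s n - l)" by blast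
  have wps: "wp (s n) = a - a ^ (p ^ n)" for n
  proof (induction n)
    case 0
    then show ?case using p_gt_0 by (simp add: s_def)
  next
    case (Suc n)
    have "s (Suc n) = s n - a ^ (p ^ n)" by (simp add: s_def)
    then have "wp (s (Suc n)) = wp (s n) - wp (a ^ (p ^ n))" by (simp add: wp_diff)
    also have "\<dots> = a - a ^ (p ^ Suc n)" unfolding Suc by (simp flip: power_mult add: mult.commute)
    finally show ?case .
  qed
  have "wp l - a = 0"
  proof (rule eq_0_of_val_ge)
    fix N :: int
    define N' where "N' = max N 0"
    obtain n0 where n0: "\<And>n. n \<ge> n0 \<Longrightarrow> val_ge w N' (s n - l)" using l(2) by blast
    define n where "n = max n0 (nat N)"
    have eq: "wp l - a = - wp (s n - l) - a ^ (p ^ n)" using wps[of n] by (simp add: wp_diff)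
    have "val_ge w N (- wp (s n - l))"
      using val_ge_mono[OF val_ge_wp[of "s n - l" N']] n0[of n]
      by (intro val_ge_uminus Fcl sF l) (auto simp: N'_def n_def Fcl sF l)
    moreover have "val_ge w N (a ^ (p ^ n))" by (rule val_ge_mono[OF term_ge]) (auto simp: n_def)
    ultimately show "val_ge w N (wp l - a)" unfolding eq by (intro val_ge_diff Fcl sF a l)
  qed
  moreover have "val_ge w 1 l"
  proof -
    obtain n0 where n0: "\<And>n. n \<ge> n0 \<Longrightarrow> val_ge w 1 (s n - l)" using l(2) by blast
    have "val_ge w 1 (s n0)"
      unfolding s_def by (intro val_ge_uminus val_ge_sum Fcl a val_ge_mono[OF term_ge]) simp
    then have "val_ge w 1 (s n0 - (s n0 - l))"
      by (rule val_ge_diff[rotated 2]) (auto intro: n0 sF l Fcl)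
    then show ?thesis by simp
  qed
  ultimately show ?thesis using that l by auto
qed

end


section \<open>Totally ramified Artin-Schreier steps\<close>

text \<open>
  If \<open>y\<^sup>p - y\<close> has a pole of order \<open>b\<close> prime to \<open>p\<close>, then \<open>y\<close> should have valuation \<open>-b\<close> in the
  normalization that multiplies \<open>w\<close> by \<open>p\<close>, and the terms of \<open>\<Sum> c\<^sub>i y\<^sup>i\<close> have distinct valuations
  modulo \<open>p\<close>. So the valuation of the sum must be the minimum over its terms; \<open>M n\<close> is the set
  of elements for which this minimum is at least \<open>n\<close>.
\<close>

locale ramified_step = complete_dvf F w p for F :: "'a::field set" and w and p +
  fixes y :: 'a and b :: int
  assumes wp_y: "wp y \<in> F" "wp y \<noteq> 0" "w (wp y) = - b" and b: "b > 0" "\<not> int p dvd b"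
begin

lemma y_notin: "y \<notin> F"
proof
  assume y: "y \<in> F"
  have "\<not> val_ge w 0 (wp y)" using wp_y b by (auto simp: val_ge_def)
  then have "int p * w y = - b" using val_wp_neg[OF y] wp_y by simp
  then show False using b by (metis dvd_minus_iff dvd_triv_left)
qed

abbreviation "E \<equiv> adjoin F {y}"

lemma E: "subfield E \<Omega>" and F_sub_E: "F \<subseteq> E" and y_in_E: "y \<in> E"
  using adjoin_subfield subset_adjoin(1)[of F "{y}"] subset_adjoin(2)[of "{y}" F] by auto

lemmas Ecl = subfield_intros[OF E]

definition monval :: "nat \<Rightarrow> 'a \<Rightarrow> int" where
  "monval i c = int p * w c - int i * b"

definition M :: "int \<Rightarrow> 'a set" where
  "M n = {(\<Sum>i<p. c i * y ^ i) | c. (\<forall>i. c i \<in> F) \<and> (\<forall>i<p. c i = 0 \<or> n \<le> monval i (c i))}"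

lemma M_iff:
  assumes "\<forall>i. c i \<in> F"
  shows "(\<Sum>i<p. c i * y ^ i) \<in> M n \<longleftrightarrow> (\<forall>i<p. c i = 0 \<or> n \<le> monval i (c i))"
proof
  assume "(\<Sum>i<p. c i * y ^ i) \<in> M n"
  then obtain c' where c': "\<forall>i. c' i \<in> F" "\<forall>i<p. c' i = 0 \<or> n \<le> monval i (c' i)"
    "(\<Sum>i<p. c i * y ^ i) = (\<Sum>i<p. c' i * y ^ i)" by (auto simp: M_def)
  then show "\<forall>i<p. c i = 0 \<or> n \<le> monval i (c i)"
    using powers_unique[OF F y_notin wp_y(1) assms c'(1) c'(3)] by auto
qed (use assms in \<open>auto simp: M_def\<close>)

lemma E_iff: "e \<in> E \<longleftrightarrow> (\<exists>c. (\<forall>i. c i \<in> F) \<and> e = (\<Sum>i<p. c i * y ^ i))"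
  unfolding adjoin_eq_lin_span(1)[OF F y_notin wp_y(1)] lin_span_def by blast

lemma M_sub_E: "e \<in> M n \<Longrightarrow> e \<in> E"
  unfolding E_iff M_def by blast

lemma M_mono: "e \<in> M n \<Longrightarrow> m \<le> n \<Longrightarrow> e \<in> M m"
  unfolding M_def by (blast intro: order_trans)

lemma monval_ge_iff: "c = 0 \<or> n \<le> monval i c \<longleftrightarrow> val_ge w (- ((- n - int i * b) div int p)) c"
proof -
  have "n \<le> int p * x - int i * b \<longleftrightarrow> - ((- n - int i * b) div int p) \<le> x" for x
  proof -
    have "n \<le> int p * x - int i * b \<longleftrightarrow> int p * (- x) \<le> - n - int i * b" by (simp add: algebra_simps)
    also have "\<dots> \<longleftrightarrow> - x \<le> (- n - int i * b) div int p"
      using p_gt_0 zdiv_mono1[of "int p * (- x)" "- n - int i * b" "int p"]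
        div_mult_mod_eq[of "- n - int i * b" "int p"] pos_mod_sign[of "int p" "- n - int i * b"]
        mult_left_mono[of "- x" "(- n - int i * b) div int p" "int p"]
      by (smt (verit) mult.commute nonzero_mult_div_cancel_left of_nat_0_less_iff)
    finally show ?thesis by linarith
  qed
  then show ?thesis by (simp add: monval_def val_ge_def)
qed

lemma M_add: "e \<in> M n \<Longrightarrow> f \<in> M n \<Longrightarrow> e + f \<in> M n"
proof -
  assume "e \<in> M n" "f \<in> M n"
  then obtain c c' where c: "\<forall>i. c i \<in> F" "\<forall>i<p. c i = 0 \<or> n \<le> monval i (c i)" "e = (\<Sum>i<p. c i * y ^ i)"
    and c': "\<forall>i. c' i \<in> F" "\<forall>i<p. c' i = 0 \<or> n \<le> monval i (c' i)" "f = (\<Sum>i<p. c' i * y ^ i)"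
    unfolding M_def by blast
  have "e + f = (\<Sum>i<p. (c i + c' i) * y ^ i)" by (simp add: c(3) c'(3) sum.distrib distrib_right)
  moreover have "(\<Sum>i<p. (c i + c' i) * y ^ i) \<in> M n"
    using c c' by (subst M_iff) (auto simp: monval_ge_iff intro!: Fcl val_ge_add)
  ultimately show ?thesis by simp
qed

lemma M_uminus: "e \<in> M n \<Longrightarrow> - e \<in> M n"
proof -
  assume "e \<in> M n"
  then obtain c where c: "\<forall>i. c i \<in> F" "\<forall>i<p. c i = 0 \<or> n \<le> monval i (c i)" "e = (\<Sum>i<p. c i * y ^ i)"
    unfolding M_def by blast
  have "- e = (\<Sum>i<p. (- c i) * y ^ i)" by (simp add: c(3) sum_negf)
  moreover have "(\<Sum>i<p. (- c i) * y ^ i) \<in> M n"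
    using c by (subst M_iff) (auto simp: monval_def val_uminus intro!: Fcl)
  ultimately show ?thesis by simp
qed

lemma M_diff: "e \<in> M n \<Longrightarrow> f \<in> M n \<Longrightarrow> e - f \<in> M n"
  using M_add[of e n "- f"] M_uminus by simp

lemma M_0: "0 \<in> M n"
  using M_iff[of "\<lambda>_. 0" n] Fcl by simp

lemma M_sum: "(\<And>i. i \<in> A \<Longrightarrow> f i \<in> M n) \<Longrightarrow> sum f A \<in> M n"
  by (induction A rule: infinite_finite_induct) (auto simp: M_0 M_add)

lemma monomial_M_iff:
  assumes "c \<in> F" "i < p"
  shows "c * y ^ i \<in> M n \<longleftrightarrow> c = 0 \<or> n \<le> monval i c"
proof -
  let ?c = "\<lambda>j. if j = i then c else 0"
  have "(\<Sum>j<p. ?c j * y ^ j) = c * y ^ i"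
    using assms by (simp add: if_distrib[of "\<lambda>x. x * _"] sum.delta cong: if_cong)
  moreover have "(\<Sum>j<p. ?c j * y ^ j) \<in> M n \<longleftrightarrow> (\<forall>j<p. ?c j = 0 \<or> n \<le> monval j (?c j))"
    using assms Fcl by (intro M_iff) auto
  ultimately show ?thesis using assms by auto
qed

text \<open>
  For exponents \<open>k \<ge> p\<close> the relation \<open>y\<^sup>k = y\<^bsup>k-p+1\<^esup> + a y\<^bsup>k-p\<^esup>\<close> with \<open>w a = -b\<close> keeps
  the expected valuation in the second term and exceeds it in the first.
\<close>

lemma high_monomial:
  assumes c: "c \<in> F" "c \<noteq> 0" and k: "k \<le> 2 * p - 2"
  shows "c * y ^ k \<in> M (monval k c)" "c * y ^ k \<notin> M (monval k c + 1)"
proof -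
  have "c * y ^ k \<in> M (monval k c) \<and> c * y ^ k \<notin> M (monval k c + 1)"
  proof (cases "k < p")
    case True
    then show ?thesis using c by (simp add: monomial_M_iff)
  next
    case False
    define j where "j = k - p"
    define a where "a = wp y"
    have j: "k = j + p" "j + 1 < p" using False k p_gt_1 by (auto simp: j_def)
    have a: "a \<in> F" "a \<noteq> 0" "w a = - b" "y ^ p = y + a" using wp_y by (auto simp: a_def)
    have eq: "c * y ^ k = c * y ^ (j + 1) + (c * a) * y ^ j"
      by (simp add: j power_add a(4) algebra_simps)
    have v: "monval j (c * a) = monval k c"
      using c a by (simp add: monval_def val_mult j algebra_simps)
    have "monval k c + 1 \<le> monval (j + 1) c"
    proof -
      have "1 * 1 \<le> (int p - 1) * b" using b p_gt_1 by (intro mult_mono) auto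
      then show ?thesis by (simp add: monval_def j algebra_simps)
    qed
    then have first: "c * y ^ (j + 1) \<in> M (monval k c + 1)"
      using c j by (subst monomial_M_iff) auto
    have ca: "c * a \<in> F" "c * a \<noteq> 0" using c a Fcl by auto
    have s: "(c * a) * y ^ j \<in> M (monval k c)" "(c * a) * y ^ j \<notin> M (monval k c + 1)"
      using monomial_M_iff[OF ca(1), of j] ca(2) j v by auto
    have "c * y ^ k \<in> M (monval k c)"
      unfolding eq by (intro M_add s M_mono[OF first]) simp
    moreover have "c * y ^ k \<notin> M (monval k c + 1)"
      using M_diff[OF _ first, of "c * y ^ k"] s(2) unfolding eq by auto
    ultimately show ?thesis by blast
  qed
  then show "c * y ^ k \<in> M (monval k c)" "c * y ^ k \<notin> M (monval k c + 1)" by auto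
qed

lemma monval_mult:
  "c \<in> F \<Longrightarrow> c' \<in> F \<Longrightarrow> c \<noteq> 0 \<Longrightarrow> c' \<noteq> 0 \<Longrightarrow> monval (i + j) (c * c') = monval i c + monval j c'"
  by (simp add: monval_def val_mult algebra_simps)

lemma M_mult: "e \<in> M m \<Longrightarrow> f \<in> M n \<Longrightarrow> e * f \<in> M (m + n)"
proof -
  assume "e \<in> M m" "f \<in> M n"
  then obtain c c' where c: "\<forall>i. c i \<in> F" "\<forall>i<p. c i = 0 \<or> m \<le> monval i (c i)" "e = (\<Sum>i<p. c i * y ^ i)"
    and c': "\<forall>i. c' i \<in> F" "\<forall>i<p. c' i = 0 \<or> n \<le> monval i (c' i)" "f = (\<Sum>i<p. c' i * y ^ i)"
    unfolding M_def by blast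
  have "e * f = (\<Sum>i<p. \<Sum>j<p. (c i * c' j) * y ^ (i + j))"
    unfolding c(3) c'(3) sum_product power_add by (simp add: ac_simps)
  moreover have "(c i * c' j) * y ^ (i + j) \<in> M (m + n)" if ij: "i < p" "j < p" for i j
  proof (cases "c i = 0 \<or> c' j = 0")
    case False
    then have "m + n \<le> monval (i + j) (c i * c' j)" using c c' ij by (auto simp: monval_mult intro: add_mono)
    moreover have "(c i * c' j) * y ^ (i + j) \<in> M (monval (i + j) (c i * c' j))"
      using False c(1) c'(1) ij by (intro high_monomial) (auto intro: Fcl)
    ultimately show ?thesis by (rule M_mono[rotated])
  qed (auto simp: M_0)
  ultimately show ?thesis by (auto intro!: M_sum)
qed

lemma distinct_monval:
  assumes "i < p" "j < p" "monval i c = monval j c'"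
  shows "i = j"
proof -
  have "(int i - int j) * b = int p * (w c - w c')"
    using assms(3) by (simp add: monval_def algebra_simps)
  then have "int p dvd (int i - int j) * b" by simp
  then have "int p dvd int i - int j"
    using b(2) prime_p prime_dvd_mult_iff[of "int p" "int i - int j" b] by simp
  then have "int i mod int p = int j mod int p" by (simp add: mod_eq_dvd_iff)
  then show ?thesis using assms by simp
qed

lemma leading_term:
  assumes "e \<in> M n" "e \<notin> M (n + 1)"
  obtains i c where "i < p" "c \<in> F" "c \<noteq> 0" "monval i c = n" "e - c * y ^ i \<in> M (n + 1)"
proof -
  obtain c where c: "\<forall>i. c i \<in> F" "\<forall>i<p. c i = 0 \<or> n \<le> monval i (c i)" "e = (\<Sum>i<p. c i * y ^ i)"
    using assms(1) unfolding M_def by blast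
  obtain i where i: "i < p" "c i \<noteq> 0" "\<not> n + 1 \<le> monval i (c i)"
    using assms(2) unfolding c(3) M_iff[OF c(1)] by blast
  have vi: "monval i (c i) = n" using i c(2) by force
  have "e = c i * y ^ i + (\<Sum>j\<in>{..<p} - {i}. c j * y ^ j)"
    unfolding c(3) using i by (subst sum.remove[of _ i]) auto
  moreover have "c j * y ^ j \<in> M (n + 1)" if j: "j < p" "j \<noteq> i" for j
  proof (cases "c j = 0")
    case False
    then have "n \<le> monval j (c j)" "monval j (c j) \<noteq> n" using c(2) j vi i distinct_monval by auto
    then show ?thesis using c(1) j by (subst monomial_M_iff) auto
  qed (simp add: M_0)
  ultimately have "e - c i * y ^ i \<in> M (n + 1)" by (auto intro!: M_sum)
  then show ?thesis using that i c(1) vi by blast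
qed

text \<open>
  The leading terms of \<open>e\<close> and \<open>f\<close> multiply without loss of valuation, and all other products have
  strictly larger valuation.
\<close>

lemma exact_mult:
  assumes "e \<in> M m" "e \<notin> M (m + 1)" "f \<in> M n" "f \<notin> M (n + 1)"
  shows "e * f \<in> M (m + n)" "e * f \<notin> M (m + n + 1)"
proof -
  show "e * f \<in> M (m + n)" using assms by (intro M_mult)
  obtain i c where c: "i < p" "c \<in> F" "c \<noteq> 0" "monval i c = m" "e - c * y ^ i \<in> M (m + 1)"
    using leading_term[OF assms(1,2)] .
  obtain j d where d: "j < p" "d \<in> F" "d \<noteq> 0" "monval j d = n" "f - d * y ^ j \<in> M (n + 1)"
    using leading_term[OF assms(3,4)] .
  have "e * f - (c * d) * y ^ (i + j) = (e - c * y ^ i) * f + c * y ^ i * (f - d * y ^ j)"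
    by (simp add: power_add algebra_simps)
  moreover have "(e - c * y ^ i) * f \<in> M (m + n + 1)"
    using M_mult[OF c(5) assms(3)] by (simp add: ac_simps)
  moreover have "c * y ^ i \<in> M m" using c by (simp add: monomial_M_iff)
  then have "c * y ^ i * (f - d * y ^ j) \<in> M (m + n + 1)"
    using M_mult[OF _ d(5)] by (simp add: add.assoc)
  ultimately have diff: "e * f - (c * d) * y ^ (i + j) \<in> M (m + n + 1)" by (simp add: M_add)
  have "monval (i + j) (c * d) = m + n" using c d by (simp add: monval_mult)
  moreover have "(c * d) * y ^ (i + j) \<notin> M (monval (i + j) (c * d) + 1)"
    using c d by (intro high_monomial) (auto intro: Fcl)
  ultimately have "(c * d) * y ^ (i + j) \<notin> M (m + n + 1)" by simp
  then show "e * f \<notin> M (m + n + 1)"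
    using M_diff[OF _ diff, of "e * f"] by auto
qed

definition W :: "'a \<Rightarrow> int" where
  "W e = (SOME n. e \<in> M n \<and> e \<notin> M (n + 1))"

lemma W_M:
  assumes "e \<in> E" "e \<noteq> 0"
  shows "e \<in> M (W e)" "e \<notin> M (W e + 1)"
proof -
  obtain c where c: "\<forall>i. c i \<in> F" "e = (\<Sum>i<p. c i * y ^ i)" using assms(1) E_iff by blast
  define V where "V = (\<lambda>i. monval i (c i)) ` {i. i < p \<and> c i \<noteq> 0}"
  have "\<exists>i<p. c i \<noteq> 0"
  proof (rule ccontr)
    assume "\<not> ?thesis"
    then have "e = 0" unfolding c(2) by (intro sum.neutral) auto
    then show False using assms by simp
  qed
  then have V: "finite V" "V \<noteq> {}" by (auto simp: V_def)
  have "e \<in> M (Min V)" unfolding c(2) M_iff[OF c(1)] using V(1) by (auto simp: V_def intro!: Min_le)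
  moreover have "e \<notin> M (Min V + 1)"
    unfolding c(2) M_iff[OF c(1)] using Min_in[OF V] by (fastforce simp: V_def)
  ultimately have "e \<in> M (W e) \<and> e \<notin> M (W e + 1)" unfolding W_def by (intro someI conjI)
  then show "e \<in> M (W e)" "e \<notin> M (W e + 1)" by auto
qed

lemma W_eqI: "e \<in> M n \<Longrightarrow> e \<notin> M (n + 1) \<Longrightarrow> W e = n"
proof -
  assume e: "e \<in> M n" "e \<notin> M (n + 1)"
  then have "e \<in> E" "e \<noteq> 0" using M_sub_E M_0 by auto
  then have "\<not> W e + 1 \<le> n" "\<not> n + 1 \<le> W e" using e W_M[of e] M_mono[of e] by blast+
  then show ?thesis by simp
qed

lemma val_ge_W_iff: "e \<in> E \<Longrightarrow> val_ge W n e \<longleftrightarrow> e \<in> M n"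
proof (cases "e = 0")
  case False
  assume "e \<in> E"
  then have "e \<in> M n \<longleftrightarrow> n \<le> W e" using False W_M[of e] M_mono[of e "W e" n] M_mono[of e n "W e + 1"] by force
  then show ?thesis using False by (simp add: val_ge_def)
qed (simp add: val_ge_def M_0)

lemma W_F: "x \<in> F \<Longrightarrow> x \<noteq> 0 \<Longrightarrow> W x = int p * w x"
  using monomial_M_iff[of x 0] p_gt_0 by (intro W_eqI) (auto simp: monval_def)

lemma W_normalized: "normalized_valuation E W"
  unfolding normalized_valuation_def
proof (intro conjI ballI impI)
  show "W (x * z) = W x + W z" if "x \<in> E - {0}" "z \<in> E - {0}" for x z
    using exact_mult[of x "W x" z "W z"] W_M[of x] W_M[of z] that by (intro W_eqI) auto
  show "min (W x) (W z) \<le> W (x + z)" if "x \<in> E - {0}" "z \<in> E - {0}" "x + z \<noteq> 0" for x z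
  proof -
    have "x + z \<in> M (min (W x) (W z))"
      using W_M[of x] W_M[of z] that by (intro M_add) (auto elim: M_mono)
    then show ?thesis using val_ge_W_iff[of "x + z"] that by (auto simp: val_ge_def intro: Ecl)
  qed
  show "W ` (E - {0}) = UNIV"
  proof (intro equalityI subsetI)
    fix n :: int
    have "coprime b (int p)"
      using b(2) prime_imp_coprime[of "int p" b] prime_p by (simp add: coprime_commute)
    \<comment> \<open>The monomial \<open>c y\<^sup>i\<close> has valuation \<open>n\<close> for \<open>i \<equiv> - n / b\<close> modulo \<open>p\<close>.\<close>
    then obtain s t where st: "s * b + t * int p = 1"
      using bezout_int[of b "int p"] by (auto simp: coprime_iff_gcd_eq_1)
    define i where "i = nat ((- n * s) mod int p)"
    have i: "int i = (- n * s) mod int p" "i < p" using p_gt_0 by (auto simp: i_def nat_less_iff)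
    define k where "k = (- n * s) div int p"
    have ik: "int i = - n * s - int p * k" unfolding i(1) k_def by (rule minus_mult_div_eq_mod[symmetric])
    have "n + int i * b = n * (1 - s * b) - int p * (k * b)" unfolding ik by (simp add: algebra_simps)
    also have "1 - s * b = t * int p" using st by simp
    also have "n * (t * int p) - int p * (k * b) = int p * (n * t - k * b)" by (simp add: algebra_simps)
    finally obtain m where m: "n + int i * b = int p * m" by blast
    obtain c where c: "c \<in> F" "c \<noteq> 0" "w c = m" by (rule ex_val)
    have "monval i c = n" using m c by (simp add: monval_def)
    then have "W (c * y ^ i) = n" using c i monomial_M_iff[of c i] by (intro W_eqI) auto
    moreover have "c * y ^ i \<in> E - {0}"
    proof -
      have "c * y ^ i \<in> E" using c F_sub_E y_in_E by (intro Ecl) auto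
      moreover have "y \<noteq> 0" using y_notin Fcl by auto
      ultimately show ?thesis using c by simp
    qed
    ultimately show "n \<in> W ` (E - {0})" by (metis imageI)
  qed simp
qed

text \<open>
  A sequence is Cauchy for \<open>W\<close> if and only if its \<open>p\<close> coordinate sequences are Cauchy for \<open>w\<close>.
\<close>

lemma W_complete: "valuation_complete E W"
  unfolding valuation_complete_def
proof (intro allI impI, elim conjE)
  fix s :: "nat \<Rightarrow> 'a"
  assume sE: "\<forall>n. s n \<in> E" and cauchy: "\<forall>N. \<exists>n0. \<forall>m\<ge>n0. \<forall>n\<ge>n0. val_ge W N (s m - s n)"
  have "\<forall>n. \<exists>c. (\<forall>i. c i \<in> F) \<and> s n = (\<Sum>i<p. c i * y ^ i)" using sE E_iff by blast
  then obtain c where c: "\<And>n i. c n i \<in> F" "\<And>n. s n = (\<Sum>i<p. c n i * y ^ i)" by metis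
  have diff: "val_ge W N (s m - (\<Sum>i<p. l i * y ^ i)) \<longleftrightarrow> (\<forall>i<p. c m i - l i = 0 \<or> N \<le> monval i (c m i - l i))"
    if l: "\<And>i. l i \<in> F" for m l N
  proof -
    have eq: "s m - (\<Sum>i<p. l i * y ^ i) = (\<Sum>i<p. (c m i - l i) * y ^ i)"
      by (simp add: c left_diff_distrib sum_subtractf)
    have F': "\<forall>i. c m i - l i \<in> F" using c l by (auto intro: Fcl)
    then have "(\<Sum>i<p. (c m i - l i) * y ^ i) \<in> E" unfolding E_iff by (intro exI[of _ "\<lambda>i. c m i - l i"]) simp
    then show ?thesis unfolding eq by (simp only: val_ge_W_iff M_iff[OF F'])
  qed
  have "\<exists>l\<in>F. \<forall>N. \<exists>n0. \<forall>n\<ge>n0. val_ge w N (c n i - l)" if i: "i < p" for i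
  proof (rule complete[unfolded valuation_complete_def, rule_format], intro conjI allI)
    show "c n i \<in> F" for n by (rule c)
    fix N
    obtain n0 where n0: "\<And>m n. m \<ge> n0 \<Longrightarrow> n \<ge> n0 \<Longrightarrow> val_ge W (int p * N) (s m - s n)"
      using cauchy by blast
    have "val_ge w N (c m i - c n i)" if "m \<ge> n0" "n \<ge> n0" for m n
    proof (cases "c m i - c n i = 0")
      case False
      have "int p * N \<le> monval i (c m i - c n i)"
        using n0[OF that] i False unfolding c(2)[of n] diff[OF c(1)] by blast
      moreover have "0 \<le> int i * b" using b by simp
      ultimately have "int p * N \<le> int p * w (c m i - c n i)" unfolding monval_def by linarith
      then show ?thesis using p_gt_0 by (simp add: val_ge_def)
    qed (simp add: val_ge_def)
    then show "\<exists>n0. \<forall>m\<ge>n0. \<forall>n\<ge>n0. val_ge w N (c m i - c n i)" by blast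
  qed
  then have "\<forall>i. \<exists>l. i < p \<longrightarrow> l \<in> F \<and> (\<forall>N. \<exists>n0. \<forall>n\<ge>n0. val_ge w N (c n i - l))" by blast
  then obtain l0 where l0: "\<And>i. i < p \<Longrightarrow> l0 i \<in> F" "\<And>i N. i < p \<Longrightarrow> \<exists>n0. \<forall>n\<ge>n0. val_ge w N (c n i - l0 i)"
    by metis
  define l where "l i = (if i < p then l0 i else 0)" for i
  have l: "l i \<in> F" for i using l0 Fcl by (simp add: l_def)
  show "\<exists>x\<in>E. \<forall>N. \<exists>n0. \<forall>n\<ge>n0. val_ge W N (s n - x)"
  proof (intro bexI allI)
    show "(\<Sum>i<p. l i * y ^ i) \<in> E" unfolding E_iff using l by (intro exI[of _ l]) simp
    fix N :: int
    define N' where "N' = \<bar>N\<bar> + int p * b"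
    have "\<forall>i. \<exists>n0. i < p \<longrightarrow> (\<forall>n\<ge>n0. val_ge w N' (c n i - l i))" using l0(2) by (auto simp: l_def)
    then obtain n0 where n0: "\<And>i n. i < p \<Longrightarrow> n \<ge> n0 i \<Longrightarrow> val_ge w N' (c n i - l i)" by metis
    have "val_ge W N (s n - (\<Sum>i<p. l i * y ^ i))" if n: "n \<ge> Max (n0 ` {..<p})" for n
      unfolding diff[OF l]
    proof (intro allI impI)
      fix i assume i: "i < p"
      then have "n0 i \<le> Max (n0 ` {..<p})" by (intro Max_ge) auto
      then have "n0 i \<le> n" using n by simp
      then have ge: "val_ge w N' (c n i - l i)" using n0 i by blast
      show "c n i - l i = 0 \<or> N \<le> monval i (c n i - l i)"
      proof (cases "c n i - l i = 0")
        case False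
        then have "N' \<le> w (c n i - l i)" using ge by (simp add: val_ge_def)
        moreover have "0 \<le> N'" using b by (simp add: N'_def)
        moreover have "1 \<le> int p" using p_gt_0 by simp
        ultimately have "1 * N' \<le> int p * w (c n i - l i)" by (intro mult_mono) auto
        moreover have "int i * b \<le> int p * b" using i b by (intro mult_right_mono) auto
        moreover have "N \<le> r - t" if "1 * (\<bar>N\<bar> + q) \<le> r" "t \<le> q" for r q t :: int
          using that abs_ge_self[of N] by simp
        ultimately have "N \<le> monval i (c n i - l i)" unfolding monval_def N'_def by blast
        then show ?thesis by simp
      qed simp
    qed
    then show "\<exists>n0. \<forall>n\<ge>n0. val_ge W N (s n - (\<Sum>i<p. l i * y ^ i))" by blast
  qed
qed

text \<open>
  Only the constant term can have valuation \<open>0\<close>, since the valuations of the terms are distinct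
  modulo \<open>p\<close>.
\<close>

lemma residue_from_F:
  assumes "e \<in> E" "val_ge W 0 e"
  obtains x where "x \<in> F" "val_ge w 0 x" "val_ge W 1 (e - x)"
proof -
  obtain c where c: "\<forall>i. c i \<in> F" "e = (\<Sum>i<p. c i * y ^ i)" using assms(1) E_iff by blast
  have ge: "\<forall>i<p. c i = 0 \<or> 0 \<le> monval i (c i)"
  proof -
    have "e \<in> M 0" using assms val_ge_W_iff by blast
    then show ?thesis unfolding c(2) M_iff[OF c(1)] .
  qed
  have "c i * y ^ i \<in> M 1" if i: "i < p" "i \<noteq> 0" for i
  proof (cases "c i = 0")
    case False
    have "monval i (c i) \<noteq> 0"
    proof
      assume "monval i (c i) = 0"
      then have "monval i (c i) = monval 0 1" by (simp add: monval_def val_1)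
      then show False using distinct_monval[of i 0] i p_gt_0 by blast
    qed
    then have "1 \<le> monval i (c i)" using ge i False by force
    then show ?thesis using c i by (subst monomial_M_iff) auto
  qed (simp add: M_0)
  then have "(\<Sum>i\<in>{..<p} - {0}. c i * y ^ i) \<in> M 1" by (intro M_sum) auto
  moreover have "e = c 0 * y ^ 0 + (\<Sum>i\<in>{..<p} - {0}. c i * y ^ i)"
    unfolding c(2) using p_gt_0 by (subst sum.remove[of _ 0]) auto
  ultimately have "e - c 0 \<in> M 1" by simp
  then have "val_ge W 1 (e - c 0)" using val_ge_W_iff M_sub_E by blast
  moreover have "val_ge w 0 (c 0)"
    using ge p_gt_0 by (auto simp: val_ge_def monval_def zero_le_mult_iff)
  ultimately show ?thesis using that c(1) by blast
qed

lemma complete_dvf_step: "complete_dvf E W p"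
proof -
  interpret V: valued_subfield E W by (rule valued_subfield.intro[OF E W_normalized])
  show ?thesis
  proof (intro complete_dvf.intro complete_dvf_axioms.intro V.valued_subfield_axioms)
    show "CHAR('a) = p" by (rule char_eq)
    show "Factorial_Ring.prime p" by (rule char_prime)
    show "valuation_complete E W" by (rule W_complete)
    have up: "val_ge W n x" if "x \<in> F" "val_ge w n x" "n \<ge> 0" for x n
    proof (cases "x = 0")
      case False
      then have "n \<le> w x" using that by (simp add: val_ge_def)
      moreover have "1 \<le> int p" using p_gt_0 by simp
      ultimately have "1 * n \<le> int p * w x" using that by (intro mult_mono) auto
      then show ?thesis using W_F[OF that(1) False] by (simp add: val_ge_def)
    qed simp
    fix a assume a: "a \<in> E" "val_ge W 0 a"
    obtain x where x: "x \<in> F" "val_ge w 0 x" "val_ge W 1 (a - x)" using residue_from_F[OF a] .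
    obtain z where z: "z \<in> F" "val_ge w 0 z" "val_ge w 1 (x - z ^ p)"
      using residue_perfect[OF x(1,2)] by blast
    have xz: "x - z ^ p \<in> F" by (intro Fcl x z)
    have "val_ge W 1 (x - z ^ p)" by (rule up[OF xz z(3)]) simp
    moreover have "x \<in> E" "x - z ^ p \<in> E" using subsetD[OF F_sub_E] x(1) xz by auto
    ultimately have "val_ge W 1 ((a - x) + (x - z ^ p))"
      using V.val_ge_add[OF subfield_diff[OF E a(1)] _ x(3)] by blast
    then have "val_ge W 1 (a - z ^ p)" by simp
    moreover have "val_ge W 0 z" by (rule up[OF z(1,2)]) simp
    ultimately show "\<exists>b\<in>E. val_ge W 0 b \<and> val_ge W 1 (a - b ^ p)" using subsetD[OF F_sub_E z(1)] by blast
  qed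
qed

end


section \<open>Presentations of the groups of order \<open>p\<^sup>3\<close>\<close>

fun letter_val :: "('b, 'm) monoid_scheme \<Rightarrow> 'b \<Rightarrow> 'b \<Rightarrow> gen \<times> bool \<Rightarrow> 'b" where
  "letter_val \<Gamma> a b (g, e) =
     (let x = (case g of Gen1 \<Rightarrow> a | Gen2 \<Rightarrow> b) in if e then inv\<^bsub>\<Gamma>\<^esub> x else x)"

definition word_val :: "('b, 'm) monoid_scheme \<Rightarrow> 'b \<Rightarrow> 'b \<Rightarrow> gword \<Rightarrow> 'b" where
  "word_val \<Gamma> a b w = foldr (\<lambda>l x. letter_val \<Gamma> a b l \<otimes>\<^bsub>\<Gamma>\<^esub> x) w \<one>\<^bsub>\<Gamma>\<^esub>"

lemma word_val_simps [simp]: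
  "word_val \<Gamma> a b [] = \<one>\<^bsub>\<Gamma>\<^esub>"
  "word_val \<Gamma> a b (l # w) = letter_val \<Gamma> a b l \<otimes>\<^bsub>\<Gamma>\<^esub> word_val \<Gamma> a b w"
  by (simp_all add: word_val_def)

locale two_elements = group \<Gamma> for \<Gamma> :: "('b, 'm) monoid_scheme" (structure) +
  fixes a b
  assumes a [simp]: "a \<in> carrier \<Gamma>" and b [simp]: "b \<in> carrier \<Gamma>"
begin

abbreviation wv where "wv \<equiv> word_val \<Gamma> a b"

lemma letter_val_closed [simp]: "letter_val \<Gamma> a b l \<in> carrier \<Gamma>"
  by (cases l) (auto simp: Let_def split: gen.splits)

lemma wv_closed [simp]: "wv w \<in> carrier \<Gamma>"
  by (induction w) auto

lemma wv_append: "wv (u @ v) = wv u \<otimes> wv v"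
  by (induction u) (auto simp: m_assoc)

lemma wv_letters: "wv w1 = a" "wv w2 = b"
  by (simp_all add: w1_def w2_def)

lemma wv_inv: "wv (w_inv w) = inv (wv w)"
proof (induction w)
  case Nil
  show ?case by (simp add: w_inv_def)
next
  case (Cons l w)
  obtain g e where l: "l = (g, e)" by (cases l)
  have "w_inv (l # w) = w_inv w @ [(g, \<not> e)]" by (simp add: w_inv_def l)
  moreover have "letter_val \<Gamma> a b (g, \<not> e) = inv (letter_val \<Gamma> a b (g, e))"
    by (cases g; cases e) simp_all
  ultimately show ?case
    using Cons letter_val_closed[of l] letter_val_closed[of "(g, \<not> e)"]
    by (simp add: wv_append inv_mult_group l del: letter_val.simps)
qed

lemma wv_pow: "wv (w_pow w n) = wv w [^] n"
  by (induction n) (simp_all add: w_pow_def wv_append nat_pow_Suc2[symmetric] flip: nat_pow_Suc2)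

lemma wv_comm: "wv (w_comm u v) = group_comm \<Gamma> (wv u) (wv v)"
  by (simp add: w_comm_def wv_append wv_inv group_comm_def m_assoc)

lemma wv_word_eq:
  assumes "\<And>u v. (u, v) \<in> R \<Longrightarrow> wv u = wv v"
  shows "word_eq R u v \<Longrightarrow> wv u = wv v"
proof (induction rule: word_eq.induct)
  case (cancel g e)
  show ?case by (cases g; cases e) simp_all
qed (auto simp: wv_append assms)

lemma presented_group_hom:
  assumes "\<And>u v. (u, v) \<in> R \<Longrightarrow> wv u = wv v"
  obtains h where "h \<in> hom (presented_group R) \<Gamma>" "\<And>w. h (word_class R w) = wv w"
proof -
  define h where "h A = wv (SOME w. A = word_class R w)" for A
  have h: "h (word_class R w) = wv w" for w
  proof -
    have "word_class R w = word_class R (SOME w'. word_class R w = word_class R w')"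
      by (rule someI[of _ w]) (rule HOL.refl)
    then show ?thesis unfolding h_def using wv_word_eq[OF assms] by (simp add: word_class_eq_iff)
  qed
  have "h \<in> hom (presented_group R) \<Gamma>"
  proof (rule homI)
    fix x y assume "x \<in> carrier (presented_group R)" "y \<in> carrier (presented_group R)"
    then obtain u v where "x = word_class R u" "y = word_class R v"
      by (auto simp: presented_group_def)
    then show "h (x \<otimes>\<^bsub>presented_group R\<^esub> y) = h x \<otimes> h y"
      by (simp add: presented_group_mult h wv_append)
  qed (auto simp: presented_group_def h)
  then show ?thesis using that h by blast
qed

end

text \<open>
  All four groups are the quotients of the free group by \<open>\<sigma>\<^sub>1\<^sup>p = \<sigma>\<^sub>3\<^bsup>e1\<^esup>\<close>,
  \<open>\<sigma>\<^sub>2\<^sup>p = \<sigma>\<^sub>3\<^bsup>e2\<^esup>\<close>, \<open>\<sigma>\<^sub>3\<^sup>p = 1\<close> with \<open>\<sigma>\<^sub>3 = [\<sigma>\<^sub>1, \<sigma>\<^sub>2]\<close> central, for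
  exponents \<open>e1, e2 \<le> 1\<close>. This allows a uniform treatment.
\<close>

definition exp1 :: "nonabelian_p3 \<Rightarrow> nat" where
  "exp1 G = (case G of Q8 \<Rightarrow> 1 | D8 \<Rightarrow> 1 | Hp3 \<Rightarrow> 0 | Mp3 \<Rightarrow> 1)"

definition exp2 :: "nonabelian_p3 \<Rightarrow> nat" where
  "exp2 G = (case G of Q8 \<Rightarrow> 1 | D8 \<Rightarrow> 0 | Hp3 \<Rightarrow> 0 | Mp3 \<Rightarrow> 0)"

locale class2_relations = two_elements \<Gamma> a b for \<Gamma> :: "('b, 'm) monoid_scheme" (structure) and a b +
  fixes c and p e1 e2 :: nat
  assumes c [simp]: "c \<in> carrier \<Gamma>" and p0: "p > 0"
    and ab: "a \<otimes> b = b \<otimes> a \<otimes> c"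
    and ac: "a \<otimes> c = c \<otimes> a" and bc: "b \<otimes> c = c \<otimes> b"
    and ap: "a [^] p = c [^] e1" and bp: "b [^] p = c [^] e2" and cp: "c [^] p = \<one>"
begin

lemma c_eq_comm: "c = group_comm \<Gamma> a b"
proof -
  have "inv a \<otimes> inv b \<otimes> a \<otimes> b = inv a \<otimes> inv b \<otimes> (b \<otimes> a \<otimes> c)"
    using ab by (simp add: m_assoc)
  also have "\<dots> = inv (b \<otimes> a) \<otimes> (b \<otimes> a) \<otimes> c" by (simp add: inv_mult_group m_assoc)
  finally show ?thesis by (simp add: group_comm_def)
qed

lemma pow_comm_c: "x \<in> carrier \<Gamma> \<Longrightarrow> x \<otimes> c = c \<otimes> x \<Longrightarrow> x [^] (i::nat) \<otimes> c [^] (k::nat) = c [^] k \<otimes> x [^] i"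
proof -
  assume x: "x \<in> carrier \<Gamma>" "x \<otimes> c = c \<otimes> x"
  have "x [^] i \<otimes> c = c \<otimes> x [^] i" for i :: nat
  proof (induction i)
    case (Suc i)
    have "x [^] Suc i \<otimes> c = x [^] i \<otimes> (x \<otimes> c)" using x by (simp add: m_assoc)
    also have "\<dots> = x [^] i \<otimes> c \<otimes> x" using x by (simp add: m_assoc)
    also have "\<dots> = c \<otimes> x [^] Suc i" using x by (simp add: Suc m_assoc)
    finally show ?case .
  qed (use x in simp)
  note 1 = this
  show ?thesis
  proof (induction k)
    case (Suc k)
    have "x [^] i \<otimes> c [^] Suc k = (x [^] i \<otimes> c [^] k) \<otimes> c" using x by (simp add: m_assoc)
    also have "\<dots> = c [^] k \<otimes> (x [^] i \<otimes> c)" using x by (simp add: Suc m_assoc)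
    also have "\<dots> = c [^] Suc k \<otimes> x [^] i" using x by (simp add: 1 m_assoc)
    finally show ?case .
  qed (use x in simp)
qed

lemma bc_pow: "b [^] (j::nat) \<otimes> c [^] (k::nat) = c [^] k \<otimes> b [^] j"
  using pow_comm_c[of b] bc by simp

lemma ba_pow: "b \<otimes> a [^] (i::nat) = a [^] i \<otimes> b \<otimes> c [^] ((p - 1) * i)"
proof -
  have ba: "b \<otimes> a = a \<otimes> b \<otimes> c [^] (p - 1)"
  proof -
    have "a \<otimes> b \<otimes> c [^] (p - 1) = b \<otimes> a \<otimes> (c \<otimes> c [^] (p - 1))" unfolding ab by (simp add: m_assoc)
    also have "c \<otimes> c [^] (p - 1) = c [^] p" using p0 nat_pow_Suc2[of c "p - 1"] by simp
    finally show ?thesis by (simp add: cp)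
  qed
  show ?thesis
  proof (induction i)
    case (Suc i)
    have "b \<otimes> a [^] Suc i = (b \<otimes> a [^] i) \<otimes> a" by (simp add: m_assoc)
    also have "\<dots> = a [^] i \<otimes> b \<otimes> (c [^] ((p - 1) * i) \<otimes> a)" by (simp add: Suc m_assoc)
    also have "c [^] ((p - 1) * i) \<otimes> a = a \<otimes> c [^] ((p - 1) * i)"
      using pow_comm_c[of a 1 "(p - 1) * i"] ac by simp
    also have "a [^] i \<otimes> b \<otimes> (a \<otimes> c [^] ((p - 1) * i)) = a [^] i \<otimes> (b \<otimes> a) \<otimes> c [^] ((p - 1) * i)"
      by (simp add: m_assoc)
    also have "\<dots> = a [^] Suc i \<otimes> b \<otimes> (c [^] (p - 1) \<otimes> c [^] ((p - 1) * i))"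
      by (simp add: ba m_assoc)
    also have "c [^] (p - 1) \<otimes> c [^] ((p - 1) * i) = c [^] ((p - 1) * Suc i)"
      by (simp add: nat_pow_mult)
    finally show ?case .
  qed simp
qed

definition nf :: "nat \<Rightarrow> nat \<Rightarrow> nat \<Rightarrow> 'b" where
  "nf i j k = a [^] i \<otimes> b [^] j \<otimes> c [^] k"

lemma a_nf: "a \<otimes> nf i j k = nf (Suc i) j k"
proof -
  have "a \<otimes> a [^] i = a [^] Suc i" using nat_pow_Suc2[of a i] by simp
  then show ?thesis unfolding nf_def by (simp add: m_assoc[symmetric] del: nat_pow_Suc)
qed

lemma b_nf: "b \<otimes> nf i j k = nf i (Suc j) ((p - 1) * i + k)"
proof -
  have "b \<otimes> nf i j k = (b \<otimes> a [^] i) \<otimes> (b [^] j \<otimes> c [^] k)" by (simp add: nf_def m_assoc)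
  also have "\<dots> = a [^] i \<otimes> b \<otimes> (c [^] ((p - 1) * i) \<otimes> b [^] j) \<otimes> c [^] k" by (simp add: ba_pow m_assoc)
  also have "\<dots> = a [^] i \<otimes> (b \<otimes> b [^] j) \<otimes> (c [^] ((p - 1) * i) \<otimes> c [^] k)"
    by (simp add: bc_pow[symmetric] m_assoc)
  also have "b \<otimes> b [^] j = b [^] Suc j" using nat_pow_Suc2[of b j] by simp
  finally show ?thesis by (simp add: nf_def nat_pow_mult)
qed

lemma pow_nf:
  assumes "x = a \<or> x = b"
  shows "\<exists>i' j' k'. x [^] (n::nat) \<otimes> nf i j k = nf i' j' k'"
proof (induction n)
  case (Suc n)
  then obtain i' j' k' where "x [^] n \<otimes> nf i j k = nf i' j' k'" by blast
  moreover have "nf i j k \<in> carrier \<Gamma>" "x \<in> carrier \<Gamma>" using assms by (auto simp: nf_def)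
  ultimately have "x [^] Suc n \<otimes> nf i j k = x \<otimes> nf i' j' k'"
    by (simp only: nat_pow_Suc2 m_assoc nat_pow_closed)
  then show ?case using assms a_nf b_nf by metis
qed (auto simp: nf_def)

lemma inv_eq_pow:
  assumes "x = a \<or> x = b"
  shows "inv x = x [^] (p * p - 1)"
proof -
  obtain e where x: "x \<in> carrier \<Gamma>" "x [^] p = c [^] (e::nat)" using assms ap bp by auto
  have "x [^] (p * p) = (c [^] e) [^] p" using x by (simp add: nat_pow_pow[symmetric])
  also have "\<dots> = (c [^] p) [^] e" by (simp add: nat_pow_pow mult.commute)
  finally have "x [^] (p * p) = \<one>" by (simp add: cp)
  moreover have "x [^] (p * p - 1) \<otimes> x = x [^] (p * p)"
    using p0 nat_pow_Suc[of x "p * p - 1"] by simp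
  ultimately show ?thesis using x by (intro inv_equality) auto
qed

text \<open>
  Both generators have order dividing \<open>p\<^sup>2\<close>, so inverses are positive powers, and it suffices that
  the set of elements \<open>a\<^sup>i b\<^sup>j c\<^sup>k\<close> is stable under multiplication by \<open>a\<close> and \<open>b\<close> from the left.
\<close>

lemma wv_nf: "\<exists>i j k. wv w = nf i j k"
proof (induction w)
  case Nil
  show ?case by (auto simp: nf_def intro!: exI[of _ 0])
next
  case (Cons l w)
  then obtain i j k where w: "wv w = nf i j k" by blast
  obtain g e where l: "l = (g, e)" by (cases l)
  define x where "x = (case g of Gen1 \<Rightarrow> a | Gen2 \<Rightarrow> b)"
  have x: "x = a \<or> x = b" "x \<in> carrier \<Gamma>" by (auto simp: x_def split: gen.splits)
  have "letter_val \<Gamma> a b l = x [^] (if e then p * p - 1 else 1)"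
    using x inv_eq_pow by (simp add: l x_def[symmetric])
  then show ?case using pow_nf[OF x(1)] by (simp add: w)
qed

lemma nf_mod: "\<exists>i'<p. \<exists>j'<p. \<exists>k'<p. nf i j k = nf i' j' k'"
proof -
  have x: "x [^] i = x [^] (i mod p) \<otimes> c [^] (e * (i div p))"
    if "x \<in> carrier \<Gamma>" "x [^] p = c [^] e" for x and i e :: nat
  proof -
    have "x [^] i = x [^] (i mod p) \<otimes> x [^] (p * (i div p))" using that by (simp add: nat_pow_mult)
    also have "x [^] (p * (i div p)) = (x [^] p) [^] (i div p)" using that(1) by (simp add: nat_pow_pow)
    finally show ?thesis unfolding that(2) by (simp add: nat_pow_pow)
  qed
  have c_mod: "c [^] n = c [^] (n mod p)" for n :: nat using x[of c 0 n] cp by simp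
  define m where "m = e1 * (i div p) + e2 * (j div p) + k"
  have "nf i j k = a [^] (i mod p) \<otimes> c [^] (e1 * (i div p)) \<otimes> (b [^] (j mod p) \<otimes> c [^] (e2 * (j div p))) \<otimes> c [^] k"
    unfolding nf_def x[OF a ap, of i] x[OF b bp, of j] ..
  also have "\<dots> = a [^] (i mod p) \<otimes> (c [^] (e1 * (i div p)) \<otimes> b [^] (j mod p)) \<otimes> (c [^] (e2 * (j div p)) \<otimes> c [^] k)"
    by (simp add: m_assoc)
  also have "\<dots> = a [^] (i mod p) \<otimes> b [^] (j mod p) \<otimes> (c [^] (e1 * (i div p)) \<otimes> (c [^] (e2 * (j div p)) \<otimes> c [^] k))"
    unfolding bc_pow[symmetric] by (simp add: m_assoc)
  also have "\<dots> = nf (i mod p) (j mod p) m" by (simp add: nf_def nat_pow_mult m_def add.assoc)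
  also have "\<dots> = nf (i mod p) (j mod p) (m mod p)" unfolding nf_def using c_mod[of m] by simp
  finally show ?thesis using p0 mod_less_divisor by metis
qed

lemma c_central_wv: "c \<otimes> wv w = wv w \<otimes> c"
proof -
  have x: "c \<otimes> x [^] (n::nat) = x [^] n \<otimes> c" if "x \<in> carrier \<Gamma>" "x \<otimes> c = c \<otimes> x" for x n
    using pow_comm_c[OF that, of n 1] by simp
  show ?thesis
  proof -
    obtain i j k where w: "wv w = nf i j k" using wv_nf by blast
    have "c \<otimes> nf i j k = (c \<otimes> a [^] i) \<otimes> b [^] j \<otimes> c [^] k" by (simp add: nf_def m_assoc)
    also have "\<dots> = a [^] i \<otimes> (c \<otimes> b [^] j) \<otimes> c [^] k" using x[of a i] ac by (simp add: m_assoc)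
    also have "\<dots> = a [^] i \<otimes> b [^] j \<otimes> (c \<otimes> c [^] k)" using x[of b j] bc by (simp add: m_assoc)
    also have "c \<otimes> c [^] k = c [^] k \<otimes> c" using nat_pow_Suc2[of c k] by simp
    finally show ?thesis by (simp add: w nf_def m_assoc)
  qed
qed

lemma p3_relations_hold:
  assumes "available_for p G" "e1 = exp1 G" "e2 = exp2 G" "(u, v) \<in> p3_relations p G"
  shows "wv u = wv v"
proof -
  have "(a [^] p) [^] p = (c [^] p) [^] e1" unfolding ap by (simp add: nat_pow_pow mult.commute)
  then have app: "a [^] (p * p) = \<one>" by (simp add: nat_pow_pow cp)
  note ev = wv_pow wv_comm wv_letters c_eq_comm[symmetric]
  show ?thesis
  proof (cases G)
    case Q8
    then show ?thesis using assms app ap bp by (auto simp: ev available_for_def exp1_def exp2_def)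
  next
    case D8
    then show ?thesis using assms app ap bp by (auto simp: ev available_for_def exp1_def exp2_def)
  next
    case Hp3
    then show ?thesis using assms ap bp cp c_central_wv
      by (auto simp: ev wv_append available_for_def exp1_def exp2_def)
  next
    case Mp3
    then show ?thesis using assms app ap bp
      by (auto simp: ev available_for_def exp1_def exp2_def power2_eq_square)
  qed
qed

end

text \<open>
  Conversely the presentations imply the uniform relations. The only point that needs an argument
  is that \<open>\<sigma>\<^sub>3 = \<sigma>\<^sub>1\<^sup>p\<close> commutes with \<open>\<sigma>\<^sub>2\<close> for \<open>D\<^sub>8\<close> and \<open>M(p\<^sup>3)\<close>: conjugation by \<open>\<sigma>\<^sub>2\<close> raises
  \<open>\<sigma>\<^sub>1\<close> to the power \<open>p + 1\<close>, hence \<open>\<sigma>\<^sub>1\<^sup>p\<close> to the power \<open>p + 1 \<equiv> 1\<close> modulo its order.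
\<close>

lemma (in two_elements) class2_relations_of_presentation:
  assumes G: "available_for p G" and rel: "\<And>u v. (u, v) \<in> p3_relations p G \<Longrightarrow> wv u = wv v"
  shows "class2_relations \<Gamma> a b (group_comm \<Gamma> a b) p (exp1 G) (exp2 G)"
proof -
  define c where "c = group_comm \<Gamma> a b"
  have c [simp]: "c \<in> carrier \<Gamma>" by (simp add: c_def group_comm_def)
  have p0: "p > 0" using G by (auto simp: available_for_def)
  have ab: "a \<otimes> b = b \<otimes> a \<otimes> c"
  proof -
    have cancel: "x \<otimes> (inv x \<otimes> z) = z" if "x \<in> carrier \<Gamma>" "z \<in> carrier \<Gamma>" for x z
      using that by (simp add: m_assoc[symmetric])
    show ?thesis unfolding c_def group_comm_def by (simp add: m_assoc cancel)
  qed
  note ev = wv_pow wv_comm wv_letters c_def[symmetric]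
  have commutes: "x \<otimes> c = c \<otimes> x" if "x \<in> carrier \<Gamma>" "x [^] n = c" for x and n :: nat
    using that(1) nat_pow_Suc2[of x n] nat_pow_Suc[of x n] unfolding that(2)[symmetric] by simp
  have M: "b \<otimes> c = c \<otimes> b" if "a [^] p = c" "a [^] (p * p) = \<one>"
  proof -
    have "a \<otimes> b = b \<otimes> a [^] (p + 1)"
      unfolding ab that(1)[symmetric] using nat_pow_Suc2[of a p] by (simp add: m_assoc)
    then have ab': "a [^] n \<otimes> b = b \<otimes> a [^] ((p + 1) * n)" for n :: nat
    proof (induction n)
      case (Suc n)
      have "a [^] Suc n \<otimes> b = a [^] n \<otimes> (a \<otimes> b)" by (simp add: m_assoc)
      also have "\<dots> = (a [^] n \<otimes> b) \<otimes> a [^] (p + 1)" using Suc.prems by (simp add: m_assoc)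
      also have "\<dots> = b \<otimes> (a [^] ((p + 1) * n) \<otimes> a [^] (p + 1))" using Suc by (simp add: m_assoc)
      also have "a [^] ((p + 1) * n) \<otimes> a [^] (p + 1) = a [^] ((p + 1) * Suc n)"
        by (subst nat_pow_mult) (simp_all add: algebra_simps)
      finally show ?case .
    qed simp
    have "c \<otimes> b = b \<otimes> a [^] (p * p + p)" using ab'[of p] that(1) by (simp add: algebra_simps)
    also have "a [^] (p * p + p) = c" using that nat_pow_mult[of a "p * p" p] by simp
    finally show ?thesis ..
  qed
  have "a \<otimes> c = c \<otimes> a \<and> b \<otimes> c = c \<otimes> b \<and> a [^] p = c [^] exp1 G \<and> b [^] p = c [^] exp2 G \<and> c [^] p = \<one>"
  proof (cases G)
    case Q8
    then have p: "p = 2" using G by (simp add: available_for_def)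
    have r: "a [^] (4::nat) = \<one>" "a [^] (2::nat) = b [^] (2::nat)" "b [^] (2::nat) = c"
      using rel[of "w_pow w1 4" "[]"] rel[of "w_pow w1 2" "w_pow w2 2"] rel[of "w_pow w2 2" "w_comm w1 w2"]
      unfolding Q8 by (simp_all add: ev)
    have "c [^] (2::nat) = a [^] (4::nat)" unfolding r(3)[symmetric] r(2)[symmetric] by (simp add: nat_pow_pow)
    then show ?thesis using r commutes[of a 2] commutes[of b 2] by (simp add: p Q8 exp1_def exp2_def)
  next
    case D8
    then have p: "p = 2" using G by (simp add: available_for_def)
    have r: "a [^] (4::nat) = \<one>" "b [^] (2::nat) = \<one>" "a [^] (2::nat) = c"
      using rel[of "w_pow w1 4" "[]"] rel[of "w_pow w2 2" "[]"] rel[of "w_pow w1 2" "w_comm w1 w2"]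
      unfolding D8 by (simp_all add: ev)
    have "c [^] (2::nat) = a [^] (4::nat)" unfolding r(3)[symmetric] by (simp add: nat_pow_pow)
    then show ?thesis using r commutes[of a 2] M by (simp add: p D8 exp1_def exp2_def)
  next
    case Hp3
    have r: "a [^] p = \<one>" "b [^] p = \<one>" "c [^] p = \<one>"
      using rel[of "w_pow w1 p" "[]"] rel[of "w_pow w2 p" "[]"] rel[of "w_pow (w_comm w1 w2) p" "[]"]
      unfolding Hp3 by (simp_all add: ev)
    have "c \<otimes> wv w = wv w \<otimes> c" for w
      using rel[of "w_comm w1 w2 @ w" "w @ w_comm w1 w2"] unfolding Hp3 by (simp add: ev wv_append)
    from this[of w1] this[of w2] show ?thesis using r by (simp add: ev Hp3 exp1_def exp2_def)
  next
    case Mp3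
    have r: "a [^] (p * p) = \<one>" "b [^] p = \<one>" "a [^] p = c"
      using rel[of "w_pow w1 (p\<^sup>2)" "[]"] rel[of "w_pow w2 p" "[]"] rel[of "w_pow w1 p" "w_comm w1 w2"]
      unfolding Mp3 by (simp_all add: ev power2_eq_square)
    have "c [^] p = a [^] (p * p)" unfolding r(3)[symmetric] by (simp add: nat_pow_pow)
    then show ?thesis using r commutes[of a p] M by (simp add: Mp3 exp1_def exp2_def)
  qed
  then show ?thesis unfolding c_def[symmetric] using ab p0
    by (intro class2_relations.intro two_elements_axioms class2_relations_axioms.intro) auto
qed

lemma word_val_presented_group:
  "word_val (presented_group R) (word_class R w1) (word_class R w2) w = word_class R w"
proof -
  interpret group "presented_group R" by (rule group_presented_group)
  let ?P = "presented_group R"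
  have carr: "word_class R u \<in> carrier ?P" for u by (simp add: presented_group_def)
  have inv: "inv\<^bsub>?P\<^esub> (word_class R [(g, False)]) = word_class R [(g, True)]" for g
  proof (rule inv_equality)
    show "word_class R [(g, True)] \<otimes>\<^bsub>?P\<^esub> word_class R [(g, False)] = \<one>\<^bsub>?P\<^esub>"
      using word_eq.cancel[of R g True] by (simp add: presented_group_mult word_class_eq_iff presented_group_def[of R, THEN arg_cong, of one])
  qed (simp_all add: carr)
  have "letter_val ?P (word_class R w1) (word_class R w2) l = word_class R [l]" for l
  proof -
    obtain g e where "l = (g, e)" by (cases l)
    then show ?thesis using inv by (cases g; cases e) (simp_all add: w1_def w2_def)
  qed
  moreover have "\<one>\<^bsub>?P\<^esub> = word_class R []" by (simp add: presented_group_def)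
  ultimately show ?thesis by (induction w) (simp_all add: presented_group_mult del: letter_val.simps)
qed

locale p3_presentation =
  fixes p :: nat and G :: nonabelian_p3
  assumes available: "available_for p G"
begin

abbreviation "P \<equiv> p3_group p G"
abbreviation "g1 \<equiv> word_class (p3_relations p G) w1"
abbreviation "g2 \<equiv> word_class (p3_relations p G) w2"

lemma P_eq: "P = presented_group (p3_relations p G)"
  by (simp add: p3_group_def)

lemma group_P: "group P"
  by (simp add: P_eq group_presented_group)

lemma two_elements_P: "two_elements P g1 g2"
  by (intro two_elements.intro two_elements_axioms.intro group_P) (simp_all add: P_eq presented_group_def)

lemma P_class2: "class2_relations P g1 g2 (group_comm P g1 g2) p (exp1 G) (exp2 G)"
proof -
  interpret two_elements P g1 g2 by (rule two_elements_P)
  have "word_val P g1 g2 u = word_class (p3_relations p G) u" for u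
    unfolding P_eq by (rule word_val_presented_group)
  then show ?thesis
    by (intro class2_relations_of_presentation available) (simp add: word_class_eq_iff word_eq.relation)
qed

lemma carrier_P_word_val: "x \<in> carrier P \<Longrightarrow> \<exists>w. x = word_val P g1 g2 w"
  unfolding P_eq word_val_presented_group by (auto simp: presented_group_def)

sublocale P: class2_relations P g1 g2 "group_comm P g1 g2" p "exp1 G" "exp2 G"
  by (rule P_class2)

lemma carrier_P: "x \<in> carrier P \<Longrightarrow> \<exists>i<p. \<exists>j<p. \<exists>k<p. x = P.nf i j k"
  using carrier_P_word_val[of x] P.wv_nf P.nf_mod by metis

lemma finite_P: "finite (carrier P)"
proof (rule finite_subset)
  show "carrier P \<subseteq> (\<lambda>(i, j, k). P.nf i j k) ` ({..<p} \<times> {..<p} \<times> {..<p})"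
    using carrier_P by force
qed simp

lemma hom_from_P:
  assumes "class2_relations \<Gamma> a b c p (exp1 G) (exp2 G)"
  obtains h where "h \<in> hom P \<Gamma>" "h g1 = a" "h g2 = b"
proof -
  interpret \<Gamma>: class2_relations \<Gamma> a b c p "exp1 G" "exp2 G" by (rule assms)
  obtain h where h: "h \<in> hom (presented_group (p3_relations p G)) \<Gamma>"
    "\<And>w. h (word_class (p3_relations p G) w) = word_val \<Gamma> a b w"
    using \<Gamma>.presented_group_hom[of "p3_relations p G"] \<Gamma>.p3_relations_hold[OF available HOL.refl HOL.refl] by blast
  then show ?thesis using that[of h] \<Gamma>.wv_letters by (simp add: P_eq)
qed

end


section \<open>Galois groups generated by prescribed automorphisms\<close>

lemma Gal_automorphism:
  assumes "field_extension K L" "\<sigma> \<in> carrier (Gal K L)"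
  shows "automorphism_on L \<sigma>" "hom_on L \<sigma>" "\<And>x. x \<in> K \<Longrightarrow> \<sigma> x = x" "\<And>x. x \<in> L \<Longrightarrow> \<sigma> x \<in> L"
proof -
  have \<sigma>: "bij_betw \<sigma> L L" "\<forall>x\<in>L. \<forall>y\<in>L. \<sigma> (x + y) = \<sigma> x + \<sigma> y \<and> \<sigma> (x * y) = \<sigma> x * \<sigma> y"
    "\<forall>x\<in>K. \<sigma> x = x" using assms(2) by (auto simp: Gal_def Bij_def)
  show fixK: "\<sigma> x = x" if "x \<in> K" for x using \<sigma>(3) that by blast
  have "\<sigma> 1 = 1" using fixK assms(1) by (simp add: field_extension_def subfield_1)
  then show "hom_on L \<sigma>" using \<sigma>(2) by (simp add: hom_on_def)
  moreover have "\<sigma> ` L = L" using \<sigma>(1) by (simp add: bij_betw_def)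
  ultimately show "automorphism_on L \<sigma>" "\<And>x. x \<in> L \<Longrightarrow> \<sigma> x \<in> L" by (auto simp: automorphism_on_def)
qed

lemma restrict_in_Gal:
  assumes "field_extension K L" "automorphism_on L \<tau>" "\<And>x. x \<in> K \<Longrightarrow> \<tau> x = x"
  shows "restrict \<tau> L \<in> carrier (Gal K L)"
proof -
  have L: "subfield L \<Omega>" and KL: "K \<subseteq> L" using assms by (auto simp: field_extension_def)
  have h: "hom_on L \<tau>" and im: "\<tau> ` L = L" using assms by (auto simp: automorphism_on_def)
  have "inj_on \<tau> L" by (rule hom_on_inj[OF h L])
  then have "bij_betw (restrict \<tau> L) L L" using im by (auto simp: bij_betw_def inj_on_def)
  then show ?thesis
    using h assms(3) KL L unfolding Gal_def Bij_def hom_on_def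
    by (auto simp: subfield_add subfield_mult)
qed

lemma Gal_mult_apply:
  "\<sigma> \<in> carrier (Gal K L) \<Longrightarrow> \<tau> \<in> carrier (Gal K L) \<Longrightarrow> x \<in> L \<Longrightarrow> (\<sigma> \<otimes>\<^bsub>Gal K L\<^esub> \<tau>) x = \<sigma> (\<tau> x)"
  by (simp add: Gal_def BijGroup_def compose_def)

lemma Gal_one_apply: "x \<in> L \<Longrightarrow> \<one>\<^bsub>Gal K L\<^esub> x = x"
  by (simp add: Gal_def BijGroup_def)

lemma Gal_ext:
  assumes "\<sigma> \<in> carrier (Gal K L)" "\<tau> \<in> carrier (Gal K L)" "\<And>x. x \<in> L \<Longrightarrow> \<sigma> x = \<tau> x"
  shows "\<sigma> = \<tau>"
proof (rule extensionalityI[of _ L])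
  show "\<sigma> \<in> extensional L" "\<tau> \<in> extensional L" using assms(1,2) by (auto simp: Gal_def Bij_def)
qed (rule assms(3))

lemma equalizer_subfield:
  assumes L: "subfield L \<Omega>" and "hom_on L \<sigma>" "hom_on L \<tau>"
  shows "subfield {x \<in> L. \<sigma> x = \<tau> x} \<Omega>"
  by (rule subfieldI) (use assms(2,3)[THEN hom_on_1[OF _ L]] assms(2,3)[THEN hom_on_add[OF _ L]]
      assms(2,3)[THEN hom_on_mult[OF _ L]] assms(2,3)[THEN hom_on_uminus[OF _ L]]
      assms(2,3)[THEN hom_on_inverse[OF _ L]] subfield_intros[OF L] in auto)

lemma homs_eq_on_adjoin:
  assumes L: "subfield L \<Omega>" and h: "hom_on L \<sigma>" "hom_on L \<tau>" and KA: "K \<subseteq> L" "A \<subseteq> L"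
    and eq: "\<And>x. x \<in> K \<Longrightarrow> \<sigma> x = \<tau> x" "\<And>x. x \<in> A \<Longrightarrow> \<sigma> x = \<tau> x" and x: "x \<in> adjoin K A"
  shows "\<sigma> x = \<tau> x"
proof -
  have "adjoin K A \<subseteq> {x \<in> L. \<sigma> x = \<tau> x}"
    by (rule adjoin_least[OF equalizer_subfield[OF L h]]) (use KA eq in auto)
  then show ?thesis using x by blast
qed

locale galois_setting =
  fixes K L :: "'a::field set"
  assumes KL: "field_extension K L"
begin

lemma Ksub: "subfield K \<Omega>" and Lsub: "subfield L \<Omega>" and K_sub: "K \<subseteq> L"
  using KL by (auto simp: field_extension_def)

abbreviation "\<Gamma> \<equiv> Gal K L"

sublocale Gal: group \<Gamma>
  by (rule group_Gal[OF KL])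

lemmas Lcl = subfield_intros[OF Lsub]
lemmas mult_apply = Gal_mult_apply[of _ K L]

lemma hom_L: "\<sigma> \<in> carrier \<Gamma> \<Longrightarrow> hom_on L \<sigma>" and into: "\<sigma> \<in> carrier \<Gamma> \<Longrightarrow> x \<in> L \<Longrightarrow> \<sigma> x \<in> L"
  and fixK: "\<sigma> \<in> carrier \<Gamma> \<Longrightarrow> x \<in> K \<Longrightarrow> \<sigma> x = x"
  using Gal_automorphism[OF KL] by blast+

lemmas Gadd = hom_on_add[OF hom_L Lsub] and Gmult = hom_on_mult[OF hom_L Lsub]
  and Gneg = hom_on_uminus[OF hom_L Lsub] and Gnat = hom_on_of_nat[OF hom_L Lsub]
  and G1 = hom_on_1[OF hom_L Lsub] and G0 = hom_on_0[OF hom_L Lsub]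
  and Gcarry = hom_on_carry[OF hom_L Lsub] and Gdiff = hom_on_diff[OF hom_L Lsub]
  and Gpow = hom_on_power[OF hom_L Lsub]

lemma pow_apply_Suc: "\<sigma> \<in> carrier \<Gamma> \<Longrightarrow> y \<in> L \<Longrightarrow> (\<sigma> [^]\<^bsub>\<Gamma>\<^esub> Suc n) y = \<sigma> ((\<sigma> [^]\<^bsub>\<Gamma>\<^esub> n) y)"
  unfolding Gal.nat_pow_Suc2 by (simp add: mult_apply)

lemma pow_translation:
  assumes \<sigma>: "\<sigma> \<in> carrier \<Gamma>" and y: "y \<in> L" and d: "d \<in> L" "\<sigma> y = y + d"
  shows "(\<sigma> [^]\<^bsub>\<Gamma>\<^esub> (n::nat)) y = y + (\<Sum>i<n. (\<sigma> [^]\<^bsub>\<Gamma>\<^esub> i) d)"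
proof (induction n)
  case (Suc n)
  have pL: "(\<sigma> [^]\<^bsub>\<Gamma>\<^esub> i) d \<in> L" for i :: nat by (rule into[OF Gal.nat_pow_closed[OF \<sigma>] d(1)])
  then have sL: "(\<Sum>i<n. (\<sigma> [^]\<^bsub>\<Gamma>\<^esub> i) d) \<in> L" by (intro subfield_sum[OF Lsub])
  have "\<sigma> (\<Sum>i<n. (\<sigma> [^]\<^bsub>\<Gamma>\<^esub> i) d) = (\<Sum>i<n. (\<sigma> [^]\<^bsub>\<Gamma>\<^esub> Suc i) d)"
    unfolding pow_apply_Suc[OF \<sigma> d(1)] by (intro hom_on_sum[OF hom_L[OF \<sigma>] Lsub] pL)
  then have "(\<sigma> [^]\<^bsub>\<Gamma>\<^esub> Suc n) y = y + (d + (\<Sum>i<n. (\<sigma> [^]\<^bsub>\<Gamma>\<^esub> Suc i) d))"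
    unfolding pow_apply_Suc[OF \<sigma> y] Suc Gadd[OF \<sigma> y sL] d(2) by simp
  also have "d + (\<Sum>i<n. (\<sigma> [^]\<^bsub>\<Gamma>\<^esub> Suc i) d) = (\<Sum>i<Suc n. (\<sigma> [^]\<^bsub>\<Gamma>\<^esub> i) d)"
    unfolding sum.lessThan_Suc_shift using d(1) by (simp add: Gal_one_apply)
  finally show ?case .
qed (simp add: y Gal_one_apply)

lemma pow_fixed:
  assumes "\<sigma> \<in> carrier \<Gamma>" "y \<in> L" "\<sigma> y = y"
  shows "(\<sigma> [^]\<^bsub>\<Gamma>\<^esub> (n::nat)) y = y"
  using pow_translation[of \<sigma> y 0 n] hom_on_0[OF hom_L[OF Gal.nat_pow_closed[OF assms(1)]] Lsub]
    assms subfield_0[OF Lsub] by simp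

lemma pow_translation_const:
  assumes "\<sigma> \<in> carrier \<Gamma>" "y \<in> L" "\<sigma> y = y + c" "c \<in> K"
  shows "(\<sigma> [^]\<^bsub>\<Gamma>\<^esub> (n::nat)) y = y + of_nat n * c"
proof -
  have "(\<sigma> [^]\<^bsub>\<Gamma>\<^esub> i) c = c" for i :: nat
    by (rule fixK[OF Gal.nat_pow_closed[OF assms(1)] assms(4)])
  then show ?thesis using pow_translation[OF assms(1,2) _ assms(3), of n] K_sub assms(4) by auto
qed

end

locale p3_char = p3_presentation p G + char_p p T for p G and T :: "'a::field itself"
begin

definition \<epsilon>1 :: 'a where "\<epsilon>1 = of_nat (exp1 G)"
definition \<epsilon>2 :: 'a where "\<epsilon>2 = of_nat (exp2 G)"

lemma carry_char_2: "p = 2 \<Longrightarrow> carry 2 x y = x * (y::'a)"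
  unfolding carry_2 by (rule uminus_CHAR_2) (simp add: CHAR)

lemma s_term_eq:
  "s_term p G \<kappa>1 \<kappa>2 x1 x2 = - \<kappa>2 * x1 + \<epsilon>1 * carry p x1 \<kappa>1 + \<epsilon>2 * carry p x2 (\<kappa>2::'a)"
  using available by (auto simp: s_term_def \<epsilon>1_def \<epsilon>2_def exp1_def exp2_def available_for_def
      S_eval_eq_carry[OF prime_p] carry_char_2 mult.commute)

definition move1 :: "'a \<Rightarrow> 'a \<Rightarrow> 'a" where "move1 x1 x2 = - x2 + \<epsilon>1 * carry p x1 1"
definition move2 :: "'a \<Rightarrow> 'a" where "move2 x2 = \<epsilon>2 * carry p x2 1"

lemma prescribed_action_iff:
  "prescribed_action p G x1 x2 x3 \<sigma>1 \<sigma>2 \<sigma>3 \<longleftrightarrow>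
     \<sigma>1 x1 = x1 + 1 \<and> \<sigma>1 x2 = x2 \<and> \<sigma>1 x3 = x3 + move1 x1 x2 \<and>
     \<sigma>2 x1 = x1 \<and> \<sigma>2 x2 = x2 + 1 \<and> \<sigma>2 x3 = x3 + move2 x2 \<and>
     \<sigma>3 x1 = x1 \<and> \<sigma>3 x2 = x2 \<and> \<sigma>3 x3 = x3 + (1::'a)"
proof -
  have "(case G of Q8 \<Rightarrow> x1 | D8 \<Rightarrow> x1 | Hp3 \<Rightarrow> 0 | Mp3 \<Rightarrow> S_eval p x1 1) = \<epsilon>1 * carry p x1 1"
    "(case G of Q8 \<Rightarrow> x2 | D8 \<Rightarrow> 0 | Hp3 \<Rightarrow> 0 | Mp3 \<Rightarrow> 0) = \<epsilon>2 * carry p x2 1"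
    using available by (auto simp: \<epsilon>1_def \<epsilon>2_def exp1_def exp2_def available_for_def
      S_eval_eq_carry[OF prime_p] carry_char_2)
  then show ?thesis
    unfolding prescribed_action_def move1_def move2_def by (auto simp: algebra_simps)
qed

end

text \<open>
  In characteristic \<open>p\<close> the structure of the Galois group follows formally once three automorphisms
  with the prescribed action are known to exist.
\<close>

locale galois_core = p3_char p G "TYPE('a)" for p G and K L :: "'a::field set" +
  fixes x1 x2 x3 :: 'a and \<sigma>1 \<sigma>2 \<sigma>3
  assumes base: "subfield K \<Omega>" and L: "L = adjoin K {x1, x2, x3}"
    and \<sigma>: "\<sigma>1 \<in> carrier (Gal K L)" "\<sigma>2 \<in> carrier (Gal K L)" "\<sigma>3 \<in> carrier (Gal K L)"
    and action: "prescribed_action p G x1 x2 x3 \<sigma>1 \<sigma>2 \<sigma>3"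
    and AS: "wp x1 \<in> K" "wp x2 \<in> K" "wp x3 \<in> adjoin K {x1, x2}"
begin

sublocale galois_setting K L
  by (rule galois_setting.intro) (simp add: L field_extension_adjoin[OF base])

lemma x_in: "x1 \<in> L" "x2 \<in> L" "x3 \<in> L"
  using subset_adjoin(2)[of "{x1, x2, x3}" K] unfolding L by auto

lemmas act = action[unfolded prescribed_action_iff]
lemma Gal_eqI:
  assumes "\<sigma> \<in> carrier \<Gamma>" "\<tau> \<in> carrier \<Gamma>" "\<sigma> x1 = \<tau> x1" "\<sigma> x2 = \<tau> x2" "\<sigma> x3 = \<tau> x3"
  shows "\<sigma> = \<tau>"
proof (rule Gal_ext[OF assms(1,2)])
  fix x assume "x \<in> L"
  then show "\<sigma> x = \<tau> x"
    unfolding L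
    by (rule homs_eq_on_adjoin[OF Lsub Gal_automorphism(2)[OF KL assms(1)] Gal_automorphism(2)[OF KL assms(2)] K_sub,
        rotated 3]) (use x_in assms Gal_automorphism(3)[OF KL assms(1)] Gal_automorphism(3)[OF KL assms(2)] in auto)
qed

lemma move_in: "move1 x1 x2 \<in> L" "move2 x2 \<in> L" "\<epsilon>1 \<in> L" "\<epsilon>2 \<in> L" "\<epsilon>1 \<in> K" "\<epsilon>2 \<in> K"
  unfolding move1_def move2_def \<epsilon>1_def \<epsilon>2_def
  by (intro Lcl subfield_of_nat[OF Ksub] carry_closed[OF Lsub] x_in)+

lemma act_moves:
  assumes "\<sigma> \<in> carrier \<Gamma>"
  shows "\<sigma> (move1 x1 x2) = - \<sigma> x2 + \<epsilon>1 * carry p (\<sigma> x1) 1" "\<sigma> (move2 x2) = \<epsilon>2 * carry p (\<sigma> x2) 1"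
proof -
  have c: "carry p x1 1 \<in> L" "carry p x2 1 \<in> L" "\<epsilon>1 * carry p x1 1 \<in> L"
    by (intro Lcl carry_closed[OF Lsub] move_in x_in)+
  show "\<sigma> (move1 x1 x2) = - \<sigma> x2 + \<epsilon>1 * carry p (\<sigma> x1) 1" "\<sigma> (move2 x2) = \<epsilon>2 * carry p (\<sigma> x2) 1"
    unfolding move1_def move2_def using assms move_in x_in c Lcl
    by (simp_all only: Gadd Gneg Gmult Gcarry G1 fixK)
qed

lemma commutator_relation: "\<sigma>1 \<otimes>\<^bsub>\<Gamma>\<^esub> \<sigma>2 = \<sigma>2 \<otimes>\<^bsub>\<Gamma>\<^esub> \<sigma>1 \<otimes>\<^bsub>\<Gamma>\<^esub> \<sigma>3"
proof (rule Gal_eqI)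
  have fix2: "\<sigma>1 (move2 x2) = move2 x2" and fix1: "\<sigma>2 (move1 x1 x2) = move1 x1 x2 - 1"
    using act by (simp_all add: act_moves \<sigma>) (simp_all add: move1_def move2_def)
  show "(\<sigma>1 \<otimes>\<^bsub>\<Gamma>\<^esub> \<sigma>2) x3 = (\<sigma>2 \<otimes>\<^bsub>\<Gamma>\<^esub> \<sigma>1 \<otimes>\<^bsub>\<Gamma>\<^esub> \<sigma>3) x3"
    using \<sigma> act x_in Lcl move_in fix1 fix2 by (simp add: mult_apply Gadd G1)
qed (use \<sigma> act x_in Lcl in \<open>simp_all add: mult_apply Gadd G1\<close>)

lemma \<sigma>1_pow:
  "(\<sigma>1 [^]\<^bsub>\<Gamma>\<^esub> n) x1 = x1 + of_nat n" "(\<sigma>1 [^]\<^bsub>\<Gamma>\<^esub> n) x2 = x2"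
  "(\<sigma>1 [^]\<^bsub>\<Gamma>\<^esub> n) x3 = x3 - of_nat n * x2 + \<epsilon>1 * (\<Sum>i<n. carry p (x1 + of_nat i) 1)" for n :: nat
proof -
  show x1: "(\<sigma>1 [^]\<^bsub>\<Gamma>\<^esub> n) x1 = x1 + of_nat n" and x2: "(\<sigma>1 [^]\<^bsub>\<Gamma>\<^esub> n) x2 = x2" for n :: nat
    using pow_translation_const[OF \<sigma>(1) x_in(1), of 1 n] pow_fixed[OF \<sigma>(1) x_in(2)] act subfield_1[OF Ksub]
    by simp_all
  show "(\<sigma>1 [^]\<^bsub>\<Gamma>\<^esub> n) x3 = x3 - of_nat n * x2 + \<epsilon>1 * (\<Sum>i<n. carry p (x1 + of_nat i) 1)"
    using pow_translation[OF \<sigma>(1) x_in(3) move_in(1), of n] act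
    by (simp add: act_moves[OF Gal.nat_pow_closed[OF \<sigma>(1)]] x1 x2 sum.distrib sum_subtractf sum_distrib_left)
qed

lemma \<sigma>2_pow:
  "(\<sigma>2 [^]\<^bsub>\<Gamma>\<^esub> n) x1 = x1" "(\<sigma>2 [^]\<^bsub>\<Gamma>\<^esub> n) x2 = x2 + of_nat n"
  "(\<sigma>2 [^]\<^bsub>\<Gamma>\<^esub> n) x3 = x3 + \<epsilon>2 * (\<Sum>i<n. carry p (x2 + of_nat i) 1)" for n :: nat
proof -
  show x2: "(\<sigma>2 [^]\<^bsub>\<Gamma>\<^esub> n) x2 = x2 + of_nat n" and "(\<sigma>2 [^]\<^bsub>\<Gamma>\<^esub> n) x1 = x1" for n :: nat
    using pow_translation_const[OF \<sigma>(2) x_in(2), of 1 n] pow_fixed[OF \<sigma>(2) x_in(1)] act subfield_1[OF Ksub]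
    by simp_all
  show "(\<sigma>2 [^]\<^bsub>\<Gamma>\<^esub> n) x3 = x3 + \<epsilon>2 * (\<Sum>i<n. carry p (x2 + of_nat i) 1)"
    using pow_translation[OF \<sigma>(2) x_in(3) move_in(2), of n] act
    by (simp add: act_moves[OF Gal.nat_pow_closed[OF \<sigma>(2)]] x2 sum_distrib_left)
qed

lemma \<sigma>3_pow:
  "(\<sigma>3 [^]\<^bsub>\<Gamma>\<^esub> n) x1 = x1" "(\<sigma>3 [^]\<^bsub>\<Gamma>\<^esub> n) x2 = x2" "(\<sigma>3 [^]\<^bsub>\<Gamma>\<^esub> n) x3 = x3 + of_nat n" for n :: nat
  using pow_translation_const[OF \<sigma>(3) x_in(3), of 1 n] pow_fixed[OF \<sigma>(3) x_in(1), of n]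
    pow_fixed[OF \<sigma>(3) x_in(2), of n] act subfield_1[OF Ksub] by simp_all

lemma relations: "class2_relations \<Gamma> \<sigma>1 \<sigma>2 \<sigma>3 p (exp1 G) (exp2 G)"
proof (intro class2_relations.intro two_elements.intro two_elements_axioms.intro
    class2_relations_axioms.intro Gal.group_axioms \<sigma> p_gt_0 commutator_relation)
  show "\<sigma>1 \<otimes>\<^bsub>\<Gamma>\<^esub> \<sigma>3 = \<sigma>3 \<otimes>\<^bsub>\<Gamma>\<^esub> \<sigma>1" "\<sigma>2 \<otimes>\<^bsub>\<Gamma>\<^esub> \<sigma>3 = \<sigma>3 \<otimes>\<^bsub>\<Gamma>\<^esub> \<sigma>2"
  proof -
    have "\<sigma>3 (move1 x1 x2) = move1 x1 x2" "\<sigma>3 (move2 x2) = move2 x2"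
      using act by (simp_all add: act_moves \<sigma>) (simp_all add: move1_def move2_def)
    note simps = this \<sigma> act x_in Lcl(1-5) move_in mult_apply Gadd G1
    show "\<sigma>1 \<otimes>\<^bsub>\<Gamma>\<^esub> \<sigma>3 = \<sigma>3 \<otimes>\<^bsub>\<Gamma>\<^esub> \<sigma>1" by (rule Gal_eqI) (simp_all add: simps)
    show "\<sigma>2 \<otimes>\<^bsub>\<Gamma>\<^esub> \<sigma>3 = \<sigma>3 \<otimes>\<^bsub>\<Gamma>\<^esub> \<sigma>2" by (rule Gal_eqI) (simp_all add: simps)
  qed
  show "\<sigma>1 [^]\<^bsub>\<Gamma>\<^esub> p = \<sigma>3 [^]\<^bsub>\<Gamma>\<^esub> exp1 G"
    using \<sigma> by (intro Gal_eqI) (simp_all add: \<sigma>1_pow \<sigma>3_pow sum_carry_shift \<epsilon>1_def)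
  show "\<sigma>2 [^]\<^bsub>\<Gamma>\<^esub> p = \<sigma>3 [^]\<^bsub>\<Gamma>\<^esub> exp2 G"
    using \<sigma> by (intro Gal_eqI) (simp_all add: \<sigma>2_pow \<sigma>3_pow sum_carry_shift \<epsilon>2_def)
  show "\<sigma>3 [^]\<^bsub>\<Gamma>\<^esub> p = \<one>\<^bsub>\<Gamma>\<^esub>"
    using \<sigma> x_in by (intro Gal_eqI) (simp_all add: \<sigma>3_pow Gal_one_apply)
qed

sublocale rel: class2_relations \<Gamma> \<sigma>1 \<sigma>2 \<sigma>3 p "exp1 G" "exp2 G"
  by (rule relations)

lemma nf_apply:
  "rel.nf i j k x1 = x1 + of_nat i" "rel.nf i j k x2 = x2 + of_nat j"
  "rel.nf 0 0 k x3 = x3 + of_nat k"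
  using \<sigma> x_in Lcl
  by (simp_all add: rel.nf_def mult_apply \<sigma>1_pow \<sigma>2_pow \<sigma>3_pow Gadd Gnat)

lemma wp_fixed_imp_translation:
  assumes "\<tau> \<in> carrier \<Gamma>" "x \<in> L" "\<tau> (wp x) = wp x"
  obtains i where "i < p" "\<tau> x = x + of_nat i"
proof -
  have "wp (\<tau> x - x) = \<tau> (wp x) - wp x"
    using assms Lcl by (simp add: wp_diff Gdiff Gpow)
  then obtain i where "i < p" "\<tau> x - x = of_nat i" using wp_eq_0_imp[of "\<tau> x - x"] assms by auto
  then show ?thesis using that by (simp add: algebra_simps)
qed

text \<open>
  Every automorphism translates \<open>x1\<close> and \<open>x2\<close> by elements of the prime field, because it fixes the
  right hand sides of their Artin-Schreier equations. Composing with powers of \<open>\<sigma>1\<close> and \<open>\<sigma>2\<close>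
  removes these translations; what remains fixes \<open>x3\<^sup>p - x3\<close> and translates \<open>x3\<close>, so it is a
  power of \<open>\<sigma>3\<close>.
\<close>

lemma Gal_nf:
  assumes \<tau>: "\<tau> \<in> carrier \<Gamma>"
  obtains i j k where "i < p" "j < p" "k < p" "\<tau> = rel.nf i j k"
proof -
  obtain i where i: "i < p" "\<tau> x1 = x1 + of_nat i"
    using wp_fixed_imp_translation[OF \<tau> x_in(1)] Gal_automorphism(3)[OF KL \<tau> AS(1)] by blast
  obtain j where j: "j < p" "\<tau> x2 = x2 + of_nat j"
    using wp_fixed_imp_translation[OF \<tau> x_in(2)] Gal_automorphism(3)[OF KL \<tau> AS(2)] by blast
  define \<rho> where "\<rho> = rel.nf i j 0"
  have \<rho>: "\<rho> \<in> carrier \<Gamma>" using \<sigma> by (simp add: \<rho>_def rel.nf_def)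
  define \<tau>' where "\<tau>' = inv\<^bsub>\<Gamma>\<^esub> \<rho> \<otimes>\<^bsub>\<Gamma>\<^esub> \<tau>"
  have \<tau>': "\<tau>' \<in> carrier \<Gamma>" "\<tau> = \<rho> \<otimes>\<^bsub>\<Gamma>\<^esub> \<tau>'" using \<rho> \<tau> by (simp_all add: \<tau>'_def Gal.m_assoc[symmetric])
  have fixed: "\<tau>' x = x" if "x \<in> L" "\<tau> x = \<rho> x" for x
  proof -
    have "\<rho> (\<tau>' x) = \<rho> x" using that \<tau>' \<rho> by (simp add: mult_apply)
    then show ?thesis
      using hom_on_inj[OF hom_L[OF \<rho>] Lsub] that Gal_automorphism(4)[OF KL \<tau>'(1)] by (simp add: inj_on_def)
  qed
  have f12: "\<tau>' x1 = x1" "\<tau>' x2 = x2"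
    using fixed x_in i j nf_apply(1,2)[of i j 0] by (simp_all add: \<rho>_def)
  have "\<tau>' (wp x3) = wp x3"
  proof (rule homs_eq_on_adjoin[OF Lsub hom_L[OF \<tau>'(1)] hom_on_id K_sub _ _ _ AS(3)])
    show "{x1, x2} \<subseteq> L" using x_in by simp
  qed (use f12 Gal_automorphism(3)[OF KL \<tau>'(1)] in auto)
  then obtain k where k: "k < p" "\<tau>' x3 = x3 + of_nat k"
    using wp_fixed_imp_translation[OF \<tau>'(1) x_in(3)] by blast
  have "\<tau>' = \<sigma>3 [^]\<^bsub>\<Gamma>\<^esub> k"
    using \<sigma> \<tau>' f12 k by (intro Gal_eqI) (simp_all add: \<sigma>3_pow)
  then have "\<tau> = rel.nf i j k" using \<tau>' \<sigma> by (simp add: \<rho>_def rel.nf_def)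
  then show ?thesis using that i j k by blast
qed

lemma comm_eq: "\<sigma>3 = group_comm \<Gamma> \<sigma>1 \<sigma>2"
  by (rule rel.c_eq_comm)

lemma carrier_generate: "carrier \<Gamma> = generate \<Gamma> {\<sigma>1, \<sigma>2, \<sigma>3}"
proof
  have pow: "x [^]\<^bsub>\<Gamma>\<^esub> (n::nat) \<in> generate \<Gamma> {\<sigma>1, \<sigma>2, \<sigma>3}" if "x \<in> {\<sigma>1, \<sigma>2, \<sigma>3}" for x n
    by (induction n) (use that in \<open>auto intro: generate.intros\<close>)
  show "carrier \<Gamma> \<subseteq> generate \<Gamma> {\<sigma>1, \<sigma>2, \<sigma>3}"
  proof
    fix \<tau> assume "\<tau> \<in> carrier \<Gamma>"
    then obtain i j k where "\<tau> = rel.nf i j k" using Gal_nf by metis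
    then show "\<tau> \<in> generate \<Gamma> {\<sigma>1, \<sigma>2, \<sigma>3}"
      unfolding rel.nf_def by (simp add: pow generate.eng)
  qed
  show "generate \<Gamma> {\<sigma>1, \<sigma>2, \<sigma>3} \<subseteq> carrier \<Gamma>" using \<sigma> by (intro Gal.generate_incl) auto
qed

text \<open>
  The presented group and the Galois group have the same normal forms, and those of the Galois
  group are separated by the translations of \<open>x1\<close>, \<open>x2\<close> and \<open>x3\<close>.
\<close>

lemma presentation: "satisfy_presentation p G \<Gamma> \<sigma>1 \<sigma>2"
proof -
  obtain h where h: "h \<in> hom P \<Gamma>" "h g1 = \<sigma>1" "h g2 = \<sigma>2" using hom_from_P[OF relations] .
  interpret h: group_hom P \<Gamma> h
    by (intro group_hom.intro group_hom_axioms.intro group_P Gal.group_axioms h)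
  have c: "h (group_comm P g1 g2) = \<sigma>3"
    unfolding comm_eq group_comm_def by (simp add: h(2,3))
  have nf: "h (P.nf i j k) = rel.nf i j k" for i j k
    unfolding P.nf_def rel.nf_def by (simp add: h(2,3) c h.hom_nat_pow)
  have Pnf: "P.nf i j k \<in> carrier P" for i j k by (simp add: P.nf_def)
  have "inj_on h (carrier P)"
  proof (rule h.inj_on_one_iff[THEN iffD2], intro allI impI)
    fix x assume x: "x \<in> carrier P" "h x = \<one>\<^bsub>\<Gamma>\<^esub>"
    obtain i j k where n: "i < p" "j < p" "k < p" "x = P.nf i j k" using carrier_P[OF x(1)] by blast
    have one: "rel.nf i j k = \<one>\<^bsub>\<Gamma>\<^esub>" using x n nf by simp
    then have "of_nat i = (0::'a)" "of_nat j = (0::'a)"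
      using nf_apply(1,2)[of i j k] x_in by (simp_all add: Gal_one_apply)
    then have ij: "i = 0" "j = 0" using of_nat_inj_less_p[of _ 0] n by simp_all
    then have "of_nat k = (0::'a)" using nf_apply(3)[of k] one x_in by (simp add: Gal_one_apply)
    then have "k = 0" using of_nat_inj_less_p[of k 0] n by simp
    then show "x = \<one>\<^bsub>P\<^esub>" using n ij by (simp add: P.nf_def)
  qed
  moreover have "h ` carrier P = carrier \<Gamma>"
  proof
    show "carrier \<Gamma> \<subseteq> h ` carrier P"
    proof
      fix \<tau> assume "\<tau> \<in> carrier \<Gamma>"
      then obtain i j k where "\<tau> = h (P.nf i j k)" using Gal_nf nf by metis
      then show "\<tau> \<in> h ` carrier P" using Pnf by blast
    qed
  qed (auto simp: h.hom_closed)
  ultimately have "h \<in> iso P \<Gamma>" using h(1) by (simp add: iso_def bij_betw_def)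
  then show ?thesis unfolding satisfy_presentation_def using h(2,3) by blast
qed

lemma Gal_iso: "\<Gamma> \<cong> P"
proof -
  have "P \<cong> \<Gamma>" using presentation by (auto simp: satisfy_presentation_def is_iso_def)
  then show ?thesis by (rule group.iso_sym[OF group_P])
qed

lemma action_unique:
  assumes "\<tau>1 \<in> carrier \<Gamma>" "\<tau>2 \<in> carrier \<Gamma>" "\<tau>3 \<in> carrier \<Gamma>"
  shows "prescribed_action p G x1 x2 x3 \<tau>1 \<tau>2 \<tau>3 \<longleftrightarrow> \<tau>1 = \<sigma>1 \<and> \<tau>2 = \<sigma>2 \<and> \<tau>3 = \<sigma>3"
proof
  assume "prescribed_action p G x1 x2 x3 \<tau>1 \<tau>2 \<tau>3"
  then show "\<tau>1 = \<sigma>1 \<and> \<tau>2 = \<sigma>2 \<and> \<tau>3 = \<sigma>3"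
    unfolding prescribed_action_iff using assms \<sigma> act by (auto intro!: Gal_eqI)
qed (use action in simp)

end


section \<open>The base field\<close>

lemma subring_val_ring:
  assumes "valued_subfield F w"
  shows "subring (val_ring F w) \<Omega>" "ideal (val_ideal F w) (\<Omega>\<lparr>carrier := val_ring F w\<rparr>)"
proof -
  interpret valued_subfield F w by (rule assms)
  interpret \<Omega>: field "\<Omega> :: 'a ring" by (rule field_\<Omega>)
  show sub: "subring (val_ring F w) \<Omega>"
  proof (rule \<Omega>.subringI)
    show "\<one>\<^bsub>\<Omega>\<^esub> \<in> val_ring F w" by (simp add: val_ring_def \<Omega>_simps Fcl val_ge_def val_1)
    show "h1 \<otimes>\<^bsub>\<Omega>\<^esub> h2 \<in> val_ring F w" if "h1 \<in> val_ring F w" "h2 \<in> val_ring F w" for h1 h2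
      using that val_ge_mult[of h1 h2 0 0] Fcl by (simp add: val_ring_def \<Omega>_simps)
  qed (auto simp: val_ring_def \<Omega>_simps \<Omega>_uminus Fcl val_ge_add val_ge_uminus)
  let ?R = "(\<Omega> :: 'a ring)\<lparr>carrier := val_ring F w\<rparr>"
  have ring: "ring ?R" by (rule \<Omega>.subring_is_ring[OF sub])
  show "ideal (val_ideal F w) ?R"
  proof (rule idealI[OF ring])
    interpret R: ring ?R by (rule ring)
    have I_sub: "val_ideal F w \<subseteq> val_ring F w" by (auto simp: val_ideal_def val_ring_def val_ge_def)
    have neg: "\<ominus>\<^bsub>?R\<^esub> x = - x" if "x \<in> val_ring F w" for x
      using that sub by (intro R.minus_equality) (auto simp: \<Omega>_simps val_ring_def Fcl val_ge_uminus)
    show "subgroup (val_ideal F w) (add_monoid ?R)"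
    proof (rule R.add.subgroupI)
      show "val_ideal F w \<noteq> {}" using Fcl by (auto simp: val_ideal_def intro: exI[of _ 0])
      fix x assume x: "x \<in> val_ideal F w"
      then have "\<ominus>\<^bsub>?R\<^esub> x = - x" using neg[of x] I_sub by auto
      then show "\<ominus>\<^bsub>?R\<^esub> x \<in> val_ideal F w"
        using x by (simp add: val_ideal_def Fcl val_ge_uminus)
    qed (use I_sub in \<open>auto simp: val_ideal_def \<Omega>_simps Fcl val_ge_add\<close>)
    show "x \<otimes>\<^bsub>?R\<^esub> a \<in> val_ideal F w" "a \<otimes>\<^bsub>?R\<^esub> x \<in> val_ideal F w"
      if "a \<in> val_ideal F w" "x \<in> carrier ?R" for a x
      using that val_ge_mult[of x a 0 1] val_ge_mult[of a x 1 0] Fcl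
      by (auto simp: val_ideal_def val_ring_def \<Omega>_simps)
  qed
qed

lemma residue_field_perfectD:
  assumes V: "valued_subfield F w" and perf: "perfect_char p (residue_field F w)"
    and a: "a \<in> F" "val_ge w 0 a"
  shows "\<exists>b\<in>F. val_ge w 0 b \<and> val_ge w 1 (a - b ^ p)"
proof -
  interpret valued_subfield F w by (rule V)
  let ?R = "(\<Omega> :: 'a ring)\<lparr>carrier := val_ring F w\<rparr>" and ?I = "val_ideal F w"
  interpret I: ideal ?I ?R by (rule subring_val_ring(2)[OF V])
  have coset: "?I +>\<^bsub>?R\<^esub> x = {h + x | h. h \<in> ?I}" for x
    by (auto simp: a_r_coset_def' \<Omega>_simps)
  have "?I +>\<^bsub>?R\<^esub> a \<in> carrier (residue_field F w)"
    using a by (auto simp: residue_field_def FactRing_def A_RCOSETS_def' val_ring_def)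
  then obtain B where B: "B \<in> carrier (residue_field F w)" "B [^]\<^bsub>residue_field F w\<^esub> p = ?I +>\<^bsub>?R\<^esub> a"
    using perf by (auto simp: perfect_char_def)
  then obtain b where b: "b \<in> val_ring F w" "B = ?I +>\<^bsub>?R\<^esub> b"
    by (auto simp: residue_field_def FactRing_def A_RCOSETS_def')
  have pow_in: "b ^ n \<in> val_ring F w" for n
    using b val_ge_power[of b 0 n] Fcl by (simp add: val_ring_def)
  have "B [^]\<^bsub>residue_field F w\<^esub> n = ?I +>\<^bsub>?R\<^esub> (b ^ n)" for n :: nat
  proof (induction n)
    case 0
    show ?case by (simp add: residue_field_def FactRing_def nat_pow_def \<Omega>_simps)
  next
    case (Suc n)
    have "B [^]\<^bsub>residue_field F w\<^esub> Suc n = rcoset_mult ?R ?I (?I +>\<^bsub>?R\<^esub> (b ^ n)) (?I +>\<^bsub>?R\<^esub> b)"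
      using Suc b by (simp add: nat_pow_def residue_field_def FactRing_def)
    also have "\<dots> = ?I +>\<^bsub>?R\<^esub> (b ^ n * b)"
      using I.rcoset_mult_add[of "b ^ n" b] pow_in b by (simp add: \<Omega>_simps)
    finally show ?case by (simp add: mult.commute)
  qed
  then have "?I +>\<^bsub>?R\<^esub> a = ?I +>\<^bsub>?R\<^esub> (b ^ p)" using B by simp
  moreover have "a \<in> ?I +>\<^bsub>?R\<^esub> a" unfolding coset by (auto simp: val_ideal_def Fcl intro: exI[of _ 0])
  ultimately obtain h where "h \<in> ?I" "a = h + b ^ p" unfolding coset by auto
  then show ?thesis using b by (auto simp: val_ideal_def val_ring_def)
qed

lemma local_field_complete_dvf:
  assumes "local_field_char p K v"
  shows "complete_dvf K v p"
proof -
  have V: "valued_subfield K v" using assms by (intro valued_subfield.intro) (auto simp: local_field_char_def)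
  have "Factorial_Ring.prime CHAR('a)" using assms by (intro prime_CHAR_semidom) (simp add: local_field_char_def)
  then show ?thesis
    using assms residue_field_perfectD[OF V]
    by (intro complete_dvf.intro V complete_dvf_axioms.intro) (auto simp: local_field_char_def)
qed


section \<open>Totally ramified towers\<close>

text \<open>
  Besides the valuation and the degree, the record keeps that residues in \<open>F\<close> are represented
  by elements of the base field \<open>K\<close>.
\<close>

definition tot_ram_tower :: "nat \<Rightarrow> 'a::field set \<Rightarrow> ('a \<Rightarrow> int) \<Rightarrow> 'a set \<Rightarrow> ('a \<Rightarrow> int) \<Rightarrow> nat \<Rightarrow> bool" where
  "tot_ram_tower p K v F w n \<longleftrightarrow>
     complete_dvf F w p \<and> field_extension K F \<and> ring.dimension \<Omega> n K F \<and>
     (\<forall>x\<in>K - {0}. w x = int n * v x) \<and>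
     (\<forall>e\<in>F. val_ge w 0 e \<longrightarrow> (\<exists>c\<in>K. val_ge v 0 c \<and> val_ge w 1 (e - c)))"

lemma tot_ram_tower_base:
  assumes "complete_dvf K v p"
  shows "tot_ram_tower p K v K v 1"
proof -
  interpret complete_dvf K v p by (rule assms)
  interpret \<Omega>: field "\<Omega> :: 'a ring" by (rule field_\<Omega>)
  show ?thesis unfolding tot_ram_tower_def field_extension_def
  proof (intro conjI ballI impI)
    show "\<exists>c\<in>K. val_ge v 0 c \<and> val_ge v 1 (e - c)" if "e \<in> K" "val_ge v 0 e" for e
      using that by (intro bexI[of _ e]) (auto simp: val_ge_def)
  qed (use assms \<Omega>.dimension_one[OF F] F in auto)
qed

lemma tot_ram_tower_imp_totally_ramified:
  assumes "tot_ram_tower p K v L w n"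
  shows "totally_ramified K v L"
proof -
  interpret \<Omega>: field "\<Omega> :: 'a ring" by (rule field_\<Omega>)
  interpret complete_dvf L w p using assms by (simp add: tot_ram_tower_def)
  have K: "subfield K \<Omega>" and dim: "\<Omega>.dimension n K L"
    using assms by (auto simp: tot_ram_tower_def field_extension_def)
  have "field_degree K L = n" using \<Omega>.dimI[OF K dim] by (simp add: field_degree_def over_def)
  then show ?thesis
    using assms \<Omega>.finite_dimensionI[OF dim] nv by (auto simp: totally_ramified_def tot_ram_tower_def)
qed

text \<open>
  After subtracting an element of \<open>F\<close> from \<open>y\<close> the right hand side \<open>y\<^sup>p - y\<close> either has a pole of
  order prime to \<open>p\<close>, and the step is ramified, or it is integral. In the latter case it is a
  constant from \<open>K\<close> up to an element of the maximal ideal, and the latter is of the form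
  \<open>k\<^sup>p - k\<close>; this is excluded by hypothesis.
\<close>

lemma tot_ram_tower_step:
  assumes tower: "tot_ram_tower p K v F w n" and y: "y ^ p - y \<in> F"
    and obstruction: "\<And>h. h \<in> F \<Longrightarrow> (y - h) ^ p - (y - h) \<in> K \<Longrightarrow> val_ge v 0 ((y - h) ^ p - (y - h)) \<Longrightarrow> False"
  shows "y \<notin> F" "\<exists>W. tot_ram_tower p K v (adjoin F {y}) W (n * p)"
proof -
  interpret complete_dvf F w p using tower by (simp add: tot_ram_tower_def)
  interpret \<Omega>: field "\<Omega> :: 'a ring" by (rule field_\<Omega>)
  have K: "subfield K \<Omega>" "K \<subseteq> F" and res: "\<And>e. e \<in> F \<Longrightarrow> val_ge w 0 e \<Longrightarrow> \<exists>c\<in>K. val_ge v 0 c \<and> val_ge w 1 (e - c)"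
    and dim: "\<Omega>.dimension n K F" and wv: "\<And>x. x \<in> K \<Longrightarrow> x \<noteq> 0 \<Longrightarrow> w x = int n * v x"
    using tower by (auto simp: tot_ram_tower_def field_extension_def)
  obtain h where h: "h \<in> F" "val_ge w 0 (wp y - wp h) \<or>
      (wp y - wp h \<noteq> 0 \<and> w (wp y - wp h) < 0 \<and> \<not> int p dvd w (wp y - wp h))"
    using reduce_mod_wp[OF y] by blast
  define z where "z = y - h"
  have z: "wp z = wp y - wp h" by (simp add: z_def wp_diff)
  have zF: "wp z \<in> F" unfolding z by (intro Fcl y h)
  have "\<not> val_ge w 0 (wp z)"
  proof
    assume "val_ge w 0 (wp z)"
    then obtain c where c: "c \<in> K" "val_ge v 0 c" "val_ge w 1 (wp z - c)" using res zF by blast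
    have "wp z - c \<in> F" using zF c K by (auto intro: Fcl)
    then obtain k where k: "k \<in> F" "wp k = wp z - c" using wp_surj_maximal_ideal[OF _ c(3)] by blast
    have "wp (y - (h + k)) = c" using k(2) z by (simp add: wp_diff wp_add)
    then show False using obstruction[of "h + k"] c k h Fcl by simp
  qed
  then have red: "wp z \<noteq> 0" "w (wp z) < 0" "\<not> int p dvd w (wp z)" using h(2) z by auto
  interpret ramified_step F w p z "- w (wp z)"
    by unfold_locales (use zF red in auto)
  have E_eq: "adjoin F {z} = adjoin F {y}"
  proof (rule adjoin_eqI)
    have mem: "h \<in> adjoin F {u}" "u \<in> adjoin F {u}" for u
      using h(1) subset_adjoin(1)[of F "{u}"] subset_adjoin(2)[of "{u}" F] by auto
    have "z \<in> adjoin F {y}" unfolding z_def by (intro subfield_diff adjoin_subfield mem)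
    moreover have "z + h \<in> adjoin F {z}" by (intro subfield_add adjoin_subfield mem)
    ultimately show "{z} \<subseteq> adjoin F {y}" "{y} \<subseteq> adjoin F {z}" by (simp_all add: z_def)
  qed
  show "y \<notin> F" using y_notin h Fcl by (auto simp: z_def)
  have "tot_ram_tower p K v E W (n * p)" unfolding tot_ram_tower_def
  proof (intro conjI ballI impI)
    show "complete_dvf E W p" by (rule complete_dvf_step)
    show "field_extension K E" using K F_sub_E E by (auto simp: field_extension_def)
    show "\<Omega>.dimension (n * p) K E"
      by (rule \<Omega>.telescopic_base[OF K(1) F dim adjoin_eq_lin_span(2)[OF F y_notin wp_y(1)]])
    show "W x = int (n * p) * v x" if "x \<in> K - {0}" for x
      using that K W_F[of x] wv[of x] by (auto simp: algebra_simps)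
    fix e assume e: "e \<in> E" "val_ge W 0 e"
    obtain x where x: "x \<in> F" "val_ge w 0 x" "val_ge W 1 (e - x)" using residue_from_F[OF e] .
    obtain c where c: "c \<in> K" "val_ge v 0 c" "val_ge w 1 (x - c)" using res x by blast
    have xc: "x - c \<in> F" using x c K by (auto intro: Fcl)
    have "val_ge W 1 (x - c)"
    proof (cases "x - c = 0")
      case False
      then have "1 \<le> w (x - c)" using c by (simp add: val_ge_def)
      moreover have "1 \<le> int p" using p_gt_0 by simp
      ultimately have "1 * 1 \<le> int p * w (x - c)" by (intro mult_mono) auto
      then show ?thesis using W_F[OF xc False] by (simp add: val_ge_def)
    qed (simp add: val_ge_def)
    moreover have "e - x \<in> E" "x - c \<in> E"
      using subfield_diff[OF E e(1)] subsetD[OF F_sub_E x(1)] subsetD[OF F_sub_E xc] by auto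
    ultimately have "val_ge W 1 ((e - x) + (x - c))"
      using x by (intro valued_subfield.val_ge_add[OF valued_subfield.intro[OF E W_normalized]])
    then show "\<exists>c\<in>K. val_ge v 0 c \<and> val_ge W 1 (e - c)" using c by auto
  qed
  then show "\<exists>W. tot_ram_tower p K v (adjoin F {y}) W (n * p)" unfolding E_eq by blast
qed


section \<open>Defining equations give totally ramified Galois extensions\<close>

lemma carry_commute: "carry p a b = carry p b a"
proof -
  have "(\<Sum>k\<in>{1..<p}. of_nat ((p choose k) div p) * a ^ k * b ^ (p - k))
      = (\<Sum>k\<in>{1..<p}. of_nat ((p choose k) div p) * b ^ k * a ^ (p - k))"
    by (rule sum.reindex_bij_witness[of _ "\<lambda>k. p - k" "\<lambda>k. p - k"])
       (auto simp: binomial_symmetric[symmetric] mult.assoc mult.commute)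
  then show ?thesis by (simp add: carry_def)
qed

text \<open>
  Write \<open>x\<^sup>p = x + \<kappa>\<close>; the two ways of adding \<open>x\<close>, \<open>1\<close> and \<open>\<kappa>\<close> as Witt vectors give the same carry.
\<close>

lemma (in char_p) wp_carry_1:
  assumes "wp x = \<kappa>"
  shows "wp (carry p x 1) = carry p (x + 1) \<kappa> - carry p x \<kappa>"
proof -
  have "x ^ p = x + \<kappa>" using assms by (simp add: algebra_simps)
  then have "wp (carry p x 1) = carry p (x + \<kappa>) 1 - carry p x 1" by (simp add: frob_carry)
  moreover have "carry p x \<kappa> + carry p (x + \<kappa>) 1 = carry p x (\<kappa> + 1) + carry p \<kappa> 1"
    "carry p x 1 + carry p (x + 1) \<kappa> = carry p x (1 + \<kappa>) + carry p 1 \<kappa>"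
    by (rule carry_cocycle[OF prime_p])+
  moreover have "carry p \<kappa> 1 = carry p 1 \<kappa>" by (rule carry_commute)
  ultimately show ?thesis by (simp add: algebra_simps add_eq_0_iff eq_diff_eq diff_eq_eq)
qed

context p3_char
begin

lemma frob_\<epsilon>: "\<epsilon>1 ^ p = \<epsilon>1" "\<epsilon>2 ^ p = \<epsilon>2"
  by (simp_all add: \<epsilon>1_def \<epsilon>2_def frob_of_nat)

text \<open>
  The displacements of \<open>x3\<close> are solutions of the Artin-Schreier equations that the translations
  of \<open>x1\<close> and \<open>x2\<close> impose on them.
\<close>

lemma wp_moves:
  assumes "wp x1 = \<kappa>1" "wp x2 = \<kappa>2"
  shows "wp (move1 x1 x2) = s_term p G \<kappa>1 \<kappa>2 (x1 + 1) x2 - s_term p G \<kappa>1 \<kappa>2 x1 x2"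
    and "wp (move2 x2) = s_term p G \<kappa>1 \<kappa>2 x1 (x2 + 1) - s_term p G \<kappa>1 \<kappa>2 x1 x2"
proof -
  have "wp (move1 x1 x2) = - wp x2 + \<epsilon>1 * wp (carry p x1 1)"
    unfolding move1_def
    by (simp add: frob_add frob_diff frob_minus power_mult_distrib frob_\<epsilon> algebra_simps)
  then show "wp (move1 x1 x2) = s_term p G \<kappa>1 \<kappa>2 (x1 + 1) x2 - s_term p G \<kappa>1 \<kappa>2 x1 x2"
    unfolding wp_carry_1[OF assms(1)] s_term_eq assms(2) by (simp add: algebra_simps)
  have "wp (move2 x2) = \<epsilon>2 * wp (carry p x2 1)"
    unfolding move2_def by (simp add: power_mult_distrib frob_\<epsilon> algebra_simps)
  then show "wp (move2 x2) = s_term p G \<kappa>1 \<kappa>2 x1 (x2 + 1) - s_term p G \<kappa>1 \<kappa>2 x1 x2"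
    unfolding wp_carry_1[OF assms(2)] s_term_eq by (simp add: algebra_simps)
qed

lemma s_term_hom:
  fixes E :: "'a set"
  assumes E: "subfield E \<Omega>" and hom: "hom_on E s" and "\<kappa>1 \<in> E" "\<kappa>2 \<in> E" "x1 \<in> E" "x2 \<in> E"
    and "s \<kappa>1 = \<kappa>1" "s \<kappa>2 = \<kappa>2"
  shows "s (s_term p G \<kappa>1 \<kappa>2 x1 x2) = s_term p G \<kappa>1 \<kappa>2 (s x1) (s x2)"
proof -
  note h = hom_on_add[OF hom E] hom_on_mult[OF hom E] hom_on_carry[OF hom E]
    hom_on_uminus[OF hom E] hom_on_diff[OF hom E] hom_on_of_nat[OF hom E]
  show ?thesis unfolding s_term_eq \<epsilon>1_def \<epsilon>2_def
    using assms(3-) subfield_intros[OF E] carry_closed[OF E] by (simp add: h)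
qed

lemma s_term_closed:
  "subfield E \<Omega> \<Longrightarrow> \<kappa>1 \<in> E \<Longrightarrow> \<kappa>2 \<in> E \<Longrightarrow> x1 \<in> E \<Longrightarrow> x2 \<in> E \<Longrightarrow> s_term p G \<kappa>1 \<kappa>2 x1 x2 \<in> E"
  for E :: "'a set"
  unfolding s_term_eq \<epsilon>1_def \<epsilon>2_def by (intro subfield_intros carry_closed)

end

text \<open>
  If \<open>k\<^sup>p - k\<close> has a pole at all, then the order of this pole is divisible by \<open>p\<close>.
\<close>

lemma (in complete_dvf) pole_prime_to_p_not_wp:
  assumes "u \<in> F" "u \<noteq> 0" "w u < 0" "\<not> int p dvd w u" "k \<in> F"
  shows "\<not> val_ge w 0 (u - wp k)"
proof
  assume ge: "val_ge w 0 (u - wp k)"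
  have "u - (u - wp k) \<noteq> 0 \<and> w (u - (u - wp k)) = w u"
    using assms val_ge_mono[OF ge] by (intro val_diff_eq) (auto intro!: Fcl)
  then have eq: "wp k \<noteq> 0" "w (wp k) = w u" by auto
  then have "\<not> val_ge w 0 (wp k)" using assms by (auto simp: val_ge_def)
  then have "w (wp k) = int p * w k" using val_wp_neg assms by blast
  then show False using eq assms by simp
qed

locale defining_equations = p3_char p G "TYPE('a)" + complete_dvf K v p
  for p G and K :: "'a::field set" and v +
  fixes \<kappa>1 \<kappa>2 \<kappa>3 x1 x2 x3 :: 'a
  assumes data: "defining_data p G K v \<kappa>1 \<kappa>2 \<kappa>3 x1 x2 x3"
begin

lemma \<kappa>_in: "\<kappa>1 \<in> K" "\<kappa>2 \<in> K" "\<kappa>3 \<in> K" and wp_x: "wp x1 = \<kappa>1" "wp x2 = \<kappa>2"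
  "wp x3 = s_term p G \<kappa>1 \<kappa>2 x1 x2 + \<kappa>3"
  using data by (auto simp: defining_data_def)

lemma poles: "\<kappa>1 \<noteq> 0" "v \<kappa>1 < 0" "\<not> int p dvd v \<kappa>1" "\<kappa>2 \<noteq> 0" "v \<kappa>2 < 0" "\<not> int p dvd v \<kappa>2"
  "v \<kappa>1 = v \<kappa>2 \<Longrightarrow> leading_independent p K v \<kappa>1 \<kappa>2"
  using data by (auto simp: defining_data_def)

text \<open>
  If the orders of the poles differ, the larger one that occurs survives; if they agree, this is
  the independence of the leading terms.
\<close>

lemma pole_combination:
  fixes j :: nat
  defines "u \<equiv> \<kappa>2 - of_nat j * \<kappa>1"
  shows "u \<in> K \<and> u \<noteq> 0 \<and> v u < 0 \<and> \<not> int p dvd v u"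
proof (cases "of_nat j = (0::'a)")
  case True
  then show ?thesis using poles \<kappa>_in by (simp add: u_def)
next
  case False
  have u: "u \<in> K" unfolding u_def by (intro Fcl \<kappa>_in)
  have j: "of_nat j \<in> K" by (rule Fcl)
  have "int p * v (of_nat j) = v (of_nat j)"
    using val_power[OF j False, of p] by (simp add: frob_of_nat)
  then have "v (of_nat j) = 0" using p_gt_1 by simp
  then have vj: "v (of_nat j * \<kappa>1) = v \<kappa>1" "of_nat j * \<kappa>1 \<noteq> 0" "of_nat j * \<kappa>1 \<in> K"
    using False poles \<kappa>_in j by (auto simp: val_mult intro: Fcl)
  consider "v \<kappa>1 > v \<kappa>2" | "v \<kappa>1 < v \<kappa>2" | "v \<kappa>1 = v \<kappa>2" by linarith
  then show ?thesis
  proof cases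
    case 1
    have "val_ge v (v \<kappa>2 + 1) (of_nat j * \<kappa>1)" using 1 vj by (simp add: val_ge_def)
    then show ?thesis using val_diff_eq[OF \<kappa>_in(2) vj(3) poles(4)] poles u by (simp add: u_def)
  next
    case 2
    have "val_ge v (v (of_nat j * \<kappa>1) + 1) \<kappa>2" using 2 vj by (simp add: val_ge_def)
    then have "of_nat j * \<kappa>1 - \<kappa>2 \<noteq> 0 \<and> v (of_nat j * \<kappa>1 - \<kappa>2) = v \<kappa>1"
      using val_diff_eq[OF vj(3) \<kappa>_in(2) vj(2)] vj by simp
    moreover have "v u = v (- u)" using val_uminus[OF u] by simp
    ultimately show ?thesis using poles u by (auto simp: u_def)
  next
    case 3
    have ge: "val_ge v (v \<kappa>2) u"
      unfolding u_def using 3 vj \<kappa>_in by (intro val_ge_diff) (auto simp: val_ge_def)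
    have "\<not> val_ge v (v \<kappa>2 + 1) u"
    proof
      assume "val_ge v (v \<kappa>2 + 1) u"
      then have "u / \<kappa>2 \<in> val_ideal K v"
        using val_ge_mult[of u "inverse \<kappa>2" "v \<kappa>2 + 1" "- v \<kappa>2"] u \<kappa>_in poles
        by (auto simp: val_ideal_def divide_inverse val_ge_def[of v "- v \<kappa>2"] val_inverse intro!: Fcl)
      then have "u \<in> (\<lambda>y. \<kappa>2 * y) ` val_ideal K v"
        using poles(4) by (intro image_eqI[of _ _ "u / \<kappa>2"]) auto
      moreover have "u = of_int (- int j) * \<kappa>1 + of_int 1 * \<kappa>2" by (simp add: u_def)
      ultimately have "int p dvd 1" using poles(7)[OF 3] unfolding leading_independent_def by metis
      then show False using p_gt_1 by simp
    qed
    then have "u \<noteq> 0" "v u = v \<kappa>2" using ge by (auto simp: val_ge_def)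
    then show ?thesis using poles u by simp
  qed
qed

abbreviation "F1 \<equiv> adjoin K {x1}"
abbreviation "F2 \<equiv> adjoin F1 {x2}"
abbreviation "L \<equiv> adjoin F2 {x3}"

lemma L_eq: "L = adjoin K {x1, x2, x3}" and F2_eq: "F2 = adjoin K {x1, x2}"
  by (simp_all add: adjoin_adjoin insert_commute)

lemma fields: "subfield F1 \<Omega>" "subfield F2 \<Omega>" "subfield L \<Omega>" "K \<subseteq> F1" "F1 \<subseteq> F2" "F2 \<subseteq> L"
  "x1 \<in> F1" "x2 \<in> F2" "x3 \<in> L"
  using adjoin_subfield subset_adjoin(1)[of K "{x1}"] subset_adjoin(1)[of F1 "{x2}"]
    subset_adjoin(1)[of F2 "{x3}"] subset_adjoin(2)[of "{x1}" K] subset_adjoin(2)[of "{x2}" F1]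
    subset_adjoin(2)[of "{x3}" F2] by auto

lemma x1_in_F2: "x1 \<in> F2" and K_sub_F2: "K \<subseteq> F2" and K_sub_L: "K \<subseteq> L"
  using fields by auto

lemma tower1: "x1 \<notin> K" "\<exists>w. tot_ram_tower p K v F1 w p"
proof -
  have "False" if h: "h \<in> K" "val_ge v 0 (wp (x1 - h))" for h
    using pole_prime_to_p_not_wp[of \<kappa>1 h] h \<kappa>_in poles by (simp add: wp_diff wp_x)
  note step = tot_ram_tower_step[OF tot_ram_tower_base[OF complete_dvf_axioms], of x1]
  show "x1 \<notin> K" "\<exists>w. tot_ram_tower p K v F1 w p"
    using step \<kappa>_in wp_x \<open>\<And>h. h \<in> K \<Longrightarrow> val_ge v 0 (wp (x1 - h)) \<Longrightarrow> False\<close> by auto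
qed

lemma ex_\<rho>:
  obtains \<rho> where "automorphism_on F1 \<rho>" "\<rho> x1 = x1 + 1" "\<And>x. x \<in> K \<Longrightarrow> \<rho> x = x"
proof -
  have "automorphism_on K (\<lambda>x. x)" by (simp add: automorphism_on_def hom_on_id)
  then show ?thesis
    using extend_automorphism[OF F tower1(1), of "\<lambda>x. x" 1] \<kappa>_in wp_x Fcl that by auto
qed

text \<open>
  If \<open>h \<in> F1\<close> and \<open>(x2 - h)\<^sup>p - (x2 - h)\<close> lies in \<open>K\<close>, then so does \<open>h\<^sup>p - h\<close>, whence
  \<open>h = j x1 + g\<close> with \<open>j\<close> in the prime field and \<open>g \<in> K\<close>. Then \<open>\<kappa>2 - j \<kappa>1\<close> and \<open>g\<^sup>p - g\<close> differ by an
  integral element, which the orders of their poles exclude.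
\<close>

lemma tower2: "x2 \<notin> F1" "\<exists>w. tot_ram_tower p K v F2 w (p * p)"
proof -
  obtain w where w: "tot_ram_tower p K v F1 w p" using tower1 by blast
  obtain \<rho> where \<rho>: "automorphism_on F1 \<rho>" "\<rho> x1 = x1 + 1" "\<And>x. x \<in> K \<Longrightarrow> \<rho> x = x" by (rule ex_\<rho>) blast
  have hom: "hom_on F1 \<rho>" using \<rho> by (simp add: automorphism_on_def)
  have obst: False if h: "h \<in> F1" "wp (x2 - h) \<in> K" "val_ge v 0 (wp (x2 - h))" for h
  proof -
    note cl = subfield_intros[OF fields(1)]
    have eq: "wp h = \<kappa>2 - wp (x2 - h)" unfolding wp_diff wp_x by simp
    have wph: "wp h \<in> K" unfolding eq by (intro subfield_diff[OF F] \<kappa>_in h(2))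
    have "wp (\<rho> h - h) = \<rho> (wp h) - wp h"
      using h cl hom_on_diff[OF hom fields(1)] hom_on_power[OF hom fields(1)] by (simp add: wp_diff)
    then have "wp (\<rho> h - h) = 0" using \<rho>(3) wph by simp
    then obtain j where j: "\<rho> h - h = of_nat j" by (rule wp_eq_0_imp)
    define g where "g = h - of_nat j * x1"
    have gF1: "g \<in> F1" unfolding g_def by (intro cl h fields)
    have "\<rho> g = \<rho> h - of_nat j * (x1 + 1)"
      using h cl fields hom_on_diff[OF hom fields(1)] hom_on_mult[OF hom fields(1)] hom_on_of_nat[OF hom fields(1)]
      by (simp add: g_def \<rho>(2))
    also have "\<dots> = g" using j by (simp add: g_def algebra_simps)
    finally have g: "g \<in> K"
      using fixed_by_translation[OF F tower1(1) _ hom \<rho>(3,2) gF1] wp_x \<kappa>_in by simp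
    have "wp (x2 - h) = (\<kappa>2 - of_nat j * \<kappa>1) - wp g"
      using wp_of_int_mult[of "int j" x1] by (simp add: g_def wp_diff wp_x)
    then show False
      using pole_prime_to_p_not_wp[of "\<kappa>2 - of_nat j * \<kappa>1" g] pole_combination[of j] g h by simp
  qed
  have "wp x2 \<in> F1" using wp_x \<kappa>_in fields by auto
  from tot_ram_tower_step[OF w this obst] show "x2 \<notin> F1" "\<exists>w. tot_ram_tower p K v F2 w (p * p)" by auto
qed

lemma \<epsilon>_in: "\<epsilon>1 \<in> K" "\<epsilon>2 \<in> K"
  unfolding \<epsilon>1_def \<epsilon>2_def by (intro Fcl)+

lemmas F2cl = subfield_intros[OF fields(2)]

lemma in_F2: "\<epsilon>1 \<in> F2" "\<epsilon>2 \<in> F2" "\<kappa>1 \<in> F2" "\<kappa>2 \<in> F2" "\<kappa>3 \<in> F2"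
  using \<epsilon>_in \<kappa>_in K_sub_F2 by auto

lemma wp_x3_in: "wp x3 \<in> F2" and moves_in: "move1 x1 x2 \<in> F2" "move2 x2 \<in> F2"
  unfolding wp_x move1_def move2_def
  by (intro F2cl s_term_closed carry_closed[OF fields(2)] in_F2 x1_in_F2 fields)+

lemma ex_F2_automorphisms:
  obtains s1 s2 where
    "automorphism_on F2 s1" "s1 x1 = x1 + 1" "s1 x2 = x2" "\<And>x. x \<in> K \<Longrightarrow> s1 x = x"
    "automorphism_on F2 s2" "s2 x1 = x1" "s2 x2 = x2 + 1" "\<And>x. x \<in> K \<Longrightarrow> s2 x = x"
proof -
  obtain \<rho> where \<rho>: "automorphism_on F1 \<rho>" "\<rho> x1 = x1 + 1" "\<And>x. x \<in> K \<Longrightarrow> \<rho> x = x" by (rule ex_\<rho>) blast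
  have id: "automorphism_on F1 (\<lambda>x. x)" by (simp add: automorphism_on_def hom_on_id)
  have w2: "wp x2 \<in> F1" using wp_x \<kappa>_in fields by auto
  have d0: "(0::'a) \<in> F1" "wp 0 = \<rho> (wp x2) - wp x2" and d1: "(1::'a) \<in> F1" "wp 1 = wp x2 - wp x2"
    using \<rho>(3)[OF \<kappa>_in(2)] p_gt_0 subfield_intros(1,2)[OF fields(1)] by (simp_all add: wp_x)
  obtain s1 where s1: "automorphism_on F2 s1" "s1 x2 = x2 + 0" "\<And>x. x \<in> F1 \<Longrightarrow> s1 x = \<rho> x"
    using extend_automorphism[OF fields(1) tower2(1) w2 \<rho>(1) d0] by blast
  obtain s2 where s2: "automorphism_on F2 s2" "s2 x2 = x2 + 1" "\<And>x. x \<in> F1 \<Longrightarrow> s2 x = x"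
    using extend_automorphism[OF fields(1) tower2(1) w2 id d1] by blast
  show ?thesis
    by (rule that[of s1 s2]) (use s1 s2 \<rho> fields in auto)
qed

lemma act_on_wp_x3:
  assumes s: "automorphism_on F2 s" "\<And>x. x \<in> K \<Longrightarrow> s x = x"
  shows "s x1 = x1 + 1 \<Longrightarrow> s x2 = x2 \<Longrightarrow> wp (move1 x1 x2) = s (wp x3) - wp x3"
    and "s x1 = x1 \<Longrightarrow> s x2 = x2 + 1 \<Longrightarrow> wp (move2 x2) = s (wp x3) - wp x3"
proof -
  have hom: "hom_on F2 s" using s by (simp add: automorphism_on_def)
  have "s_term p G \<kappa>1 \<kappa>2 x1 x2 \<in> F2"
    by (intro s_term_closed[OF fields(2)] in_F2 x1_in_F2 fields)
  then have "s (wp x3) = s_term p G \<kappa>1 \<kappa>2 (s x1) (s x2) + \<kappa>3"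
    unfolding wp_x(3) using s(2)[OF \<kappa>_in(1)] s(2)[OF \<kappa>_in(2)] s(2)[OF \<kappa>_in(3)] in_F2 x1_in_F2 fields(8)
    by (simp add: hom_on_add[OF hom fields(2)] s_term_hom[OF fields(2) hom])
  then show "s x1 = x1 + 1 \<Longrightarrow> s x2 = x2 \<Longrightarrow> wp (move1 x1 x2) = s (wp x3) - wp x3"
    and "s x1 = x1 \<Longrightarrow> s x2 = x2 + 1 \<Longrightarrow> wp (move2 x2) = s (wp x3) - wp x3"
    unfolding wp_moves[OF wp_x(1,2)] wp_x(3) by simp_all
qed

text \<open>
  On \<open>F2\<close> the two automorphisms commute, while on \<open>x3\<close> they would differ by \<open>1\<close>.
\<close>

lemma x3_notin: "x3 \<notin> F2"
proof
  assume x3: "x3 \<in> F2"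
  obtain s1 s2 where s: "automorphism_on F2 s1" "s1 x1 = x1 + 1" "s1 x2 = x2" "\<And>x. x \<in> K \<Longrightarrow> s1 x = x"
    "automorphism_on F2 s2" "s2 x1 = x1" "s2 x2 = x2 + 1" "\<And>x. x \<in> K \<Longrightarrow> s2 x = x"
    by (rule ex_F2_automorphisms) blast
  have hom: "hom_on F2 s1" "hom_on F2 s2" and into: "\<And>x. x \<in> F2 \<Longrightarrow> s1 x \<in> F2" "\<And>x. x \<in> F2 \<Longrightarrow> s2 x \<in> F2"
    using s by (auto simp: automorphism_on_def)
  note h1 = hom_on_add[OF hom(1) fields(2)] hom_on_mult[OF hom(1) fields(2)] hom_on_carry[OF hom(1) fields(2)]
    hom_on_uminus[OF hom(1) fields(2)] hom_on_of_nat[OF hom(1) fields(2)] hom_on_1[OF hom(1) fields(2)]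
  note h2 = hom_on_add[OF hom(2) fields(2)] hom_on_mult[OF hom(2) fields(2)] hom_on_carry[OF hom(2) fields(2)]
    hom_on_uminus[OF hom(2) fields(2)] hom_on_of_nat[OF hom(2) fields(2)] hom_on_1[OF hom(2) fields(2)]
  have shift: "\<exists>n. t x3 = x3 + m + of_nat n"
    if t: "hom_on F2 t" and m: "wp m = t (wp x3) - wp x3" for t m
  proof -
    have "t (wp x3) = wp (t x3)"
      using hom_on_diff[OF t fields(2)] hom_on_power[OF t fields(2)] x3 F2cl by simp
    then have "wp (t x3 - x3 - m) = 0" using m by (simp add: wp_diff)
    then obtain n where "t x3 - x3 - m = of_nat n" by (rule wp_eq_0_imp)
    then show ?thesis by (auto simp: algebra_simps intro!: exI[of _ n])
  qed
  obtain n1 where n1: "s1 x3 = x3 + move1 x1 x2 + of_nat n1"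
    using shift[OF hom(1) act_on_wp_x3(1)[OF s(1,4,2,3)]] by blast
  obtain n2 where n2: "s2 x3 = x3 + move2 x2 + of_nat n2"
    using shift[OF hom(2) act_on_wp_x3(2)[OF s(5,8,6,7)]] by blast
  have cin: "carry p x1 1 \<in> F2" "carry p x2 1 \<in> F2"
    by (intro carry_closed[OF fields(2)] x1_in_F2 fields F2cl)+
  have m1: "s2 (move1 x1 x2) = move1 x1 x2 - 1" and m2: "s1 (move2 x2) = move2 x2"
    unfolding move1_def move2_def using s(4,8)[OF \<epsilon>_in(1)] s(4,8)[OF \<epsilon>_in(2)] s(2,3,6,7)
      in_F2 x1_in_F2 fields(8) cin F2cl
    by (simp_all add: h1 h2 hom_on_diff[OF hom(2) fields(2)])
  have "s1 (s2 x3) = s2 (s1 x3)"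
  proof -
    have c12: "hom_on F2 (\<lambda>x. s1 (s2 x))" "hom_on F2 (\<lambda>x. s2 (s1 x))"
      unfolding hom_on_def using into by (simp_all add: h1 h2)
    show ?thesis
    proof (rule homs_eq_on_adjoin[OF fields(2) c12 K_sub_F2])
      show "x3 \<in> adjoin K {x1, x2}" using x3 by (simp add: F2_eq)
    qed (use s x1_in_F2 fields(8) F2cl in \<open>auto simp: h1 h2\<close>)
  qed
  moreover have "s1 (s2 x3) = s1 x3 + move2 x2 + of_nat n2"
    using x3 moves_in F2cl m2 by (simp add: n2 h1)
  moreover have "s2 (s1 x3) = s2 x3 + (move1 x1 x2 - 1) + of_nat n1"
    using x3 moves_in F2cl m1 by (simp add: n1 h2)
  ultimately show False by (simp add: n1 n2)
qed

text \<open>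
  The automorphisms of \<open>F2\<close> that translate \<open>x1\<close> and \<open>x2\<close> extend to \<open>L\<close> because the prescribed
  displacements of \<open>x3\<close> solve the required Artin-Schreier equations.
\<close>

lemma ex_core:
  obtains \<sigma>1 \<sigma>2 \<sigma>3 where "galois_core p G K L x1 x2 x3 \<sigma>1 \<sigma>2 \<sigma>3"
    "\<And>x. x \<in> F2 \<Longrightarrow> \<sigma>3 x = x"
proof -
  obtain s1 s2 where s: "automorphism_on F2 s1" "s1 x1 = x1 + 1" "s1 x2 = x2" "\<And>x. x \<in> K \<Longrightarrow> s1 x = x"
    "automorphism_on F2 s2" "s2 x1 = x1" "s2 x2 = x2 + 1" "\<And>x. x \<in> K \<Longrightarrow> s2 x = x"
    by (rule ex_F2_automorphisms) blast
  have id: "automorphism_on F2 (\<lambda>x. x)" by (simp add: automorphism_on_def hom_on_id)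
  note ext = extend_automorphism[OF fields(2) x3_notin wp_x3_in]
  obtain t1 where t1: "automorphism_on L t1" "t1 x3 = x3 + move1 x1 x2" "\<And>x. x \<in> F2 \<Longrightarrow> t1 x = s1 x"
    using ext[OF s(1) moves_in(1) act_on_wp_x3(1)[OF s(1,4,2,3)]] by blast
  obtain t2 where t2: "automorphism_on L t2" "t2 x3 = x3 + move2 x2" "\<And>x. x \<in> F2 \<Longrightarrow> t2 x = s2 x"
    using ext[OF s(5) moves_in(2) act_on_wp_x3(2)[OF s(5,8,6,7)]] by blast
  have "wp 1 = wp x3 - wp x3" by simp
  then obtain t3 where t3: "automorphism_on L t3" "t3 x3 = x3 + 1" "\<And>x. x \<in> F2 \<Longrightarrow> t3 x = x"
    using ext[OF id F2cl(2)] by blast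
  have KL: "field_extension K L" using F fields K_sub_L by (simp add: field_extension_def)
  have inL: "x1 \<in> L" "x2 \<in> L" "x3 \<in> L" using fields x1_in_F2 by auto
  have "galois_core p G K L x1 x2 x3 (restrict t1 L) (restrict t2 L) (restrict t3 L)"
  proof (intro galois_core.intro p3_char_axioms galois_core_axioms.intro F L_eq)
    show "restrict t1 L \<in> carrier (Gal K L)" "restrict t2 L \<in> carrier (Gal K L)" "restrict t3 L \<in> carrier (Gal K L)"
      by (rule restrict_in_Gal[OF KL]; use t1 t2 t3 s K_sub_F2 in auto)+
    show "prescribed_action p G x1 x2 x3 (restrict t1 L) (restrict t2 L) (restrict t3 L)"
      unfolding prescribed_action_iff using inL t1 t2 t3 s x1_in_F2 fields(8) by simp
    show "wp x1 \<in> K" "wp x2 \<in> K" using \<kappa>_in by (simp_all add: wp_x)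
    show "wp x3 \<in> adjoin K {x1, x2}" using wp_x3_in by (simp add: F2_eq)
  qed
  then show ?thesis by (rule that) (use t3 fields in auto)
qed

text \<open>
  For total ramification of the last step let \<open>z = x3 - h\<close> with \<open>h \<in> F2\<close> and \<open>z\<^sup>p - z \<in> K\<close>. Every
  automorphism translates \<open>z\<close> by an element of the prime field. Translations commute, so the commutator
  \<open>\<sigma>3\<close> fixes \<open>z\<close>, although it maps it to \<open>z + 1\<close>. The fixed field is computed step by step down the
  tower.
\<close>

lemma galois_and_totally_ramified:
  assumes sep: "\<And>x. separable_over K x"
  shows "galois_extension K L" "totally_ramified K v L"
proof -
  obtain \<sigma>1 \<sigma>2 \<sigma>3 where core: "galois_core p G K L x1 x2 x3 \<sigma>1 \<sigma>2 \<sigma>3" and \<sigma>3: "\<And>x. x \<in> F2 \<Longrightarrow> \<sigma>3 x = x"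
    by (rule ex_core) blast
  interpret core: galois_core p G K L x1 x2 x3 \<sigma>1 \<sigma>2 \<sigma>3 by (rule core)
  note hom = core.hom_L[OF core.\<sigma>(1)] core.hom_L[OF core.\<sigma>(2)] core.hom_L[OF core.\<sigma>(3)]
  have fixK: "\<sigma> x = x" if "\<sigma> \<in> carrier (Gal K L)" "x \<in> K" for \<sigma> x
    using Gal_automorphism(3)[OF core.KL that] .
  have "e \<in> K" if e: "e \<in> L" "\<forall>\<sigma>\<in>carrier (Gal K L). \<sigma> e = e" for e
  proof -
    have act: "\<sigma>1 x1 = x1 + 1" "\<sigma>2 x1 = x1" "\<sigma>2 x2 = x2 + 1" "\<sigma>3 x3 = x3 + 1" using core.act by auto
    have fixed: "\<sigma>1 e = e" "\<sigma>2 e = e" "\<sigma>3 e = e" using e(2) core.\<sigma> by auto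
    have eF2: "e \<in> F2"
      by (rule fixed_by_translation[OF fields(2) x3_notin wp_x3_in hom(3) \<sigma>3 act(4) e(1) fixed(3)])
    have fix1: "\<sigma>2 x = x" if "x \<in> F1" for x
    proof (rule homs_eq_on_adjoin[OF fields(3) hom(2) hom_on_id K_sub_L _ _ _ that])
      show "{x1} \<subseteq> L" using core.x_in by simp
    qed (use act(2) fixK[OF core.\<sigma>(2)] in auto)
    have w: "wp x1 \<in> K" "wp x2 \<in> F1" unfolding wp_x using \<kappa>_in fields(4) by auto
    have eF1: "e \<in> F1"
      by (rule fixed_by_translation[OF fields(1) tower2(1) w(2) hom_on_mono[OF hom(2) fields(6)] fix1 act(3) eF2 fixed(2)])
    have "F1 \<subseteq> L" using fields(5,6) by (rule order_trans)
    from fixed_by_translation[OF F tower1(1) w(1) hom_on_mono[OF hom(1) this] fixK[OF core.\<sigma>(1)] act(1) eF1 fixed(1)]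
    show "e \<in> K" .
  qed
  then show "galois_extension K L"
    unfolding galois_extension_def using core.KL sep fixK core.K_sub by blast
  obtain w where w: "tot_ram_tower p K v F2 w (p * p)" using tower2 by blast
  have obst: False if h: "h \<in> F2" "wp (x3 - h) \<in> K" for h
  proof -
    define z where "z = x3 - h"
    have hL: "h \<in> L" using h fields by auto
    have zL: "z \<in> L" unfolding z_def by (intro core.Lcl core.x_in hL)
    have "\<sigma> (wp z) = wp z" if "\<sigma> \<in> carrier (Gal K L)" for \<sigma> using fixK[OF that] h by (simp add: z_def)
    then obtain n1 n2 where n: "\<sigma>1 z = z + of_nat n1" "\<sigma>2 z = z + of_nat n2"
      using core.wp_fixed_imp_translation[OF core.\<sigma>(1) zL] core.wp_fixed_imp_translation[OF core.\<sigma>(2) zL] core.\<sigma>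
      by metis
    have s3: "\<sigma>3 z = z + 1"
      using core.\<sigma> core.x_in hL core.act \<sigma>3[OF h(1)] by (simp add: z_def core.Gdiff)
    have "\<sigma>1 (\<sigma>2 z) = \<sigma>2 (\<sigma>1 (\<sigma>3 z))"
      using arg_cong[OF core.commutator_relation, of "\<lambda>\<tau>. \<tau> z"] core.\<sigma> zL
      by (simp add: core.mult_apply Gal_automorphism(4)[OF core.KL])
    then show False using core.\<sigma> zL core.Lcl
      by (simp add: n s3 core.Gadd core.Gnat core.G1)
  qed
  obtain W where "tot_ram_tower p K v L W (p * p * p)"
    using tot_ram_tower_step(2)[OF w wp_x3_in] obst by blast
  then show "totally_ramified K v L" by (rule tot_ram_tower_imp_totally_ramified)
qed

end


section \<open>Additive Hilbert 90\<close>

text \<open>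
  Dedekind's argument: subtracting the relation multiplied by \<open>\<sigma>0 y\<close> from the relation evaluated at
  \<open>y x\<close> removes \<open>\<sigma>0\<close>.
\<close>

lemma independence_of_homs:
  fixes L :: "'a::field set"
  assumes "finite S" and L: "subfield L \<Omega>" and "\<And>\<sigma>. \<sigma> \<in> S \<Longrightarrow> hom_on L \<sigma>"
    and "\<And>\<sigma> \<tau>. \<sigma> \<in> S \<Longrightarrow> \<tau> \<in> S \<Longrightarrow> \<sigma> \<noteq> \<tau> \<Longrightarrow> \<exists>x\<in>L. \<sigma> x \<noteq> \<tau> x"
    and "\<And>x. x \<in> L \<Longrightarrow> (\<Sum>\<sigma>\<in>S. c \<sigma> * \<sigma> x) = 0"
  shows "\<forall>\<sigma>\<in>S. c \<sigma> = (0::'a)"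
  using assms(1,3-)
proof (induction S arbitrary: c rule: finite_induct)
  case (insert \<sigma>0 S)
  have zero: "c \<sigma>1 = 0" if \<sigma>1: "\<sigma>1 \<in> S" for \<sigma>1
  proof -
    obtain y where y: "y \<in> L" "\<sigma>0 y \<noteq> \<sigma>1 y" using insert.prems(2)[of \<sigma>0 \<sigma>1] \<sigma>1 insert.hyps by auto
    have "(\<Sum>\<sigma>\<in>S. (c \<sigma> * (\<sigma> y - \<sigma>0 y)) * \<sigma> x) = 0" if x: "x \<in> L" for x
    proof -
      have yx: "y * x \<in> L" by (rule subfield_mult[OF L y(1) x])
      have mult: "\<sigma> (y * x) = \<sigma> y * \<sigma> x" if "\<sigma> \<in> insert \<sigma>0 S" for \<sigma>
        using hom_on_mult[OF insert.prems(1)[OF that] L y(1) x] .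
      have "(\<Sum>\<sigma>\<in>insert \<sigma>0 S. c \<sigma> * \<sigma> (y * x)) - \<sigma>0 y * (\<Sum>\<sigma>\<in>insert \<sigma>0 S. c \<sigma> * \<sigma> x) = 0"
        using insert.prems(3)[OF yx] insert.prems(3)[OF x] by simp
      moreover have "(\<Sum>\<sigma>\<in>insert \<sigma>0 S. c \<sigma> * \<sigma> (y * x)) = (\<Sum>\<sigma>\<in>insert \<sigma>0 S. c \<sigma> * (\<sigma> y * \<sigma> x))"
        by (intro sum.cong) (auto simp: mult)
      ultimately show ?thesis using insert.hyps
        by (simp add: sum_distrib_left algebra_simps sum_subtractf)
    qed
    then have "\<forall>\<sigma>\<in>S. c \<sigma> * (\<sigma> y - \<sigma>0 y) = 0"
      using insert.prems(1,2) by (intro insert.IH) auto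
    then show ?thesis using \<sigma>1 y by auto
  qed
  then have "(\<Sum>\<sigma>\<in>S. c \<sigma> * \<sigma> 1) = 0" by (intro sum.neutral) auto
  then have "c \<sigma>0 * \<sigma>0 1 = 0" using insert.prems(3)[OF subfield_1[OF L]] insert.hyps by simp
  moreover have "\<sigma>0 1 = 1" by (rule hom_on_1[OF insert.prems(1) L]) simp
  ultimately show ?case using zero by simp
qed simp

locale presented_galois = p3_char p G "TYPE('a)" for p G and K L :: "'a::field set" +
  fixes h
  assumes galois: "galois_extension K L" and h: "h \<in> iso P (Gal K L)"
begin

sublocale galois_setting K L
  using galois by (intro galois_setting.intro) (simp add: galois_extension_def)

sublocale hom: group_hom P \<Gamma> h
  using h by (intro group_hom.intro group_hom_axioms.intro group_P Gal.group_axioms) (simp add: iso_def)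

lemma h_bij: "bij_betw h (carrier P) (carrier \<Gamma>)"
  using h by (simp add: iso_def)

abbreviation "g3 \<equiv> group_comm P g1 g2"
abbreviation "\<sigma>1 \<equiv> h g1"
abbreviation "\<sigma>2 \<equiv> h g2"
abbreviation "\<sigma>3 \<equiv> h g3"

lemma \<sigma>: "\<sigma>1 \<in> carrier \<Gamma>" "\<sigma>2 \<in> carrier \<Gamma>" "\<sigma>3 \<in> carrier \<Gamma>"
  by simp_all

lemma relations: "class2_relations \<Gamma> \<sigma>1 \<sigma>2 \<sigma>3 p (exp1 G) (exp2 G)"
proof (intro class2_relations.intro two_elements.intro two_elements_axioms.intro
    class2_relations_axioms.intro Gal.group_axioms \<sigma> p_gt_0)
  show "\<sigma>1 \<otimes>\<^bsub>\<Gamma>\<^esub> \<sigma>2 = \<sigma>2 \<otimes>\<^bsub>\<Gamma>\<^esub> \<sigma>1 \<otimes>\<^bsub>\<Gamma>\<^esub> \<sigma>3"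
    using arg_cong[OF P.ab, of h] by (simp add: hom.hom_mult)
  show "\<sigma>1 \<otimes>\<^bsub>\<Gamma>\<^esub> \<sigma>3 = \<sigma>3 \<otimes>\<^bsub>\<Gamma>\<^esub> \<sigma>1" "\<sigma>2 \<otimes>\<^bsub>\<Gamma>\<^esub> \<sigma>3 = \<sigma>3 \<otimes>\<^bsub>\<Gamma>\<^esub> \<sigma>2"
    using arg_cong[OF P.ac, of h] arg_cong[OF P.bc, of h] by (simp_all add: hom.hom_mult)
  show "\<sigma>1 [^]\<^bsub>\<Gamma>\<^esub> p = \<sigma>3 [^]\<^bsub>\<Gamma>\<^esub> exp1 G" "\<sigma>2 [^]\<^bsub>\<Gamma>\<^esub> p = \<sigma>3 [^]\<^bsub>\<Gamma>\<^esub> exp2 G" "\<sigma>3 [^]\<^bsub>\<Gamma>\<^esub> p = \<one>\<^bsub>\<Gamma>\<^esub>"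
    using arg_cong[OF P.ap, of h] arg_cong[OF P.bp, of h] arg_cong[OF P.cp, of h]
    by (simp_all add: hom.hom_nat_pow)
qed

sublocale rel: class2_relations \<Gamma> \<sigma>1 \<sigma>2 \<sigma>3 p "exp1 G" "exp2 G"
  by (rule relations)

lemma commutator_apply: "y \<in> L \<Longrightarrow> \<sigma>1 (\<sigma>2 y) = \<sigma>2 (\<sigma>1 (\<sigma>3 y))"
  using arg_cong[OF rel.ab, of "\<lambda>\<tau>. \<tau> y"] by (simp add: mult_apply into)

lemma commute3_apply: "y \<in> L \<Longrightarrow> \<sigma>1 (\<sigma>3 y) = \<sigma>3 (\<sigma>1 y)" "y \<in> L \<Longrightarrow> \<sigma>2 (\<sigma>3 y) = \<sigma>3 (\<sigma>2 y)"
  using arg_cong[OF rel.ac, of "\<lambda>\<tau>. \<tau> y"] arg_cong[OF rel.bc, of "\<lambda>\<tau>. \<tau> y"]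
  by (simp_all add: mult_apply into)

text \<open>Since \<open>\<sigma>1 \<sigma>2 = \<sigma>2 \<sigma>1 \<sigma>3\<close>, the action of \<open>\<sigma>3\<close> can be computed from those of \<open>\<sigma>1\<close> and \<open>\<sigma>2\<close>.\<close>

lemma \<sigma>3_eqI:
  assumes "y \<in> L" "z \<in> L" "\<sigma>2 (\<sigma>1 z) = \<sigma>1 (\<sigma>2 y)"
  shows "\<sigma>3 y = z"
proof -
  note inj = inj_onD[OF hom_on_inj[OF hom_L Lsub]]
  have "\<sigma>2 (\<sigma>1 (\<sigma>3 y)) = \<sigma>2 (\<sigma>1 z)" using assms commutator_apply by simp
  then have "\<sigma>1 (\<sigma>3 y) = \<sigma>1 z"
    by (rule inj[OF \<sigma>(2)]) (intro into[OF \<sigma>(1)] into[OF \<sigma>(3)] assms)+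
  then show ?thesis by (rule inj[OF \<sigma>(1)]) (intro into[OF \<sigma>(3)] assms)+
qed

lemma fixed_by_generators:
  assumes y: "y \<in> L" "\<sigma>1 y = y" "\<sigma>2 y = y"
  shows "y \<in> K"
proof -
  have s3: "\<sigma>3 y = y" by (rule \<sigma>3_eqI) (use y in simp_all)
  have "\<tau> y = y" if "\<tau> \<in> carrier \<Gamma>" for \<tau>
  proof -
    have "\<tau> \<in> h ` carrier P" unfolding bij_betw_imp_surj_on[OF h_bij] by (rule that)
    then obtain q where q: "q \<in> carrier P" "\<tau> = h q" by (elim imageE) simp
    obtain i j k where "q = P.nf i j k" using carrier_P[OF q(1)] by blast
    then have "\<tau> = \<sigma>1 [^]\<^bsub>\<Gamma>\<^esub> i \<otimes>\<^bsub>\<Gamma>\<^esub> \<sigma>2 [^]\<^bsub>\<Gamma>\<^esub> j \<otimes>\<^bsub>\<Gamma>\<^esub> \<sigma>3 [^]\<^bsub>\<Gamma>\<^esub> k"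
      using q by (simp add: P.nf_def hom.hom_mult hom.hom_nat_pow)
    then show ?thesis using y s3 by (simp add: mult_apply pow_fixed)
  qed
  then show ?thesis using galois y(1) by (auto simp: galois_extension_def)
qed

lemma finite_Gal: "finite (carrier \<Gamma>)"
  using bij_betw_finite[OF h_bij] finite_P by simp

lemma left_mult_bij:
  assumes "group A" "a \<in> carrier A"
  shows "bij_betw (\<lambda>x. a \<otimes>\<^bsub>A\<^esub> x) (carrier A) (carrier A)"
  using group.inj_on_cmult[OF assms] group.surj_const_mult[OF assms] by (simp add: bij_betw_def)

lemma ex_trace_1: obtains \<theta> where "\<theta> \<in> L" "(\<Sum>\<tau>\<in>carrier \<Gamma>. \<tau> \<theta>) = 1"
proof -
  have "\<exists>x\<in>L. (\<Sum>\<tau>\<in>carrier \<Gamma>. \<tau> x) \<noteq> 0"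
  proof (rule ccontr)
    assume "\<not> ?thesis"
    then have z: "(\<Sum>\<tau>\<in>carrier \<Gamma>. 1 * \<tau> x) = 0" if "x \<in> L" for x using that by simp
    have "\<exists>x\<in>L. \<sigma> x \<noteq> \<tau> x" if "\<sigma> \<in> carrier \<Gamma>" "\<tau> \<in> carrier \<Gamma>" "\<sigma> \<noteq> \<tau>" for \<sigma> \<tau>
      using Gal_ext[OF that(1,2)] that(3) by blast
    then have "\<forall>\<sigma>\<in>carrier \<Gamma>. (1::'a) = 0"
      by (intro independence_of_homs[OF finite_Gal Lsub hom_L _ z])
    then show False using Gal.one_closed by auto
  qed
  then obtain x where x: "x \<in> L" "(\<Sum>\<tau>\<in>carrier \<Gamma>. \<tau> x) \<noteq> 0" by blast
  define t where "t = (\<Sum>\<tau>\<in>carrier \<Gamma>. \<tau> x)"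
  have tL: "t \<in> L" unfolding t_def by (intro subfield_sum[OF Lsub] into[OF _ x(1)])
  have "\<rho> t = t" if \<rho>: "\<rho> \<in> carrier \<Gamma>" for \<rho>
  proof -
    have "\<rho> t = (\<Sum>\<tau>\<in>carrier \<Gamma>. (\<rho> \<otimes>\<^bsub>\<Gamma>\<^esub> \<tau>) x)"
      unfolding t_def using \<rho> x by (subst hom_on_sum[OF hom_L[OF \<rho>] Lsub]) (auto simp: mult_apply into)
    also have "\<dots> = t" unfolding t_def
      by (rule sum.reindex_bij_betw[OF left_mult_bij[OF Gal.group_axioms \<rho>], of "\<lambda>\<tau>. \<tau> x"])
    finally show ?thesis .
  qed
  then have "t \<in> K" using galois tL by (auto simp: galois_extension_def)
  then have it: "inverse t \<in> K" by (rule subfield_inverse[OF Ksub])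
  have "(\<Sum>\<tau>\<in>carrier \<Gamma>. \<tau> (inverse t * x)) = (\<Sum>\<tau>\<in>carrier \<Gamma>. inverse t * \<tau> x)"
    using it K_sub x by (intro sum.cong) (auto simp: Gmult fixK)
  also have "\<dots> = 1" using x(2) by (simp add: t_def[symmetric] sum_distrib_left[symmetric])
  finally show ?thesis using that[of "inverse t * x"] it K_sub x Lcl(4) by blast
qed

lemma BijGroup_apply:
  "S \<in> Bij L \<Longrightarrow> T \<in> Bij L \<Longrightarrow> y \<in> L \<Longrightarrow> (S \<otimes>\<^bsub>BijGroup L\<^esub> T) y = S (T y)"
  by (simp add: BijGroup_def compose_def)

text \<open>
  Prescribing \<open>\<sigma>1 z - z = a1\<close> and \<open>\<sigma>2 z - z = a2\<close> means looking for a common fixed point of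
  the affine maps \<open>T\<^sub>i y = \<sigma>\<^sub>i y - a\<^sub>i\<close>. The hypotheses say that these satisfy the defining
  relations of the group, so they extend to an action \<open>T\<close> of it on \<open>L\<close>. With an element
  \<open>\<theta>\<close> of trace \<open>1\<close>, the weighted average \<open>\<Sum> q(\<theta>) T\<^sub>q(0)\<close> over the group is fixed.
\<close>

lemma additive_hilbert_90:
  assumes a: "a1 \<in> L" "a2 \<in> L" "a3 \<in> K"
    and comm: "\<sigma>1 a2 + a1 = \<sigma>2 a1 + a2 + a3"
    and fix3: "\<sigma>3 a1 = a1" "\<sigma>3 a2 = a2"
    and norm1: "(\<Sum>i<p. (\<sigma>1 [^]\<^bsub>\<Gamma>\<^esub> i) a1) = of_nat (exp1 G) * a3"
    and norm2: "(\<Sum>i<p. (\<sigma>2 [^]\<^bsub>\<Gamma>\<^esub> i) a2) = of_nat (exp2 G) * a3"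
  obtains z where "z \<in> L" "\<sigma>1 z = z + a1" "\<sigma>2 z = z + a2"
proof -
  let ?B = "BijGroup L"
  interpret B: group ?B by (rule group_BijGroup)
  have a3L: "a3 \<in> L" using a K_sub by auto
  define T where "T \<sigma> b = (\<lambda>y\<in>L. \<sigma> y - b)" for \<sigma> :: "'a \<Rightarrow> 'a" and b
  have T_apply: "T \<sigma> b y = \<sigma> y - b" if "y \<in> L" for \<sigma> b y using that by (simp add: T_def)
  have T_Bij: "T \<sigma> b \<in> Bij L" if \<sigma>: "\<sigma> \<in> carrier \<Gamma>" and b: "b \<in> L" for \<sigma> b
  proof -
    have im: "\<sigma> ` L = L" using Gal_automorphism(1)[OF KL \<sigma>] by (simp add: automorphism_on_def)
    have "inj_on (T \<sigma> b) L"
      using hom_on_inj[OF hom_L[OF \<sigma>] Lsub] by (auto simp: inj_on_def T_def)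
    moreover have "T \<sigma> b ` L = L"
    proof (intro equalityI subsetI)
      fix y assume y: "y \<in> L"
      then have "y + b \<in> \<sigma> ` L" using im b Lcl by auto
      then obtain x where "x \<in> L" "\<sigma> x = y + b" by auto
      then show "y \<in> T \<sigma> b ` L" by (intro image_eqI[of _ _ x]) (auto simp: T_def)
    qed (use into[OF \<sigma>] b Lcl in \<open>auto simp: T_def\<close>)
    ultimately show ?thesis by (auto simp: Bij_def bij_betw_def T_def)
  qed
  have carr: "carrier ?B = Bij L" by (simp add: BijGroup_def)
  have eqI: "S = S'" if "S \<in> Bij L" "S' \<in> Bij L" "\<And>y. y \<in> L \<Longrightarrow> S y = S' y" for S S'
    by (rule extensionalityI[of _ L]) (use that Bij_imp_extensional in auto)
  have mult_Bij: "S \<otimes>\<^bsub>?B\<^esub> S' \<in> Bij L" if "S \<in> Bij L" "S' \<in> Bij L" for S S'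
    using B.m_closed that unfolding carr .
  have pow_Bij: "S [^]\<^bsub>?B\<^esub> (n::nat) \<in> Bij L" if "S \<in> Bij L" for S n
    using B.nat_pow_closed that unfolding carr .
  have T_into: "T \<sigma> b y \<in> L" if "\<sigma> \<in> carrier \<Gamma>" "b \<in> L" "y \<in> L" for \<sigma> b y
    using that into Lcl by (simp add: T_apply)
  have one_apply: "\<one>\<^bsub>?B\<^esub> y = y" if "y \<in> L" for y using that by (simp add: BijGroup_def)
  have T_pow: "(T \<sigma> b [^]\<^bsub>?B\<^esub> n) y = (\<sigma> [^]\<^bsub>\<Gamma>\<^esub> n) y - (\<Sum>i<n. (\<sigma> [^]\<^bsub>\<Gamma>\<^esub> i) b)"
    if \<sigma>: "\<sigma> \<in> carrier \<Gamma>" and b: "b \<in> L" and y: "y \<in> L" for \<sigma> b y and n :: nat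
  proof (induction n)
    case 0
    show ?case using y by (simp add: one_apply Gal_one_apply)
  next
    case (Suc n)
    have in_L: "(\<sigma> [^]\<^bsub>\<Gamma>\<^esub> i) x \<in> L" if "x \<in> L" for i :: nat and x
      by (rule into[OF Gal.nat_pow_closed[OF \<sigma>] that])
    have "(T \<sigma> b [^]\<^bsub>?B\<^esub> Suc n) y = T \<sigma> b ((T \<sigma> b [^]\<^bsub>?B\<^esub> n) y)"
      using B.nat_pow_Suc2[of "T \<sigma> b" n] T_Bij[OF \<sigma> b] pow_Bij y
      by (simp add: carr BijGroup_apply del: B.nat_pow_Suc)
    also have "\<dots> = \<sigma> ((\<sigma> [^]\<^bsub>\<Gamma>\<^esub> n) y - (\<Sum>i<n. (\<sigma> [^]\<^bsub>\<Gamma>\<^esub> i) b)) - b"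
      unfolding Suc by (intro T_apply Lcl in_L y b)
    also have "\<dots> = \<sigma> ((\<sigma> [^]\<^bsub>\<Gamma>\<^esub> n) y) - (\<Sum>i<n. \<sigma> ((\<sigma> [^]\<^bsub>\<Gamma>\<^esub> i) b)) - b"
    proof -
      have "\<sigma> (\<Sum>i<n. (\<sigma> [^]\<^bsub>\<Gamma>\<^esub> i) b) = (\<Sum>i<n. \<sigma> ((\<sigma> [^]\<^bsub>\<Gamma>\<^esub> i) b))"
        by (intro hom_on_sum[OF hom_L[OF \<sigma>] Lsub] in_L b)
      moreover have "(\<Sum>i<n. (\<sigma> [^]\<^bsub>\<Gamma>\<^esub> i) b) \<in> L" by (intro Lcl in_L b)
      ultimately show ?thesis by (simp add: Gdiff[OF \<sigma> in_L[OF y]])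
    qed
    also have "\<dots> = (\<sigma> [^]\<^bsub>\<Gamma>\<^esub> Suc n) y - (\<Sum>i<Suc n. (\<sigma> [^]\<^bsub>\<Gamma>\<^esub> i) b)"
      unfolding sum.lessThan_Suc_shift pow_apply_Suc[OF \<sigma> y] pow_apply_Suc[OF \<sigma> b]
      using b by (simp add: Gal_one_apply)
    finally show ?case .
  qed
  let ?T1 = "T \<sigma>1 a1" and ?T2 = "T \<sigma>2 a2" and ?T3 = "T \<sigma>3 a3"
  note Bij = T_Bij[OF \<sigma>(1) a(1)] T_Bij[OF \<sigma>(2) a(2)] T_Bij[OF \<sigma>(3) a3L]
  note TL = T_into[OF \<sigma>(1) a(1)] T_into[OF \<sigma>(2) a(2)] T_into[OF \<sigma>(3) a3L]
  have T3_pow: "(?T3 [^]\<^bsub>?B\<^esub> n) y = (\<sigma>3 [^]\<^bsub>\<Gamma>\<^esub> n) y - of_nat n * a3" if "y \<in> L" for n :: nat and y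
    using T_pow[OF \<sigma>(3) a3L that, of n] pow_fixed[OF \<sigma>(3) a3L fixK[OF \<sigma>(3) a(3)]] by simp
  have "class2_relations ?B ?T1 ?T2 ?T3 p (exp1 G) (exp2 G)"
  proof (intro class2_relations.intro two_elements.intro two_elements_axioms.intro
      class2_relations_axioms.intro B.group_axioms p_gt_0)
    show "?T1 \<in> carrier ?B" "?T2 \<in> carrier ?B" "?T3 \<in> carrier ?B" using Bij by (simp_all add: carr)
    note ap = BijGroup_apply Bij mult_Bij pow_Bij TL T_apply into[OF \<sigma>(1)] into[OF \<sigma>(2)] into[OF \<sigma>(3)] a a3L
      Gdiff[OF \<sigma>(1)] Gdiff[OF \<sigma>(2)] Gdiff[OF \<sigma>(3)] fixK[OF \<sigma>(1) a(3)] fixK[OF \<sigma>(2) a(3)] fixK[OF \<sigma>(3) a(3)]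
      subfield_diff[OF Lsub]
    show "?T1 \<otimes>\<^bsub>?B\<^esub> ?T2 = ?T2 \<otimes>\<^bsub>?B\<^esub> ?T1 \<otimes>\<^bsub>?B\<^esub> ?T3"
    proof (rule eqI)
      fix y assume y: "y \<in> L"
      have "(?T1 \<otimes>\<^bsub>?B\<^esub> ?T2) y = \<sigma>1 (\<sigma>2 y) - (\<sigma>1 a2 + a1)" using y by (simp add: ap)
      also have "\<dots> = \<sigma>2 (\<sigma>1 (\<sigma>3 y)) - (\<sigma>2 a1 + a2 + a3)" using commutator_apply[OF y] comm by simp
      also have "\<dots> = (?T2 \<otimes>\<^bsub>?B\<^esub> ?T1 \<otimes>\<^bsub>?B\<^esub> ?T3) y" using y by (simp add: ap)
      finally show "(?T1 \<otimes>\<^bsub>?B\<^esub> ?T2) y = (?T2 \<otimes>\<^bsub>?B\<^esub> ?T1 \<otimes>\<^bsub>?B\<^esub> ?T3) y" .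
    qed (simp_all add: ap)
    show "?T1 \<otimes>\<^bsub>?B\<^esub> ?T3 = ?T3 \<otimes>\<^bsub>?B\<^esub> ?T1" "?T2 \<otimes>\<^bsub>?B\<^esub> ?T3 = ?T3 \<otimes>\<^bsub>?B\<^esub> ?T2"
      by (rule eqI; simp add: ap commute3_apply fix3)+
    show "?T1 [^]\<^bsub>?B\<^esub> p = ?T3 [^]\<^bsub>?B\<^esub> exp1 G"
      by (rule eqI) (simp_all add: ap T_pow[OF \<sigma>(1) a(1)] T3_pow norm1 rel.ap)
    show "?T2 [^]\<^bsub>?B\<^esub> p = ?T3 [^]\<^bsub>?B\<^esub> exp2 G"
      by (rule eqI) (simp_all add: ap T_pow[OF \<sigma>(2) a(2)] T3_pow norm2 rel.bp)
    show "?T3 [^]\<^bsub>?B\<^esub> p = \<one>\<^bsub>?B\<^esub>"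
      using B.one_closed unfolding carr
      by (intro eqI) (simp_all add: ap T3_pow rel.cp Gal_one_apply one_apply)
  qed
  then obtain f where f: "f \<in> Group.hom P ?B" "f g1 = ?T1" "f g2 = ?T2" by (rule hom_from_P)
  have f_Bij: "f q \<in> Bij L" if "q \<in> carrier P" for q using hom_in_carrier[OF f(1) that] by (simp add: carr)
  have f0: "f q 0 \<in> L" if "q \<in> carrier P" for q
    using Bij_imp_funcset[OF f_Bij[OF that]] subfield_0[OF Lsub] by blast
  obtain \<theta> where \<theta>: "\<theta> \<in> L" "(\<Sum>\<tau>\<in>carrier \<Gamma>. \<tau> \<theta>) = 1" by (rule ex_trace_1)
  have tr: "(\<Sum>q\<in>carrier P. h q \<theta>) = 1"
    using sum.reindex_bij_betw[OF h_bij, of "\<lambda>\<tau>. \<tau> \<theta>"] \<theta>(2) by simp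
  define z where "z = (\<Sum>q\<in>carrier P. h q \<theta> * f q 0)"
  have hL: "h q \<theta> \<in> L" if "q \<in> carrier P" for q using that \<theta> into by simp
  have zL: "z \<in> L" unfolding z_def by (intro Lcl hL f0)
  have shift: "h g z = z + b" if g: "g \<in> carrier P" and fg: "f g = T (h g) b" and b: "b \<in> L" for g b
  proof -
    have hg: "h g \<in> carrier \<Gamma>" using g by simp
    let ?q = "\<lambda>q. g \<otimes>\<^bsub>P\<^esub> q"
    have "h g z = (\<Sum>q\<in>carrier P. h g (h q \<theta> * f q 0))"
      unfolding z_def by (intro hom_on_sum[OF hom_L[OF hg] Lsub] Lcl hL f0)
    also have "\<dots> = (\<Sum>q\<in>carrier P. h (?q q) \<theta> * f (?q q) 0 + b * h (?q q) \<theta>)"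
    proof (rule sum.cong)
      fix q assume q: "q \<in> carrier P"
      have hq: "h g (h q \<theta>) = h (?q q) \<theta>" using g q \<theta> by (simp add: hom.hom_mult mult_apply)
      have "f (?q q) 0 = h g (f q 0) - b"
        using hom_mult[OF f(1) g q] f_Bij[OF g] f_Bij[OF q] subfield_0[OF Lsub] f0[OF q]
        by (simp add: BijGroup_apply) (simp add: fg T_apply)
      then have hf: "h g (f q 0) = f (?q q) 0 + b" by simp
      show "h g (h q \<theta> * f q 0) = h (?q q) \<theta> * f (?q q) 0 + b * h (?q q) \<theta>"
        unfolding Gmult[OF hg hL[OF q] f0[OF q]] hq hf by (simp add: algebra_simps)
    qed simp
    also have "\<dots> = (\<Sum>q\<in>carrier P. h q \<theta> * f q 0 + b * h q \<theta>)"
      by (rule sum.reindex_bij_betw[OF left_mult_bij[OF group_P g], of "\<lambda>q. h q \<theta> * f q 0 + b * h q \<theta>"])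
    also have "\<dots> = z + b * (\<Sum>q\<in>carrier P. h q \<theta>)" by (simp add: z_def sum.distrib sum_distrib_left)
    finally show ?thesis by (simp add: tr)
  qed
  show ?thesis using that[OF zL] shift[of g1 a1] shift[of g2 a2] f a by simp
qed

section \<open>Generators of a Galois extension with given group\<close>

text \<open>
  If \<open>\<tau>\<close> has order \<open>p\<close> and \<open>\<tau> x = x + 1\<close>, then \<open>1 - (\<tau>\<^sup>i x - x)\<^bsup>p-1\<^esup>\<close> is \<open>1\<close> for
  \<open>i = 0\<close> and \<open>0\<close> otherwise. Multiplying by \<open>\<tau>\<^sup>i y\<close>, summing over \<open>i\<close> and expanding writes \<open>y\<close>
  as a polynomial in \<open>x\<close> whose coefficients are traces.
\<close>

lemma generated_by_translation:
  fixes E M :: "'a set"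
  assumes E: "subfield E \<Omega>" and M: "subfield M \<Omega>" and \<tau>: "hom_on E \<tau>" "\<And>y. y \<in> E \<Longrightarrow> \<tau> y \<in> E"
    and order: "\<And>y. y \<in> E \<Longrightarrow> (\<tau> ^^ p) y = y"
    and x: "x \<in> E" "\<tau> x = x + 1" "x \<in> M"
    and fixed: "\<And>y. y \<in> E \<Longrightarrow> \<tau> y = y \<Longrightarrow> y \<in> M"
  shows "E \<subseteq> M"
proof
  fix y :: 'a assume y: "y \<in> E"
  note h = hom_on_add[OF \<tau>(1) E] hom_on_mult[OF \<tau>(1) E] hom_on_power[OF \<tau>(1) E] hom_on_of_nat[OF \<tau>(1) E]
    hom_on_1[OF \<tau>(1) E]
  have it: "(\<tau> ^^ i) u \<in> E" if "u \<in> E" for i u using that \<tau>(2) by (induction i) auto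
  have it_x: "(\<tau> ^^ i) x = x + of_nat i" for i
  proof (induction i)
    case (Suc i)
    then show ?case using x subfield_of_nat[OF E] by (simp add: h ac_simps)
  qed simp
  have it_pow: "(\<tau> ^^ i) (x ^ k * u) = ((\<tau> ^^ i) x) ^ k * (\<tau> ^^ i) u" if "u \<in> E" for i k u
  proof (induction i)
    case (Suc i)
    have "((\<tau> ^^ i) x) ^ k \<in> E" by (intro subfield_power[OF E] it x)
    then show ?case using Suc it[OF that] it[OF x(1)] by (simp add: h)
  qed simp
  define Tr where "Tr u = (\<Sum>i<p. (\<tau> ^^ i) u)" for u
  have Tr: "Tr u \<in> M" if u: "u \<in> E" for u
  proof (rule fixed)
    show "Tr u \<in> E" unfolding Tr_def by (intro subfield_sum[OF E] it u)
    have "\<tau> (Tr u) = (\<Sum>i<p. \<tau> ((\<tau> ^^ i) u))" unfolding Tr_def by (intro hom_on_sum[OF \<tau>(1) E] it u)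
    also have "\<dots> + u = (\<Sum>i<Suc p. (\<tau> ^^ i) u)" unfolding sum.lessThan_Suc_shift by simp
    also have "\<dots> = Tr u + u" using order[OF u] by (simp add: Tr_def)
    finally show "\<tau> (Tr u) = Tr u" by simp
  qed
  have pow1: "(of_nat i :: 'a) ^ (p - 1) = (if i = 0 then 0 else 1)" if i: "i < p" for i
  proof (cases "i = 0")
    case False
    have "(of_nat i :: 'a) ^ (p - 1) * of_nat i = of_nat i"
      using frob_of_nat[of i] p_gt_0 by (metis Suc_diff_1 power_Suc2)
    moreover have "(of_nat i :: 'a) \<noteq> 0" using False i by (auto simp: of_nat_eq_0 dest: dvd_imp_le)
    ultimately show ?thesis using False by simp
  qed (use p_gt_1 in simp)
  have ind: "(\<Sum>i<p. (of_nat i :: 'a) ^ (p - 1) * (\<tau> ^^ i) y) = Tr y - y"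
  proof -
    have "(\<Sum>i<p. (of_nat i :: 'a) ^ (p - 1) * (\<tau> ^^ i) y)
        = (\<Sum>i<p. (if i = 0 then 0 else 1) * (\<tau> ^^ i) y)"
      by (rule sum.cong) (simp_all only: pow1 lessThan_iff)
    also have "\<dots> = (\<Sum>i\<in>{..<p} - {0}. (\<tau> ^^ i) y)"
      by (rule sum.mono_neutral_cong_right) auto
    also have "\<dots> = Tr y - y" unfolding Tr_def using p_gt_0 by (subst sum_diff1) auto
    finally show ?thesis .
  qed
  let ?c = "\<lambda>k. of_nat ((p - 1) choose k) * (- x) ^ k"
  have "(\<Sum>i<p. (of_nat i :: 'a) ^ (p - 1) * (\<tau> ^^ i) y)
      = (\<Sum>i<p. \<Sum>k\<le>p - 1. ?c k * (\<tau> ^^ i) (x ^ (p - 1 - k) * y))"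
  proof (rule sum.cong)
    fix i
    have "(of_nat i :: 'a) = (- x) + (\<tau> ^^ i) x" by (simp add: it_x)
    then have "(of_nat i :: 'a) ^ (p - 1) = (\<Sum>k\<le>p - 1. ?c k * ((\<tau> ^^ i) x) ^ (p - 1 - k))"
      by (simp only: binomial_ring)
    then show "(of_nat i :: 'a) ^ (p - 1) * (\<tau> ^^ i) y = (\<Sum>k\<le>p - 1. ?c k * (\<tau> ^^ i) (x ^ (p - 1 - k) * y))"
      by (simp only: sum_distrib_right it_pow[OF y] mult.assoc)
  qed simp
  also have "\<dots> = (\<Sum>k\<le>p - 1. ?c k * Tr (x ^ (p - 1 - k) * y))"
    unfolding Tr_def sum_distrib_left by (rule sum.swap)
  finally have "y = Tr y - (\<Sum>k\<le>p - 1. ?c k * Tr (x ^ (p - 1 - k) * y))" using ind by simp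
  also have "\<dots> \<in> M"
    by (intro subfield_intros[OF M] Tr y x subfield_mult[OF E] subfield_power[OF E])
  finally show "y \<in> M" .
qed

lemma funpow_eq_pow: "\<sigma> \<in> carrier \<Gamma> \<Longrightarrow> y \<in> L \<Longrightarrow> (\<sigma> ^^ n) y = (\<sigma> [^]\<^bsub>\<Gamma>\<^esub> n) y"
proof (induction n)
  case (Suc n)
  then show ?case unfolding pow_apply_Suc[OF Suc.prems] by simp
qed (simp add: Gal_one_apply)

text \<open>
  The three steps of the tower \<open>K \<subseteq> L\<^bsup>\<sigma>2,\<sigma>3\<^esup> \<subseteq> L\<^bsup>\<sigma>3\<^esup> \<subseteq> L\<close> are generated by \<open>x1\<close>, \<open>x2\<close>
  and \<open>x3\<close>, because \<open>\<sigma>1\<close>, \<open>\<sigma>2\<close> and \<open>\<sigma>3\<close> have order \<open>p\<close> on the respective upper fields.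
\<close>

lemma L_eq_adjoin:
  assumes x: "x1 \<in> L" "x2 \<in> L" "x3 \<in> L"
    and \<sigma>1_x1: "\<sigma>1 x1 = x1 + 1" and \<sigma>2_x: "\<sigma>2 x1 = x1" "\<sigma>2 x2 = x2 + 1"
    and \<sigma>3_x: "\<sigma>3 x1 = x1" "\<sigma>3 x2 = x2" "\<sigma>3 x3 = x3 + 1"
  shows "L = adjoin K {x1, x2, x3}"
proof
  let ?M = "adjoin K {x1, x2, x3}"
  note M = adjoin_subfield[of K "{x1, x2, x3}"]
  have KM: "K \<subseteq> ?M" and xM: "x1 \<in> ?M" "x2 \<in> ?M" "x3 \<in> ?M"
    using subset_adjoin(1)[of K "{x1, x2, x3}"] subset_adjoin(2)[of "{x1, x2, x3}" K] by auto
  define E2 where "E2 = {y \<in> L. \<sigma>3 y = y}"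
  define E1 where "E1 = {y \<in> E2. \<sigma>2 y = y}"
  have E2: "subfield E2 \<Omega>" unfolding E2_def by (rule equalizer_subfield[OF Lsub hom_L[OF \<sigma>(3)] hom_on_id])
  have E2L: "E2 \<subseteq> L" by (auto simp: E2_def)
  have hom2: "hom_on E2 \<sigma>1" "hom_on E2 \<sigma>2" using E2L hom_L[OF \<sigma>(1)] hom_L[OF \<sigma>(2)] by (auto intro: hom_on_mono)
  have E1: "subfield E1 \<Omega>" unfolding E1_def by (rule equalizer_subfield[OF E2 hom2(2) hom_on_id])
  have E1E2: "E1 \<subseteq> E2" by (auto simp: E1_def)
  have "E1 \<subseteq> ?M"
  proof (rule generated_by_translation[OF E1 M, where x = x1])
    show "hom_on E1 \<sigma>1" by (rule hom_on_mono[OF hom2(1) E1E2])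
    show "\<sigma>1 y \<in> E1" if "y \<in> E1" for y
    proof -
      have y: "y \<in> L" "\<sigma>3 y = y" "\<sigma>2 y = y" using that by (auto simp: E1_def E2_def)
      then show ?thesis using commute3_apply(1)[OF y(1)] commutator_apply[OF y(1)] into[OF \<sigma>(1)]
        by (simp add: E1_def E2_def)
    qed
    show "(\<sigma>1 ^^ p) y = y" if "y \<in> E1" for y
      using that by (simp add: E1_def E2_def funpow_eq_pow rel.ap pow_fixed)
    show "y \<in> ?M" if "y \<in> E1" "\<sigma>1 y = y" for y
      using fixed_by_generators[of y] that KM by (auto simp: E1_def E2_def)
  qed (use x \<sigma>1_x1 \<sigma>2_x \<sigma>3_x xM in \<open>auto simp: E1_def E2_def\<close>)
  have "E2 \<subseteq> ?M"
  proof (rule generated_by_translation[OF E2 M hom2(2), where x = x2])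
    show "\<sigma>2 y \<in> E2" if "y \<in> E2" for y
      using that commute3_apply(2)[of y] into[OF \<sigma>(2)] by (auto simp: E2_def)
    show "(\<sigma>2 ^^ p) y = y" if "y \<in> E2" for y
      using that by (simp add: E2_def funpow_eq_pow rel.bp pow_fixed)
    show "y \<in> ?M" if "y \<in> E2" "\<sigma>2 y = y" for y using that \<open>E1 \<subseteq> ?M\<close> by (auto simp: E1_def)
  qed (use x \<sigma>2_x \<sigma>3_x xM in \<open>auto simp: E2_def\<close>)
  show "L \<subseteq> ?M"
  proof (rule generated_by_translation[OF Lsub M hom_L[OF \<sigma>(3)] into[OF \<sigma>(3)], where x = x3])
    show "(\<sigma>3 ^^ p) y = y" if "y \<in> L" for y
      using that by (simp add: funpow_eq_pow rel.cp Gal_one_apply)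
    show "y \<in> ?M" if "y \<in> L" "\<sigma>3 y = y" for y using that \<open>E2 \<subseteq> ?M\<close> by (auto simp: E2_def)
  qed (use x \<sigma>3_x xM in auto)
  show "?M \<subseteq> L" by (rule adjoin_least[OF Lsub K_sub]) (use x in auto)
qed

text \<open>
  The elements \<open>x1\<close> and \<open>x2\<close> come from the two characters of the group that are dual to the generators.
  The displacements prescribed for \<open>x3\<close> satisfy the hypotheses of the additive Hilbert 90: the
  commutator condition holds since \<open>\<sigma>2\<close> changes \<open>- x2\<close> by \<open>- 1\<close>, and the norm conditions hold
  since the carries \<open>S(x + i, 1)\<close> sum up to \<open>1\<close>.
\<close>

lemma ex_generators:
  obtains x1 x2 x3 where "x1 \<in> L" "x2 \<in> L" "x3 \<in> L" "\<sigma>1 x1 = x1 + 1" "\<sigma>1 x2 = x2"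
    "\<sigma>2 x1 = x1" "\<sigma>2 x2 = x2 + 1" "wp x1 \<in> K" "wp x2 \<in> K"
    "wp x3 - s_term p G (wp x1) (wp x2) x1 x2 \<in> K" "L = adjoin K {x1, x2, x3}"
proof -
  have pow1: "(\<sigma> [^]\<^bsub>\<Gamma>\<^esub> (i::nat)) 1 = 1" "(\<sigma> [^]\<^bsub>\<Gamma>\<^esub> i) 0 = 0" if "\<sigma> \<in> carrier \<Gamma>" for \<sigma> i
    using hom_on_1[OF hom_L Lsub] hom_on_0[OF hom_L Lsub] that by simp_all
  have sub: "(0::'a) \<in> L" "(1::'a) \<in> L" "(0::'a) \<in> K" "(1::'a) \<in> K"
    using Lcl(1,2) subfield_0[OF Ksub] subfield_1[OF Ksub] by auto
  obtain x1 where x1: "x1 \<in> L" "\<sigma>1 x1 = x1 + 1" "\<sigma>2 x1 = x1 + 0"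
    by (rule additive_hilbert_90[of 1 0 0]) (use sub \<sigma> in \<open>simp_all add: G1 G0 pow1\<close>)
  obtain x2 where x2: "x2 \<in> L" "\<sigma>1 x2 = x2 + 0" "\<sigma>2 x2 = x2 + 1"
    by (rule additive_hilbert_90[of 0 1 0]) (use sub \<sigma> in \<open>simp_all add: G1 G0 pow1\<close>)
  have s3: "\<sigma>3 x1 = x1" "\<sigma>3 x2 = x2"
    by (rule \<sigma>3_eqI; use x1 x2 sub \<sigma> in \<open>simp add: Gadd G1\<close>)+
  have cL: "carry p u 1 \<in> L" if "u \<in> L" for u by (intro carry_closed[OF Lsub] that Lcl)
  have \<epsilon>K: "\<epsilon>1 \<in> K" "\<epsilon>2 \<in> K" unfolding \<epsilon>1_def \<epsilon>2_def by (rule subfield_of_nat[OF Ksub])+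
  have mL: "move1 x1 x2 \<in> L" "move2 x2 \<in> L"
    unfolding move1_def move2_def using \<epsilon>K K_sub x1 x2 by (auto intro!: Lcl cL)
  have \<epsilon>L: "\<epsilon>1 \<in> L" "\<epsilon>2 \<in> L" using \<epsilon>K K_sub by auto
  have act_m1: "\<sigma> (move1 x1 x2) = - \<sigma> x2 + \<epsilon>1 * carry p (\<sigma> x1) 1"
    and act_m2: "\<sigma> (move2 x2) = \<epsilon>2 * carry p (\<sigma> x2) 1" if "\<sigma> \<in> carrier \<Gamma>" for \<sigma>
  proof -
    have e: "\<epsilon>1 * carry p x1 1 \<in> L" "- x2 \<in> L" using \<epsilon>L x1 x2 by (auto intro!: Lcl cL)
    show "\<sigma> (move1 x1 x2) = - \<sigma> x2 + \<epsilon>1 * carry p (\<sigma> x1) 1" "\<sigma> (move2 x2) = \<epsilon>2 * carry p (\<sigma> x2) 1"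
      unfolding move1_def move2_def using that e x1 x2 \<epsilon>L \<epsilon>K cL sub
      by (simp_all only: Gadd Gneg Gmult Gcarry G1 fixK)
  qed
  have pow_x: "(\<sigma>1 [^]\<^bsub>\<Gamma>\<^esub> i) x1 = x1 + of_nat i" "(\<sigma>2 [^]\<^bsub>\<Gamma>\<^esub> i) x2 = x2 + of_nat i"
    "(\<sigma>1 [^]\<^bsub>\<Gamma>\<^esub> i) x2 = x2" for i :: nat
  proof -
    show "(\<sigma>1 [^]\<^bsub>\<Gamma>\<^esub> i) x2 = x2" using pow_fixed[OF \<sigma>(1) x2(1)] x2(2) by simp
    show "(\<sigma>1 [^]\<^bsub>\<Gamma>\<^esub> i) x1 = x1 + of_nat i" "(\<sigma>2 [^]\<^bsub>\<Gamma>\<^esub> i) x2 = x2 + of_nat i"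
      using pow_translation_const[OF \<sigma>(1) x1(1,2) sub(4), of i]
        pow_translation_const[OF \<sigma>(2) x2(1,3) sub(4), of i] by simp_all
  qed
  obtain x3 where x3: "x3 \<in> L" "\<sigma>1 x3 = x3 + move1 x1 x2" "\<sigma>2 x3 = x3 + move2 x2"
  proof (rule additive_hilbert_90[of "move1 x1 x2" "move2 x2" 1])
    show "\<sigma>1 (move2 x2) + move1 x1 x2 = \<sigma>2 (move1 x1 x2) + move2 x2 + 1"
      using \<sigma> x1 x2 by (simp add: act_m1 act_m2) (simp add: move1_def move2_def)
    show "\<sigma>3 (move1 x1 x2) = move1 x1 x2" "\<sigma>3 (move2 x2) = move2 x2"
      using \<sigma> s3 by (simp_all add: act_m1 act_m2) (simp_all add: move1_def move2_def)
    have "(\<Sum>i<p. (\<sigma>1 [^]\<^bsub>\<Gamma>\<^esub> i) (move1 x1 x2)) = (\<Sum>i<p. - x2 + \<epsilon>1 * carry p (x1 + of_nat i) 1)"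
      by (simp add: act_m1 pow_x)
    also have "\<dots> = \<epsilon>1 * (\<Sum>i<p. carry p (x1 + of_nat i) 1)"
      by (simp add: sum_subtractf sum.distrib sum_distrib_left)
    finally show "(\<Sum>i<p. (\<sigma>1 [^]\<^bsub>\<Gamma>\<^esub> i) (move1 x1 x2)) = of_nat (exp1 G) * 1"
      by (simp add: sum_carry_shift \<epsilon>1_def)
    have "(\<Sum>i<p. (\<sigma>2 [^]\<^bsub>\<Gamma>\<^esub> i) (move2 x2)) = \<epsilon>2 * (\<Sum>i<p. carry p (x2 + of_nat i) 1)"
      by (simp add: act_m2 pow_x sum_distrib_left)
    then show "(\<Sum>i<p. (\<sigma>2 [^]\<^bsub>\<Gamma>\<^esub> i) (move2 x2)) = of_nat (exp2 G) * 1"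
      by (simp add: sum_carry_shift \<epsilon>2_def)
  qed (use mL sub in auto)
  have s33: "\<sigma>3 x3 = x3 + 1"
  proof (rule \<sigma>3_eqI)
    show "\<sigma>2 (\<sigma>1 (x3 + 1)) = \<sigma>1 (\<sigma>2 x3)"
      using x3 x1 x2 mL \<sigma> sub Lcl(3) by (simp add: Gadd G1 act_m1 act_m2) (simp add: move1_def move2_def)
  qed (use x3 sub Lcl(3) in auto)
  have wpK: "wp y \<in> K" if "y \<in> L" "\<sigma>1 y = y + c" "\<sigma>2 y = y + d" "wp c = 0" "wp d = 0" for y c d
  proof (rule fixed_by_generators)
    show "wp y \<in> L" by (intro Lcl that)
    show "\<sigma>1 (wp y) = wp y" "\<sigma>2 (wp y) = wp y"
      using that \<sigma> Lcl(9) by (simp_all add: Gdiff Gpow frob_add)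
  qed
  have w12: "wp x1 \<in> K" "wp x2 \<in> K" using wpK[of x1 1 0] wpK[of x2 0 1] x1 x2 p_gt_0 by auto
  define s where "s = s_term p G (wp x1) (wp x2)"
  have "wp x3 - s x1 x2 \<in> K"
  proof (rule fixed_by_generators)
    have wL: "wp x1 \<in> L" "wp x2 \<in> L" using w12 K_sub by auto
    have sL: "s x1 x2 \<in> L" unfolding s_def by (intro s_term_closed[OF Lsub] wL x1 x2)
    have w3L: "wp x3 \<in> L" by (intro Lcl x3)
    show "wp x3 - s x1 x2 \<in> L" by (intro Lcl sL x3)
    have s_act: "\<sigma> (s x1 x2) = s (\<sigma> x1) (\<sigma> x2)" if "\<sigma> \<in> carrier \<Gamma>" for \<sigma>
      unfolding s_def using wL x1 x2 fixK[OF that w12(1)] fixK[OF that w12(2)]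
      by (intro s_term_hom[OF Lsub hom_L[OF that]])
    have wp_act: "\<sigma> (wp x3) = wp (\<sigma> x3)" if "\<sigma> \<in> carrier \<Gamma>" for \<sigma>
      using that x3 Lcl(9) by (simp add: Gdiff Gpow)
    show "\<sigma>1 (wp x3 - s x1 x2) = wp x3 - s x1 x2"
      unfolding Gdiff[OF \<sigma>(1) w3L sL] s_act[OF \<sigma>(1)] wp_act[OF \<sigma>(1)] x1 x2 x3 wp_add
      using wp_moves(1)[OF HOL.refl HOL.refl, of x1 x2] by (simp add: s_def)
    show "\<sigma>2 (wp x3 - s x1 x2) = wp x3 - s x1 x2"
      unfolding Gdiff[OF \<sigma>(2) w3L sL] s_act[OF \<sigma>(2)] wp_act[OF \<sigma>(2)] x1 x2 x3 wp_add
      using wp_moves(2)[OF HOL.refl HOL.refl, of x2 x1] by (simp add: s_def)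
  qed
  moreover have "L = adjoin K {x1, x2, x3}"
    by (rule L_eq_adjoin) (use x1 x2 x3 s3 s33 in auto)
  ultimately show ?thesis using that[of x1 x2 x3] x1 x2 x3 w12 by (simp add: s_def)
qed

end


section \<open>Residues in a totally ramified extension\<close>

text \<open>
  No cancellation of valuations is possible in a sum whose nonzero terms have distinct valuations.
\<close>

lemma (in valued_subfield) val_ge_terms:
  assumes t: "\<And>i. i \<in> I \<Longrightarrow> t i \<in> F" and I: "finite I"
    and dist: "\<And>i j. i \<in> I \<Longrightarrow> j \<in> I \<Longrightarrow> t i \<noteq> 0 \<Longrightarrow> t j \<noteq> 0 \<Longrightarrow> w (t i) = w (t j) \<Longrightarrow> i = j"
    and ge: "val_ge w m (sum t I)" and i: "i \<in> I"
  shows "val_ge w m (t i)"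
proof (rule ccontr)
  assume neg: "\<not> val_ge w m (t i)"
  define J where "J = {j \<in> I. t j \<noteq> 0}"
  have "i \<in> J" "w (t i) < m" using neg i by (auto simp: J_def val_ge_def)
  have J: "finite J" "J \<noteq> {}" using I \<open>i \<in> J\<close> by (auto simp: J_def)
  obtain k where k: "k \<in> J" "\<And>j. j \<in> J \<Longrightarrow> w (t k) \<le> w (t j)"
    using arg_min_if_finite[OF J, of "\<lambda>j. w (t j)"] by (metis linorder_not_less)
  have kI: "k \<in> I" "t k \<noteq> 0" using k by (auto simp: J_def)
  have rest: "val_ge w (w (t k) + 1) (\<Sum>j\<in>I - {k}. t j)"
  proof (intro val_ge_sum)
    fix j assume j: "j \<in> I - {k}"
    show "val_ge w (w (t k) + 1) (t j)"
    proof (cases "t j = 0")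
      case False
      then have "w (t k) \<le> w (t j)" "w (t k) \<noteq> w (t j)" using k j kI dist by (auto simp: J_def)
      then show ?thesis by (simp add: val_ge_def)
    qed simp
  qed (use t in auto)
  have "sum t I = t k - (- (\<Sum>j\<in>I - {k}. t j))" using I kI by (simp add: sum.remove)
  moreover have restF: "- (\<Sum>j\<in>I - {k}. t j) \<in> F" using t by (intro Fcl) auto
  moreover have "val_ge w (w (t k) + 1) (- (\<Sum>j\<in>I - {k}. t j))"
    using t by (intro val_ge_uminus rest Fcl) auto
  ultimately have "sum t I \<noteq> 0 \<and> w (sum t I) = w (t k)"
    using val_diff_eq[OF t[OF kI(1)] restF kI(2)] by simp
  then show False using ge k(2)[OF \<open>i \<in> J\<close>] \<open>w (t i) < m\<close> by (auto simp: val_ge_def)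
qed

context complete_dvf
begin

text \<open>
  The powers \<open>1, u, \<dots>, u\<^bsup>n-1\<^esup>\<close> of a uniformizer have distinct valuations modulo the degree
  \<open>n\<close>. So they are linearly independent over \<open>F\<close>, form a basis, and the residue of an integral
  element is that of its coefficient of \<open>1\<close>.
\<close>

lemma totally_ramified_residue:
  assumes ram: "totally_ramified F w L"
  obtains W n where "valued_subfield L W" "\<And>x. x \<in> F \<Longrightarrow> x \<noteq> 0 \<Longrightarrow> W x = int n * w x" "n > 0"
    "\<And>z. z \<in> L \<Longrightarrow> val_ge W 0 z \<Longrightarrow> \<exists>c\<in>F. val_ge w 0 c \<and> val_ge W 1 (z - c)"
proof -
  interpret \<Omega>: field "\<Omega> :: 'a ring" by (rule field_\<Omega>)
  define n where "n = field_degree F L"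
  obtain W where W: "normalized_valuation L W" "\<And>x. x \<in> F \<Longrightarrow> x \<noteq> 0 \<Longrightarrow> W x = int n * w x"
    using ram by (auto simp: totally_ramified_def n_def)
  have FL: "F \<subseteq> L" and L: "subfield L \<Omega>" and fin: "\<Omega>.finite_dimension F L"
    using ram by (auto simp: totally_ramified_def field_extension_def)
  have dim: "\<Omega>.dimension n F L"
    using \<Omega>.finite_dimensionE[OF F fin] by (simp add: n_def field_degree_def over_def)
  have n0: "n > 0"
  proof (rule ccontr)
    assume "\<not> n > 0"
    then have "L = {\<zero>\<^bsub>\<Omega>\<^esub>}" using \<Omega>.dimension_zero[OF F] dim by simp
    then show False using subfield_1[OF L] by (simp add: \<Omega>_simps)
  qed
  interpret V: valued_subfield L W by (rule valued_subfield.intro[OF L W(1)])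
  obtain u where u: "u \<in> L" "u \<noteq> 0" "W u = 1" by (rule V.ex_val)
  have cL: "c i * u ^ i \<in> L" if "\<forall>i. c i \<in> F" for c i using that FL u by (intro V.Fcl) auto
  have val: "W (c i * u ^ i) = int n * w (c i) + int i" if "\<forall>i. c i \<in> F" "c i \<noteq> 0" for c i
    using that FL u W(2) by (subst V.val_mult) (auto simp: V.val_power V.Fcl)
  have dist: "i = j" if c: "\<forall>i. c i \<in> F" "i < n" "j < n" "c i * u ^ i \<noteq> 0" "c j * u ^ j \<noteq> 0"
    "W (c i * u ^ i) = W (c j * u ^ j)" for c i j
  proof -
    have "(int n * w (c i) + int i) mod int n = (int n * w (c j) + int j) mod int n"
      using c val[OF c(1), of i] val[OF c(1), of j] by simp
    then show ?thesis using c(2,3) by simp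
  qed
  have terms: "val_ge W m (c i * u ^ i)"
    if c: "\<forall>i. c i \<in> F" "val_ge W m (\<Sum>i<n. c i * u ^ i)" "i < n" for c m i
  proof (rule V.val_ge_terms[of "{..<n}" "\<lambda>i. c i * u ^ i"])
    show "k = l" if "k \<in> {..<n}" "l \<in> {..<n}" "c k * u ^ k \<noteq> 0" "c l * u ^ l \<noteq> 0"
      "W (c k * u ^ k) = W (c l * u ^ l)" for k l
      using dist[OF c(1) _ _ that(3-5)] that(1,2) by simp
    show "c k * u ^ k \<in> L" for k by (rule cL[OF c(1)])
  qed (use c in simp_all)
  have indep: "lin_indep F (\<lambda>i. u ^ i) n" unfolding lin_indep_def
  proof (intro allI impI)
    fix c i assume c: "\<forall>i. c i \<in> F" "(\<Sum>i<n. c i * u ^ i) = 0" and i: "i < n"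
    have "val_ge W m (c i * u ^ i)" for m by (rule terms[OF c(1) _ i]) (simp add: c(2))
    then have "c i * u ^ i = 0" by (rule V.eq_0_of_val_ge)
    then show "c i = 0" using u by simp
  qed
  have "\<Omega>.Span F (map (\<lambda>i. u ^ i) (rev [0..<n])) = L"
  proof (rule \<Omega>.independent_length_eq_dimension[OF F dim independent_iff_lin_indep[OF F indep], THEN iffD1])
    show "set (map (\<lambda>i. u ^ i) (rev [0..<n])) \<subseteq> L" using u by (auto intro: V.Fcl)
  qed simp
  then have L_eq: "L = lin_span F (\<lambda>i. u ^ i) n" by (simp only: Span_eq_lin_span[OF F])
  have "\<exists>c\<in>F. val_ge w 0 c \<and> val_ge W 1 (z - c)" if z: "z \<in> L" "val_ge W 0 z" for z
  proof -
    obtain c where c: "\<forall>i. c i \<in> F" "z = (\<Sum>i<n. c i * u ^ i)" using z(1) unfolding L_eq lin_span_def by blast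
    have ge: "val_ge W 0 (c i * u ^ i)" if "i < n" for i using terms[OF c(1) _ that] z(2) c(2) by simp
    have "val_ge W 1 (c i * u ^ i)" if i: "i < n" "i \<noteq> 0" for i
    proof (cases "c i = 0")
      case False
      have "int n * w (c i) + int i \<noteq> 0"
      proof
        assume "int n * w (c i) + int i = 0"
        then have "(int n * w (c i) + int i) mod int n = 0" by simp
        then show False using i by simp
      qed
      moreover have "c i * u ^ i \<noteq> 0" using False u by simp
      then have "0 \<le> int n * w (c i) + int i" using ge[OF i(1)] val[OF c(1) False] u(2) by (simp add: val_ge_def)
      ultimately have "1 \<le> W (c i * u ^ i)" using val[OF c(1) False] by linarith
      then show ?thesis by (simp add: val_ge_def)
    qed simp
    then have "val_ge W 1 (\<Sum>i\<in>{..<n} - {0}. c i * u ^ i)" using cL[OF c(1)] by (intro V.val_ge_sum) auto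
    moreover have "z = c 0 * u ^ 0 + (\<Sum>i\<in>{..<n} - {0}. c i * u ^ i)"
      unfolding c(2) using n0 by (subst sum.remove[of _ 0]) auto
    ultimately have "val_ge W 1 (z - c 0)" by simp
    moreover have "val_ge w 0 (c 0)"
      using ge[OF n0] W(2)[of "c 0"] c(1) n0 by (auto simp: val_ge_def zero_le_mult_iff)
    ultimately show ?thesis using c(1) by blast
  qed
  then show ?thesis using that V.valued_subfield_axioms W(2) n0 by blast
qed

text \<open>
  An integral Artin-Schreier element has a residue in the base field. Subtracting a representative
  \<open>c\<close> moves \<open>z\<^sup>p - z\<close> into the maximal ideal, where it equals \<open>k\<^sup>p - k\<close> with \<open>k\<close> in the base field.
\<close>

lemma totally_ramified_wp_integral:
  assumes ram: "totally_ramified F w L" and z: "z \<in> L" "wp z \<in> F" "val_ge w 0 (wp z)"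
  shows "z \<in> F"
proof -
  obtain W n where V: "valued_subfield L W" and W: "\<And>x. x \<in> F \<Longrightarrow> x \<noteq> 0 \<Longrightarrow> W x = int n * w x" "n > 0"
    and res: "\<And>z. z \<in> L \<Longrightarrow> val_ge W 0 z \<Longrightarrow> \<exists>c\<in>F. val_ge w 0 c \<and> val_ge W 1 (z - c)"
    using totally_ramified_residue[OF ram] by blast
  interpret V: valued_subfield L W by (rule V)
  have FL: "F \<subseteq> L" using ram by (auto simp: totally_ramified_def field_extension_def)
  have "val_ge W 0 z"
  proof (rule ccontr)
    assume "\<not> val_ge W 0 z"
    then have neg: "z \<noteq> 0" "W z < 0" by (auto simp: val_ge_def)
    have "int p * W z + 1 \<le> W z" using neg(2) mult_right_mono_neg[OF p_ge_2, of "W z"] by linarith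
    then have "val_ge W (W (z ^ p) + 1) z" using z neg by (simp add: V.val_power val_ge_def)
    then have wz: "wp z \<noteq> 0" "W (wp z) = int p * W z"
      using V.val_diff_eq[of "z ^ p" z] z neg by (simp_all add: V.Fcl V.val_power)
    have "0 \<le> int n * w (wp z)" using z(3) wz(1) by (simp add: val_ge_def)
    then have "0 \<le> int p * W z" using W(1)[OF z(2) wz(1)] wz(2) by simp
    then show False using neg p_gt_0 by (simp add: zero_le_mult_iff)
  qed
  then obtain c where c: "c \<in> F" "val_ge w 0 c" "val_ge W 1 (z - c)" using res[OF z(1)] by blast
  have zc: "z - c \<in> L" using z c FL by (auto intro: V.Fcl)
  have wF: "wp (z - c) \<in> F" unfolding wp_diff by (intro Fcl z c)
  have "val_ge W 1 (wp (z - c))"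
  proof (rule V.val_ge_diff[OF V.Fcl(9)[OF zc] zc _ c(3)])
    have "1 \<le> int p * 1" using p_gt_0 by simp
    then show "val_ge W 1 ((z - c) ^ p)" by (rule V.val_ge_mono[OF V.val_ge_power[OF zc c(3)]])
  qed
  then have "val_ge w 1 (wp (z - c))"
  proof (cases "wp (z - c) = 0")
    case False
    then have "0 < int n * w (wp (z - c))" using W(1)[OF wF False] \<open>val_ge W 1 (wp (z - c))\<close> by (simp add: val_ge_def)
    then have "0 < w (wp (z - c))" by (simp add: zero_less_mult_iff)
    then show ?thesis by (simp add: val_ge_def)
  qed simp
  then obtain k where k: "k \<in> F" "wp k = wp (z - c)" using wp_surj_maximal_ideal[OF wF] by blast
  then have "wp (z - c - k) = 0" unfolding wp_diff[of "z - c" k] by simp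
  then obtain i where "z - c - k = of_nat i" by (rule wp_eq_0_imp)
  then have "z = of_nat i + k + c" by (simp add: algebra_simps)
  then show ?thesis using k c by (auto intro!: Fcl)
qed

end


section \<open>Change of generators\<close>

context p3_char
begin

text \<open>
  The equations of \<open>defining_data\<close> without the conditions on poles; this part is stable under the
  changes of generators below.
\<close>

definition AS_data :: "'a set \<Rightarrow> 'a \<Rightarrow> 'a \<Rightarrow> 'a \<Rightarrow> bool" where
  "AS_data K x1 x2 x3 \<longleftrightarrow> wp x1 \<in> K \<and> wp x2 \<in> K \<and>
     wp x3 - s_term p G (wp x1) (wp x2) x1 x2 \<in> K"

lemma adjoin_change:
  fixes x1 x2 x3 y1 y2 d :: 'a
  assumes "y1 \<in> adjoin K {x1, x2}" "y2 \<in> adjoin K {x1, x2}" "d \<in> adjoin K {x1, x2}"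
    and "x1 \<in> adjoin K {y1, y2}" "x2 \<in> adjoin K {y1, y2}"
  shows "adjoin K {y1, y2, x3 + d} = adjoin K {x1, x2, x3}"
proof -
  have 12: "adjoin K {y1, y2} = adjoin K {x1, x2}" by (rule adjoin_eqI) (use assms in auto)
  let ?F = "adjoin K {x1, x2}"
  have "adjoin ?F {x3 + d} = adjoin ?F {x3}"
  proof (rule adjoin_eqI)
    have mem: "d \<in> adjoin ?F {u}" "u \<in> adjoin ?F {u}" for u
      using assms(3) subset_adjoin(1)[of ?F "{u}"] subset_adjoin(2)[of "{u}" ?F] by auto
    have "x3 + d \<in> adjoin ?F {x3}" by (intro subfield_add adjoin_subfield mem)
    moreover have "x3 + d - d \<in> adjoin ?F {x3 + d}" by (intro subfield_diff adjoin_subfield mem)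
    ultimately show "{x3 + d} \<subseteq> adjoin ?F {x3}" "{x3} \<subseteq> adjoin ?F {x3 + d}" by auto
  qed
  moreover have "adjoin ?F {u} = adjoin K {x1, x2, u}" for u
    by (simp add: adjoin_adjoin insert_commute)
  moreover have "adjoin ?F {u} = adjoin K {y1, y2, u}" for u
    by (simp add: 12[symmetric] adjoin_adjoin insert_commute)
  ultimately show ?thesis by metis
qed

text \<open>
  Both sides are the carry of the fourfold Witt vector sum \<open>[x] + [k] + [a] + [b]\<close>, added in
  different orders; here \<open>x\<^sup>p = x + a\<close> and \<open>k\<^sup>p = k + b\<close>.
\<close>

lemma carry_translation:
  "carry p (x + k) (wp x + wp k) - carry p x (wp x) = wp (carry p x k) + carry p k (wp k) - carry p (wp x) (wp k)"
proof -
  define a b where "a = wp x" and "b = wp k"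
  have xp: "x ^ p = x + a" "k ^ p = k + b" by (simp_all add: a_def b_def)
  note C = carry_cocycle[OF prime_p]
  have 1: "carry p (x + k) a + carry p (x + k + a) b = carry p (x + k) (a + b) + carry p a b" by (rule C)
  have 2: "carry p (x + a) k + carry p (x + k + a) b = carry p (x + a) (k + b) + carry p k b"
    using C[of "x + a" k b] by (simp add: add.commute add.left_commute)
  have 3: "carry p x k + carry p (x + k) a = carry p x (k + a) + carry p k a" by (rule C)
  have 4: "carry p x a + carry p (x + a) k = carry p x (k + a) + carry p k a"
    using C[of x a k] carry_commute[of p a k] by (simp add: add.commute)
  have 5: "wp (carry p x k) = carry p (x + a) (k + b) - carry p x k" by (simp add: frob_carry xp)
  have "A3 - D1 = (B3 - C1) + B4 - A4"
    if "A1 + A2 = A3 + A4" "B1 + A2 = B3 + B4" "C1 + A1 = D" "D1 + B1 = D"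
    for A1 A2 A3 A4 B1 B3 B4 C1 D1 D :: 'a
  proof -
    have "A3 = A1 + A2 - A4" "B3 = B1 + A2 - B4" "C1 = D - A1" "D1 = D - B1"
      using that by (simp_all add: eq_diff_eq)
    then show ?thesis by simp
  qed
  from this[OF 1 2 3 4] show ?thesis unfolding 5 a_def b_def .
qed

lemma translate_generators:
  assumes K: "subfield K \<Omega>" and D: "AS_data K x1 x2 x3" and k: "k1 \<in> K" "k2 \<in> K"
  obtains x3' where "AS_data K (x1 + k1) (x2 + k2) x3'"
    "adjoin K {x1 + k1, x2 + k2, x3'} = adjoin K {x1, x2, x3}"
proof -
  define \<kappa>1 \<kappa>2 where "\<kappa>1 = wp x1" and "\<kappa>2 = wp x2"
  define q1 q2 where "q1 = wp k1" and "q2 = wp k2"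
  have \<kappa>: "\<kappa>1 \<in> K" "\<kappa>2 \<in> K" "wp x3 - s_term p G \<kappa>1 \<kappa>2 x1 x2 \<in> K"
    using D by (auto simp: AS_data_def \<kappa>1_def \<kappa>2_def)
  have q: "q1 \<in> K" "q2 \<in> K" unfolding q1_def q2_def using k by (auto intro: subfield_intros[OF K])
  have \<epsilon>: "\<epsilon>1 \<in> K" "\<epsilon>2 \<in> K" unfolding \<epsilon>1_def \<epsilon>2_def by (rule subfield_of_nat[OF K])+
  \<comment> \<open>The three terms of \<open>d\<close> absorb, up to constants, the change of the three terms of \<open>s_term\<close>.\<close>
  define d where "d = - (k2 * x1) + \<epsilon>1 * carry p x1 k1 + \<epsilon>2 * carry p x2 k2"
  define r where "r = \<epsilon>1 * (carry p k1 q1 - carry p \<kappa>1 q1) + \<epsilon>2 * (carry p k2 q2 - carry p \<kappa>2 q2)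
      + (k2 ^ p * \<kappa>1 - \<kappa>2 * k1 - q2 * k1)"
  have rK: "r \<in> K" unfolding r_def by (intro subfield_intros[OF K] carry_closed[OF K] \<epsilon> \<kappa> q k)
  have "wp d = - wp (k2 * x1) + \<epsilon>1 * wp (carry p x1 k1) + \<epsilon>2 * wp (carry p x2 k2)"
    unfolding d_def by (simp add: frob_add frob_diff frob_minus power_mult_distrib frob_\<epsilon> algebra_simps)
  also have "wp (k2 * x1) = q2 * x1 + k2 ^ p * \<kappa>1"
    by (simp add: q2_def \<kappa>1_def power_mult_distrib algebra_simps)
  also have "wp (carry p x1 k1) = carry p (x1 + k1) (\<kappa>1 + q1) - carry p x1 \<kappa>1 - carry p k1 q1 + carry p \<kappa>1 q1"
    using carry_translation[of x1 k1] by (simp add: \<kappa>1_def q1_def algebra_simps)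
  also have "wp (carry p x2 k2) = carry p (x2 + k2) (\<kappa>2 + q2) - carry p x2 \<kappa>2 - carry p k2 q2 + carry p \<kappa>2 q2"
    using carry_translation[of x2 k2] by (simp add: \<kappa>2_def q2_def algebra_simps)
  finally have wpd: "wp d = s_term p G (\<kappa>1 + q1) (\<kappa>2 + q2) (x1 + k1) (x2 + k2) - s_term p G \<kappa>1 \<kappa>2 x1 x2 - r"
    unfolding s_term_eq r_def by (simp add: algebra_simps)
  have "wp (x1 + k1) = \<kappa>1 + q1" "wp (x2 + k2) = \<kappa>2 + q2"
    by (simp_all add: wp_add \<kappa>1_def \<kappa>2_def q1_def q2_def)
  note w = this
  have eq: "wp (x3 + d) - s_term p G (\<kappa>1 + q1) (\<kappa>2 + q2) (x1 + k1) (x2 + k2) = (wp x3 - s_term p G \<kappa>1 \<kappa>2 x1 x2) - r"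
    unfolding wp_add wpd by simp
  have AS: "AS_data K (x1 + k1) (x2 + k2) (x3 + d)"
    unfolding AS_data_def w eq by (intro conjI subfield_add[OF K] subfield_diff[OF K] \<kappa> q rK)
  have KM: "K \<subseteq> adjoin K {u, v}" and xM: "u \<in> adjoin K {u, v}" "v \<in> adjoin K {u, v}" for u v :: 'a
    using subset_adjoin(1)[of K "{u, v}"] subset_adjoin(2)[of "{u, v}" K] by auto
  note cl = subfield_intros[OF adjoin_subfield] carry_closed[OF adjoin_subfield]
  have "adjoin K {x1 + k1, x2 + k2, x3 + d} = adjoin K {x1, x2, x3}"
  proof (rule adjoin_change)
    show "x1 + k1 \<in> adjoin K {x1, x2}" "x2 + k2 \<in> adjoin K {x1, x2}"
      using KM k by (auto intro!: subfield_add[OF adjoin_subfield] xM)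
    show "d \<in> adjoin K {x1, x2}" unfolding d_def using KM k \<epsilon> by (intro cl xM) auto
    have "(x1 + k1) - k1 \<in> adjoin K {x1 + k1, x2 + k2}" "(x2 + k2) - k2 \<in> adjoin K {x1 + k1, x2 + k2}"
      using subsetD[OF KM k(1)] subsetD[OF KM k(2)] by (intro subfield_diff[OF adjoin_subfield] xM; simp)+
    then show "x1 \<in> adjoin K {x1 + k1, x2 + k2}" "x2 \<in> adjoin K {x1 + k1, x2 + k2}" by simp_all
  qed
  then show ?thesis using that AS by blast
qed

text \<open>
  Replacing \<open>\<sigma>1\<close> by \<open>\<sigma>1 \<sigma>2\<^bsup>-m\<^esup>\<close> defines an automorphism of \<open>H(p\<^sup>3)\<close> and \<open>M(p\<^sup>3)\<close>; on the dual side
  it adds \<open>m x1\<close> to \<open>x2\<close>. The new term \<open>- m \<kappa>1 x1\<close> in the equation for \<open>x3\<close> is, up to a constant,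
  the image of \<open>- m x1\<^sup>2 / 2\<close>.
\<close>

lemma add_multiple_odd:
  fixes m :: int
  assumes K: "subfield K \<Omega>" and D: "AS_data K x1 x2 x3" and p: "p \<noteq> 2"
  obtains x3' where "AS_data K x1 (x2 + of_int m * x1) x3'"
    "adjoin K {x1, x2 + of_int m * x1, x3'} = adjoin K {x1, x2, x3}"
proof -
  define \<kappa>1 \<kappa>2 where "\<kappa>1 = wp x1" and "\<kappa>2 = wp x2"
  have \<kappa>: "\<kappa>1 \<in> K" "\<kappa>2 \<in> K" "wp x3 - s_term p G \<kappa>1 \<kappa>2 x1 x2 \<in> K"
    using D by (auto simp: AS_data_def \<kappa>1_def \<kappa>2_def)
  have \<epsilon>2: "\<epsilon>2 = 0" using available p by (auto simp: available_for_def \<epsilon>2_def exp2_def)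
  have two: "(2::'a) \<noteq> 0"
    using of_nat_eq_0[of 2] p p_gt_1 by (auto dest!: dvd_imp_le)
  have two_p: "(2::'a) ^ p = 2" using frob_of_nat[of 2] by simp
  let ?m = "of_int m :: 'a"
  define d where "d = - (?m * x1\<^sup>2 / 2)"
  have "wp d = - (?m * ((x1\<^sup>2) ^ p - x1\<^sup>2) / 2)"
    by (simp add: d_def frob_minus power_divide power_mult_distrib frob_of_int two_p algebra_simps diff_divide_distrib)
  also have "(x1\<^sup>2) ^ p = (x1 + \<kappa>1)\<^sup>2" by (simp add: \<kappa>1_def flip: power_mult) (simp add: power_mult mult.commute)
  also have "- (?m * ((x1 + \<kappa>1)\<^sup>2 - x1\<^sup>2) / 2) = - (?m * \<kappa>1 * x1) - ?m * \<kappa>1\<^sup>2 / 2"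
    using two by (simp add: field_simps power2_eq_square)
  finally have wpd: "wp d = s_term p G \<kappa>1 (\<kappa>2 + ?m * \<kappa>1) x1 (x2 + ?m * x1) - s_term p G \<kappa>1 \<kappa>2 x1 x2 - ?m * \<kappa>1\<^sup>2 / 2"
    by (simp add: s_term_eq \<epsilon>2 algebra_simps)
  have w: "wp (x2 + ?m * x1) = \<kappa>2 + ?m * \<kappa>1"
    unfolding wp_add wp_of_int_mult by (simp add: \<kappa>1_def \<kappa>2_def)
  have eq: "wp (x3 + d) - s_term p G \<kappa>1 (\<kappa>2 + ?m * \<kappa>1) x1 (x2 + ?m * x1)
      = (wp x3 - s_term p G \<kappa>1 \<kappa>2 x1 x2) - ?m * \<kappa>1\<^sup>2 / 2"
    unfolding wp_add wpd by simp
  have "(2::'a) \<in> K" using subfield_of_nat[OF K, of 2] by simp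
  then have AS: "AS_data K x1 (x2 + ?m * x1) (x3 + d)"
    unfolding AS_data_def w \<kappa>1_def[symmetric] eq
    by (intro conjI subfield_add[OF K] subfield_diff[OF K] subfield_mult[OF K] subfield_divide[OF K]
        subfield_power[OF K] subfield_of_int[OF K] \<kappa>)
  have KM: "K \<subseteq> adjoin K {u, v}" and xM: "u \<in> adjoin K {u, v}" "v \<in> adjoin K {u, v}" for u v :: 'a
    using subset_adjoin(1)[of K "{u, v}"] subset_adjoin(2)[of "{u, v}" K] by auto
  note cl = subfield_intros[OF adjoin_subfield]
  have "adjoin K {x1, x2 + ?m * x1, x3 + d} = adjoin K {x1, x2, x3}"
  proof (rule adjoin_change)
    have "2 \<in> adjoin K {x1, x2}" using subfield_of_nat[OF adjoin_subfield, of 2] by simp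
    then show "d \<in> adjoin K {x1, x2}" unfolding d_def by (intro cl xM)
    have "(x2 + ?m * x1) - ?m * x1 \<in> adjoin K {x1, x2 + ?m * x1}" by (intro cl(7) cl(4) cl(12) xM)
    then show "x2 \<in> adjoin K {x1, x2 + ?m * x1}" by simp
  qed (intro cl xM)+
  then show ?thesis using that AS by blast
qed

text \<open>
  In \<open>D\<^sub>8\<close> and \<open>Q\<^sub>8\<close> it is the replacement of \<open>\<sigma>2\<close> by \<open>\<sigma>1 \<sigma>2\<close> that defines an automorphism, which
  adds \<open>x2\<close> to \<open>x1\<close>. The equation for \<open>x3\<close> is corrected by \<open>x1 x2\<close>.
\<close>

lemma add_generators_even:
  assumes K: "subfield K \<Omega>" and D: "AS_data K x1 x2 x3" and p: "p = 2"
  obtains x3' where "AS_data K (x1 + x2) x2 x3'"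
    "adjoin K {x1 + x2, x2, x3'} = adjoin K {x1, x2, x3}"
proof -
  define \<kappa>1 \<kappa>2 where "\<kappa>1 = wp x1" and "\<kappa>2 = wp x2"
  have \<kappa>: "\<kappa>1 \<in> K" "\<kappa>2 \<in> K" "wp x3 - s_term p G \<kappa>1 \<kappa>2 x1 x2 \<in> K"
    using D by (auto simp: AS_data_def \<kappa>1_def \<kappa>2_def)
  have \<epsilon>1: "\<epsilon>1 = 1" using available p by (auto simp: available_for_def \<epsilon>1_def exp1_def)
  have neg: "- u = u" for u :: 'a by (rule uminus_CHAR_2) (simp add: CHAR p)
  have s: "s_term p G \<kappa>1 \<kappa>2 x1 x2 = \<kappa>2 * x1 + \<kappa>1 * x1 + \<epsilon>2 * (x2 * \<kappa>2)" for \<kappa>1 \<kappa>2 x1 x2 :: 'a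
  proof -
    have "carry p u v = u * v" for u v :: 'a using carry_char_2[OF p] p by simp
    then show ?thesis unfolding s_term_eq \<epsilon>1 using neg[of "\<kappa>2 * x1"] by (simp add: mult.commute)
  qed
  have x_p: "x1 ^ p = x1 + \<kappa>1" "x2 ^ p = x2 + \<kappa>2" by (simp_all add: \<kappa>1_def \<kappa>2_def)
  have "wp (x1 * x2) = \<kappa>1 * x2 + \<kappa>2 * x1 + \<kappa>1 * \<kappa>2"
    unfolding power_mult_distrib x_p by (simp add: algebra_simps)
  moreover have "s_term p G (\<kappa>1 + \<kappa>2) \<kappa>2 (x1 + x2) x2 - s_term p G \<kappa>1 \<kappa>2 x1 x2
      = \<kappa>1 * x2 + \<kappa>2 * x1 + (\<kappa>2 * x2 + \<kappa>2 * x2)"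
    unfolding s by (simp add: algebra_simps)
  moreover have "\<kappa>2 * x2 + \<kappa>2 * x2 = 0" using neg[of "\<kappa>2 * x2"] by (metis add.right_inverse)
  ultimately have wpd: "wp (x1 * x2) = s_term p G (\<kappa>1 + \<kappa>2) \<kappa>2 (x1 + x2) x2 - s_term p G \<kappa>1 \<kappa>2 x1 x2 + \<kappa>1 * \<kappa>2"
    by simp
  have w: "wp (x1 + x2) = \<kappa>1 + \<kappa>2" unfolding wp_add by (simp add: \<kappa>1_def \<kappa>2_def)
  have eq: "wp (x3 + x1 * x2) - s_term p G (\<kappa>1 + \<kappa>2) \<kappa>2 (x1 + x2) x2 = (wp x3 - s_term p G \<kappa>1 \<kappa>2 x1 x2) + \<kappa>1 * \<kappa>2"
    unfolding wp_add wpd by simp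
  have AS: "AS_data K (x1 + x2) x2 (x3 + x1 * x2)"
    unfolding AS_data_def w \<kappa>2_def[symmetric] eq
    by (intro conjI subfield_add[OF K] subfield_mult[OF K] \<kappa>)
  have xM: "u \<in> adjoin K {u, v}" "v \<in> adjoin K {u, v}" for u v :: 'a
    using subset_adjoin(2)[of "{u, v}" K] by auto
  note cl = subfield_intros[OF adjoin_subfield]
  have "adjoin K {x1 + x2, x2, x3 + x1 * x2} = adjoin K {x1, x2, x3}"
  proof (rule adjoin_change)
    have "(x1 + x2) - x2 \<in> adjoin K {x1 + x2, x2}" by (intro cl(7) xM)
    then show "x1 \<in> adjoin K {x1 + x2, x2}" by simp
  qed (intro cl xM)+
  then show ?thesis using that AS by blast
qed

end


section \<open>Reduced generators\<close>

locale p3_local = p3_char p G "TYPE('a)" + complete_dvf K v p for p G and K :: "'a::field set" and v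
begin

text \<open>
  In terms of Artin-Schreier theory: \<open>\<kappa>1\<close> and \<open>\<kappa>2\<close> define an extension of degree \<open>p\<^sup>2\<close> all of
  whose subextensions of degree \<open>p\<close> are ramified.
\<close>

definition independent_classes :: "'a \<Rightarrow> 'a \<Rightarrow> bool" where
  "independent_classes \<kappa>1 \<kappa>2 \<longleftrightarrow>
     (\<forall>m n. \<forall>k\<in>K. val_ge v 0 (of_int m * \<kappa>1 + of_int n * \<kappa>2 - wp k) \<longrightarrow> int p dvd m \<and> int p dvd n)"

lemma reduce_class:
  assumes "\<kappa> \<in> K" and "\<And>k. k \<in> K \<Longrightarrow> \<not> val_ge v 0 (\<kappa> - wp k)"
  obtains k where "k \<in> K" "\<kappa> + wp k \<noteq> 0" "v (\<kappa> + wp k) < 0" "\<not> int p dvd v (\<kappa> + wp k)"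
    "\<And>n. n \<le> 0 \<Longrightarrow> val_ge v n \<kappa> \<Longrightarrow> val_ge v n (\<kappa> + wp k)"
proof -
  obtain h where h: "h \<in> K"
    "val_ge v 0 (\<kappa> - wp h) \<or> (\<kappa> - wp h \<noteq> 0 \<and> v (\<kappa> - wp h) < 0 \<and> \<not> int p dvd v (\<kappa> - wp h))"
    "\<And>n. n \<le> 0 \<Longrightarrow> val_ge v n \<kappa> \<Longrightarrow> val_ge v n (\<kappa> - wp h)"
    using reduce_mod_wp[OF assms(1)] by blast
  have eq: "\<kappa> + wp (- h) = \<kappa> - wp h" by (simp add: frob_minus)
  show ?thesis
  proof (rule that[of "- h"])
    show "- h \<in> K" by (rule Fcl(5)[OF h(1)])
    show "\<kappa> + wp (- h) \<noteq> 0" "v (\<kappa> + wp (- h)) < 0" "\<not> int p dvd v (\<kappa> + wp (- h))"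
      unfolding eq using h(2) assms(2)[OF h(1)] by auto
    show "\<And>n. n \<le> 0 \<Longrightarrow> val_ge v n \<kappa> \<Longrightarrow> val_ge v n (\<kappa> + wp (- h))"
      unfolding eq by (rule h(3))
  qed
qed

lemma independent_classes_translate:
  assumes "independent_classes \<kappa>1 \<kappa>2" "k1 \<in> K" "k2 \<in> K"
  shows "independent_classes (\<kappa>1 + wp k1) (\<kappa>2 + wp k2)"
  unfolding independent_classes_def
proof (intro allI ballI impI)
  fix m n k assume k: "k \<in> K"
    and ge: "val_ge v 0 (of_int m * (\<kappa>1 + wp k1) + of_int n * (\<kappa>2 + wp k2) - wp k)"
  let ?k = "k - of_int m * k1 - of_int n * k2"
  have "wp ?k = wp k - of_int m * wp k1 - of_int n * wp k2"
    unfolding wp_diff wp_of_int_mult ..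
  then have "of_int m * (\<kappa>1 + wp k1) + of_int n * (\<kappa>2 + wp k2) - wp k
      = of_int m * \<kappa>1 + of_int n * \<kappa>2 - wp ?k"
    by (simp only: distrib_left) simp
  moreover have "?k \<in> K" by (intro Fcl k assms)
  ultimately show "int p dvd m \<and> int p dvd n"
    using assms(1) ge unfolding independent_classes_def by metis
qed

lemma not_dvd_1: "\<not> int p dvd 1"
  using p_gt_1 by simp

lemma independent_classesD:
  assumes "independent_classes \<kappa>1 \<kappa>2" "k \<in> K"
  shows "\<not> val_ge v 0 (\<kappa>1 - wp k)" "\<not> val_ge v 0 (of_int m * \<kappa>1 + \<kappa>2 - wp k)"
    "\<not> val_ge v 0 (\<kappa>1 + \<kappa>2 - wp k)"
proof -
  have *: "int p dvd a \<and> int p dvd b" if "val_ge v 0 (of_int a * \<kappa>1 + of_int b * \<kappa>2 - wp k)" for a b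
    using assms that unfolding independent_classes_def by blast
  show "\<not> val_ge v 0 (\<kappa>1 - wp k)" using *[of 1 0] not_dvd_1 by auto
  show "\<not> val_ge v 0 (of_int m * \<kappa>1 + \<kappa>2 - wp k)" using *[of m 1] not_dvd_1 by auto
  show "\<not> val_ge v 0 (\<kappa>1 + \<kappa>2 - wp k)" using *[of 1 1] not_dvd_1 by auto
qed

text \<open>
  Neither term of a dependency relation \<open>m \<kappa>1 + n \<kappa>2\<close> can vanish, because both \<open>\<kappa>1\<close> and \<open>\<kappa>2\<close> have
  valuation exactly \<open>N\<close>. So \<open>n\<close> is invertible modulo \<open>p\<close> and the relation can be scaled to \<open>n = 1\<close>.
\<close>

lemma dependent_leading_terms:
  assumes \<kappa>: "\<kappa>1 \<in> K" "\<kappa>2 \<in> K" "\<kappa>1 \<noteq> 0" "\<kappa>2 \<noteq> 0" and N: "v \<kappa>1 = N" "v \<kappa>2 = N"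
    and dep: "\<not> leading_independent p K v \<kappa>1 \<kappa>2"
  obtains r :: int where "\<not> int p dvd r" "val_ge v (N + 1) (of_int r * \<kappa>1 + \<kappa>2)"
proof -
  obtain m n y where y: "of_int m * \<kappa>1 + of_int n * \<kappa>2 = \<kappa>2 * y" "y \<in> val_ideal K v"
    and mn: "\<not> (int p dvd m \<and> int p dvd n)"
    using dep unfolding leading_independent_def by blast
  have ge: "val_ge v (N + 1) (of_int m * \<kappa>1 + of_int n * \<kappa>2)"
    unfolding y(1) using y(2) \<kappa> N by (intro val_ge_mult) (auto simp: val_ideal_def val_ge_def)
  have unit: "\<not> val_ge v (N + 1) (of_int j * \<kappa>)" if "\<kappa> \<in> K" "\<kappa> \<noteq> 0" "v \<kappa> = N" "\<not> int p dvd j" for j \<kappa>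
  proof -
    have j: "of_int j \<in> K" "of_int j \<noteq> (0::'a)" using that(4) of_int_eq_0 by (auto intro: Fcl)
    have "int p * v (of_int j) = v (of_int j)" using val_power[OF j, of p] by (simp add: frob_of_int)
    then have "v (of_int j) = 0" using p_gt_1 by simp
    then show ?thesis using that j by (simp add: val_ge_def val_mult)
  qed
  have m: "\<not> int p dvd m"
  proof
    assume "int p dvd m"
    then have "val_ge v (N + 1) (of_int n * \<kappa>2)" using ge of_int_eq_0[of m] by simp
    then show False using unit[OF \<kappa>(2,4) N(2)] mn \<open>int p dvd m\<close> by blast
  qed
  have n: "\<not> int p dvd n"
  proof
    assume "int p dvd n"
    then have "val_ge v (N + 1) (of_int m * \<kappa>1)" using ge of_int_eq_0[of n] by simp
    then show False using unit[OF \<kappa>(1,3) N(1)] m by blast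
  qed
  have "coprime n (int p)"
    using n prime_imp_coprime[of "int p" n] prime_p by (simp add: coprime_commute)
  then obtain s t where "s * n + t * int p = 1"
    using bezout_int[of n "int p"] by (auto simp: coprime_iff_gcd_eq_1)
  then have "of_int (s * n + t * int p) = (1::'a)" by simp
  then have sn: "of_int s * of_int n = (1::'a)" by simp
  have s: "\<not> int p dvd s"
  proof
    assume "int p dvd s"
    then have "of_int s = (0::'a)" by (simp add: of_int_eq_0)
    then show False using sn by simp
  qed
  have "val_ge v (0 + (N + 1)) (of_int s * (of_int m * \<kappa>1 + of_int n * \<kappa>2))"
    by (intro val_ge_mult val_ge_of_int ge Fcl \<kappa>)
  moreover have "of_int s * (of_int m * \<kappa>1 + of_int n * \<kappa>2) = of_int (s * m) * \<kappa>1 + (of_int s * of_int n) * \<kappa>2"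
    by (simp add: algebra_simps)
  ultimately have "val_ge v (N + 1) (of_int (s * m) * \<kappa>1 + \<kappa>2)" by (simp add: sn)
  moreover have "\<not> int p dvd s * m" using s m prime_p prime_dvd_mult_iff[of "int p" s m] by simp
  ultimately show ?thesis using that by blast
qed

lemma defining_dataI:
  assumes D: "AS_data K x1 x2 x3"
    and "wp x1 \<noteq> 0" "v (wp x1) < 0" "\<not> int p dvd v (wp x1)"
    and "wp x2 \<noteq> 0" "v (wp x2) < 0" "\<not> int p dvd v (wp x2)"
    and "v (wp x1) = v (wp x2) \<Longrightarrow> leading_independent p K v (wp x1) (wp x2)"
  shows "\<exists>\<kappa>1 \<kappa>2 \<kappa>3. defining_data p G K v \<kappa>1 \<kappa>2 \<kappa>3 x1 x2 x3"
proof -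
  have "int p dvd - int (nat (- n)) \<longleftrightarrow> int p dvd n" if "n < 0" for n :: int using that by simp
  then have dvd: "\<not> p dvd nat (- n)" if "n < 0" "\<not> int p dvd n" for n
    using that by (metis dvd_minus_iff int_dvd_int_iff)
  have "defining_data p G K v (wp x1) (wp x2) (wp x3 - s_term p G (wp x1) (wp x2) x1 x2) x1 x2 x3"
    unfolding defining_data_def
  proof (intro conjI)
    show "\<exists>b1 b2. wp x1 \<noteq> 0 \<and> v (wp x1) = - int b1 \<and> 0 < b1 \<and> \<not> p dvd b1 \<and>
        wp x2 \<noteq> 0 \<and> v (wp x2) = - int b2 \<and> 0 < b2 \<and> \<not> p dvd b2 \<and>
        (b1 = b2 \<longrightarrow> leading_independent p K v (wp x1) (wp x2))"
      by (rule exI[of _ "nat (- v (wp x1))"], rule exI[of _ "nat (- v (wp x2))"])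
         (use assms dvd in auto)
  qed (use D in \<open>auto simp: AS_data_def\<close>)
  then show ?thesis by blast
qed

text \<open>
  First both classes are reduced. If they have poles of the same order with dependent leading
  coefficients, a suitable combination has a smaller pole; replacing one of the generators by
  this combination, in the way that the group allows, makes the pole orders different.
\<close>

lemma ex_defining_data:
  assumes D: "AS_data K x1 x2 x3" and ind: "independent_classes (wp x1) (wp x2)"
  shows "\<exists>\<kappa>1 \<kappa>2 \<kappa>3 y1 y2 y3. defining_data p G K v \<kappa>1 \<kappa>2 \<kappa>3 y1 y2 y3 \<and>
           adjoin K {y1, y2, y3} = adjoin K {x1, x2, x3}"
proof -
  have \<kappa>: "wp x1 \<in> K" "wp x2 \<in> K" using D by (auto simp: AS_data_def)
  obtain k1 where k1: "k1 \<in> K" "wp x1 + wp k1 \<noteq> 0" "v (wp x1 + wp k1) < 0" "\<not> int p dvd v (wp x1 + wp k1)"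
    using reduce_class[OF \<kappa>(1) independent_classesD(1)[OF ind]] by blast
  have "\<not> val_ge v 0 (wp x2 - wp k)" if "k \<in> K" for k
    using independent_classesD(2)[OF ind that, of 0] by simp
  then obtain k2 where k2: "k2 \<in> K" "wp x2 + wp k2 \<noteq> 0" "v (wp x2 + wp k2) < 0" "\<not> int p dvd v (wp x2 + wp k2)"
    using reduce_class[OF \<kappa>(2)] by blast
  define y1 y2 where "y1 = x1 + k1" and "y2 = x2 + k2"
  obtain y3 where D': "AS_data K y1 y2 y3" and adj: "adjoin K {y1, y2, y3} = adjoin K {x1, x2, x3}"
    unfolding y1_def y2_def using translate_generators[OF F D k1(1) k2(1)] .
  have w: "wp y1 = wp x1 + wp k1" "wp y2 = wp x2 + wp k2" by (simp_all add: y1_def y2_def wp_add)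
  have y1: "wp y1 \<noteq> 0" "v (wp y1) < 0" "\<not> int p dvd v (wp y1)" unfolding w by (fact k1)+
  have y2: "wp y2 \<noteq> 0" "v (wp y2) < 0" "\<not> int p dvd v (wp y2)" unfolding w by (fact k2)+
  have ind': "independent_classes (wp y1) (wp y2)"
    unfolding w by (rule independent_classes_translate[OF ind k1(1) k2(1)])
  have \<kappa>': "wp y1 \<in> K" "wp y2 \<in> K" using D' by (auto simp: AS_data_def)
  show ?thesis
  proof (cases "v (wp y1) = v (wp y2) \<longrightarrow> leading_independent p K v (wp y1) (wp y2)")
    case True
    then show ?thesis using defining_dataI[OF D' y1 y2] adj by blast
  next
    case False
    define N where "N = v (wp y2)"
    have N: "v (wp y1) = N" "v (wp y2) = N" "N < 0" using False y2 by (auto simp: N_def)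
    obtain r where r: "\<not> int p dvd r" "val_ge v (N + 1) (of_int r * wp y1 + wp y2)"
      using dependent_leading_terms[OF \<kappa>' y1(1) y2(1) N(1,2)] False by blast
    show ?thesis
    proof (cases "p = 2")
      case p2: False
      define \<kappa> where "\<kappa> = of_int r * wp y1 + wp y2"
      have \<kappa>K: "\<kappa> \<in> K" unfolding \<kappa>_def by (intro Fcl \<kappa>')
      obtain z3 where D2: "AS_data K y1 (y2 + of_int r * y1) z3"
        and adj2: "adjoin K {y1, y2 + of_int r * y1, z3} = adjoin K {y1, y2, y3}"
        using add_multiple_odd[OF F D' p2] .
      have wz: "wp (y2 + of_int r * y1) = \<kappa>" unfolding wp_add wp_of_int_mult by (simp add: \<kappa>_def)
      have "\<not> val_ge v 0 (\<kappa> - wp k)" if "k \<in> K" for k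
        unfolding \<kappa>_def by (rule independent_classesD(2)[OF ind' that])
      then obtain k where k: "k \<in> K" "\<kappa> + wp k \<noteq> 0" "v (\<kappa> + wp k) < 0" "\<not> int p dvd v (\<kappa> + wp k)"
        "\<And>n. n \<le> 0 \<Longrightarrow> val_ge v n \<kappa> \<Longrightarrow> val_ge v n (\<kappa> + wp k)"
        using reduce_class[OF \<kappa>K] by metis
      have "val_ge v (N + 1) (\<kappa> + wp k)" using k(5)[of "N + 1"] r(2) N(3) by (simp add: \<kappa>_def)
      then have smaller: "v (\<kappa> + wp k) \<noteq> N" using k(2) by (auto simp: val_ge_def)
      obtain u3 where D3: "AS_data K (y1 + 0) (y2 + of_int r * y1 + k) u3"
        and adj3: "adjoin K {y1 + 0, y2 + of_int r * y1 + k, u3} = adjoin K {y1, y2 + of_int r * y1, z3}"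
        using translate_generators[OF F D2 Fcl(1) k(1)] .
      have wu: "wp (y2 + of_int r * y1 + k) = \<kappa> + wp k"
        unfolding wp_add[of "y2 + of_int r * y1" k] wz ..
      have "\<exists>\<kappa>1 \<kappa>2 \<kappa>3. defining_data p G K v \<kappa>1 \<kappa>2 \<kappa>3 y1 (y2 + of_int r * y1 + k) u3"
      proof (rule defining_dataI)
        show "AS_data K y1 (y2 + of_int r * y1 + k) u3" using D3 by simp
      qed (unfold wu, use y1 k(2-4) N(1) smaller in auto)
      moreover have "adjoin K {y1, y2 + of_int r * y1 + k, u3} = adjoin K {x1, x2, x3}"
        using adj adj2 adj3 by simp
      ultimately show ?thesis by blast
    next
      case p2: True
      define \<kappa> where "\<kappa> = wp y1 + wp y2"
      have \<kappa>K: "\<kappa> \<in> K" unfolding \<kappa>_def by (intro Fcl \<kappa>')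
      have "int p dvd r - 1" using r(1) by (simp add: p2)
      then have "of_int (r - 1) = (0::'a)" by (simp only: of_int_eq_0)
      then have "of_int r = (1::'a)" by simp
      then have ge: "val_ge v (N + 1) \<kappa>" using r(2) by (simp add: \<kappa>_def)
      obtain z3 where D2: "AS_data K (y1 + y2) y2 z3"
        and adj2: "adjoin K {y1 + y2, y2, z3} = adjoin K {y1, y2, y3}"
        using add_generators_even[OF F D' p2] .
      have wz: "wp (y1 + y2) = \<kappa>" unfolding wp_add by (simp add: \<kappa>_def)
      have "\<not> val_ge v 0 (\<kappa> - wp k)" if "k \<in> K" for k
        unfolding \<kappa>_def by (rule independent_classesD(3)[OF ind' that])
      then obtain k where k: "k \<in> K" "\<kappa> + wp k \<noteq> 0" "v (\<kappa> + wp k) < 0" "\<not> int p dvd v (\<kappa> + wp k)"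
        "\<And>n. n \<le> 0 \<Longrightarrow> val_ge v n \<kappa> \<Longrightarrow> val_ge v n (\<kappa> + wp k)"
        using reduce_class[OF \<kappa>K] by metis
      have "val_ge v (N + 1) (\<kappa> + wp k)" using k(5)[of "N + 1"] ge N(3) by simp
      then have smaller: "v (\<kappa> + wp k) \<noteq> N" using k(2) by (auto simp: val_ge_def)
      obtain u3 where D3: "AS_data K (y1 + y2 + k) (y2 + 0) u3"
        and adj3: "adjoin K {y1 + y2 + k, y2 + 0, u3} = adjoin K {y1 + y2, y2, z3}"
        using translate_generators[OF F D2 k(1) Fcl(1)] .
      have wu: "wp (y1 + y2 + k) = \<kappa> + wp k"
        unfolding wp_add[of "y1 + y2" k] wz ..
      have "\<exists>\<kappa>1 \<kappa>2 \<kappa>3. defining_data p G K v \<kappa>1 \<kappa>2 \<kappa>3 (y1 + y2 + k) y2 u3"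
      proof (rule defining_dataI)
        show "AS_data K (y1 + y2 + k) y2 u3" using D3 by simp
      qed (unfold wu, use y2 k(2-4) N(2) smaller in auto)
      moreover have "adjoin K {y1 + y2 + k, y2, u3} = adjoin K {x1, x2, x3}"
        using adj adj2 adj3 by simp
      ultimately show ?thesis by blast
    qed
  qed
qed

text \<open>
  If a combination \<open>m x1 + n x2 - k\<close> had an integral Artin-Schreier image, it would lie in \<open>K\<close> by
  total ramification, and so be fixed by \<open>\<sigma>1\<close> and \<open>\<sigma>2\<close>, which change it by \<open>m\<close> and \<open>n\<close>.
\<close>

lemma totally_ramified_imp_defining_data:
  assumes ram: "totally_ramified K v L" and gal: "galois_extension K L" and iso: "Gal K L \<cong> P"
  shows "\<exists>\<kappa>1 \<kappa>2 \<kappa>3 x1 x2 x3. defining_data p G K v \<kappa>1 \<kappa>2 \<kappa>3 x1 x2 x3 \<and> L = adjoin K {x1, x2, x3}"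
proof -
  have KL: "field_extension K L" using gal by (simp add: galois_extension_def)
  have "P \<cong> Gal K L" by (rule group.iso_sym[OF group_Gal[OF KL] iso])
  then obtain h where h: "h \<in> Group.iso P (Gal K L)" by (auto simp: is_iso_def)
  interpret presented_galois p G K L h
    by (intro presented_galois.intro p3_char_axioms presented_galois_axioms.intro gal h)
  obtain x1 x2 x3 where x: "x1 \<in> L" "x2 \<in> L" "\<sigma>1 x1 = x1 + 1" "\<sigma>1 x2 = x2"
    "\<sigma>2 x1 = x1" "\<sigma>2 x2 = x2 + 1" "wp x1 \<in> K" "wp x2 \<in> K"
    "wp x3 - s_term p G (wp x1) (wp x2) x1 x2 \<in> K" "L = adjoin K {x1, x2, x3}"
    by (rule ex_generators) blast
  have "independent_classes (wp x1) (wp x2)" unfolding independent_classes_def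
  proof (intro allI ballI impI)
    fix m n k assume k: "k \<in> K" and ge: "val_ge v 0 (of_int m * wp x1 + of_int n * wp x2 - wp k)"
    let ?z = "of_int m * x1 + of_int n * x2 - k"
    have eq: "wp ?z = of_int m * wp x1 + of_int n * wp x2 - wp k"
      unfolding wp_diff[of _ k] wp_add wp_of_int_mult ..
    have kL: "k \<in> L" using k K_sub by auto
    have zL: "?z \<in> L" by (intro Lcl x kL)
    have wzK: "wp ?z \<in> K"
      unfolding eq by (intro Fcl(3)[OF Fcl(4)[OF Fcl(12) x(7)] Fcl(4)[OF Fcl(12) x(8)], THEN Fcl(7)] Fcl k)
    have zK: "?z \<in> K"
      by (rule totally_ramified_wp_integral[OF ram zL wzK]) (unfold eq, rule ge)
    have int: "\<sigma> (of_int j * y) = of_int j * \<sigma> y" if "\<sigma> \<in> carrier \<Gamma>" "y \<in> L" for \<sigma> j y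
      using that Gmult[OF that(1) Lcl(12) that(2)] fixK[OF that(1) Fcl(12)] by simp
    have mul: "of_int j * y \<in> L" if "y \<in> L" for j y by (intro Lcl that)
    have act: "\<sigma> ?z = of_int m * \<sigma> x1 + of_int n * \<sigma> x2 - k" if "\<sigma> \<in> carrier \<Gamma>" for \<sigma>
      unfolding Gdiff[OF that Lcl(3)[OF mul[OF x(1)] mul[OF x(2)]] kL] Gadd[OF that mul[OF x(1)] mul[OF x(2)]]
        int[OF that x(1)] int[OF that x(2)] fixK[OF that k] ..
    have "of_int m = (0::'a)"
      using act[OF \<sigma>(1)] unfolding fixK[OF \<sigma>(1) zK] x(3,4) by (simp add: distrib_left)
    moreover have "of_int n = (0::'a)"
      using act[OF \<sigma>(2)] unfolding fixK[OF \<sigma>(2) zK] x(5,6) by (simp add: distrib_left)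
    ultimately show "int p dvd m \<and> int p dvd n" by (simp add: of_int_eq_0)
  qed
  moreover have "AS_data K x1 x2 x3" using x by (simp add: AS_data_def)
  ultimately show ?thesis using ex_defining_data[of x1 x2 x3] x(10) by metis
qed

end


section \<open>Totally ramified extensions with Galois group of order \<open>p\<^sup>3\<close>\<close>

theorem corollary1p5:
  fixes p :: nat and K :: "'a::field set" and v :: "'a \<Rightarrow> int" and G :: nonabelian_p3
  assumes "local_field_char p K v"
    and "UNIV_separable_closure_of K"
    and "available_for p G"
  shows "(\<forall>L. field_extension K L \<longrightarrow>
            (totally_ramified K v L \<and> galois_extension K L \<and> Gal K L \<cong> p3_group p G
             \<longleftrightarrow> (\<exists>\<kappa>1 \<kappa>2 \<kappa>3 x1 x2 x3. defining_data p G K v \<kappa>1 \<kappa>2 \<kappa>3 x1 x2 x3 \<and>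
                    L = adjoin K {x1, x2, x3})))
       \<and> (\<forall>L \<kappa>1 \<kappa>2 \<kappa>3 x1 x2 x3.
            defining_data p G K v \<kappa>1 \<kappa>2 \<kappa>3 x1 x2 x3 \<and> L = adjoin K {x1, x2, x3} \<longrightarrow>
            (\<exists>\<sigma>1 \<sigma>2 \<sigma>3.
               {\<sigma>1, \<sigma>2, \<sigma>3} \<subseteq> carrier (Gal K L) \<and>
               (\<forall>\<tau>1 \<tau>2 \<tau>3. {\<tau>1, \<tau>2, \<tau>3} \<subseteq> carrier (Gal K L) \<longrightarrow>
                  (prescribed_action p G x1 x2 x3 \<tau>1 \<tau>2 \<tau>3
                   \<longleftrightarrow> \<tau>1 = \<sigma>1 \<and> \<tau>2 = \<sigma>2 \<and> \<tau>3 = \<sigma>3)) \<and>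
               carrier (Gal K L) = generate (Gal K L) {\<sigma>1, \<sigma>2, \<sigma>3} \<and>
               satisfy_presentation p G (Gal K L) \<sigma>1 \<sigma>2 \<and>
               \<sigma>3 = group_comm (Gal K L) \<sigma>1 \<sigma>2))"
proof -
  interpret complete_dvf K v p by (rule local_field_complete_dvf[OF assms(1)])
  interpret p3_local p G K v
    by (intro p3_local.intro p3_char.intro p3_presentation.intro assms(3) char_p_axioms complete_dvf_axioms)
  have sep: "separable_over K x" for x using assms(2) by (simp add: UNIV_separable_closure_of_def)
  have backward: "galois_extension K (adjoin K {x1, x2, x3}) \<and> totally_ramified K v (adjoin K {x1, x2, x3}) \<and>
      (\<exists>\<sigma>1 \<sigma>2 \<sigma>3. galois_core p G K (adjoin K {x1, x2, x3}) x1 x2 x3 \<sigma>1 \<sigma>2 \<sigma>3)"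
    if "defining_data p G K v \<kappa>1 \<kappa>2 \<kappa>3 x1 x2 x3" for \<kappa>1 \<kappa>2 \<kappa>3 x1 x2 x3
  proof -
    interpret D: defining_equations p G K v \<kappa>1 \<kappa>2 \<kappa>3 x1 x2 x3
      by (intro defining_equations.intro p3_char_axioms complete_dvf_axioms defining_equations_axioms.intro that)
    show ?thesis
      using D.galois_and_totally_ramified[OF sep] D.ex_core unfolding D.L_eq by metis
  qed
  show ?thesis
  proof (intro conjI allI impI iffI)
    fix L assume "totally_ramified K v L \<and> galois_extension K L \<and> Gal K L \<cong> p3_group p G"
    then show "\<exists>\<kappa>1 \<kappa>2 \<kappa>3 x1 x2 x3. defining_data p G K v \<kappa>1 \<kappa>2 \<kappa>3 x1 x2 x3 \<and> L = adjoin K {x1, x2, x3}"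
      using totally_ramified_imp_defining_data by blast
  next
    fix L assume "\<exists>\<kappa>1 \<kappa>2 \<kappa>3 x1 x2 x3. defining_data p G K v \<kappa>1 \<kappa>2 \<kappa>3 x1 x2 x3 \<and> L = adjoin K {x1, x2, x3}"
    then obtain x1 x2 x3 \<sigma>1 \<sigma>2 \<sigma>3 where L: "galois_extension K L" "totally_ramified K v L"
      "galois_core p G K L x1 x2 x3 \<sigma>1 \<sigma>2 \<sigma>3"
      using backward by metis
    show "totally_ramified K v L" "galois_extension K L" by (fact L)+
    show "Gal K L \<cong> p3_group p G" by (rule galois_core.Gal_iso[OF L(3)])
  next
    fix L \<kappa>1 \<kappa>2 \<kappa>3 x1 x2 x3
    assume "defining_data p G K v \<kappa>1 \<kappa>2 \<kappa>3 x1 x2 x3 \<and> L = adjoin K {x1, x2, x3}"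
    then obtain \<sigma>1 \<sigma>2 \<sigma>3 where core: "galois_core p G K L x1 x2 x3 \<sigma>1 \<sigma>2 \<sigma>3"
      using backward by metis
    interpret C: galois_core p G K L x1 x2 x3 \<sigma>1 \<sigma>2 \<sigma>3 by (rule core)
    show "\<exists>\<sigma>1 \<sigma>2 \<sigma>3.
               {\<sigma>1, \<sigma>2, \<sigma>3} \<subseteq> carrier (Gal K L) \<and>
               (\<forall>\<tau>1 \<tau>2 \<tau>3. {\<tau>1, \<tau>2, \<tau>3} \<subseteq> carrier (Gal K L) \<longrightarrow>
                  (prescribed_action p G x1 x2 x3 \<tau>1 \<tau>2 \<tau>3
                   \<longleftrightarrow> \<tau>1 = \<sigma>1 \<and> \<tau>2 = \<sigma>2 \<and> \<tau>3 = \<sigma>3)) \<and>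
               carrier (Gal K L) = generate (Gal K L) {\<sigma>1, \<sigma>2, \<sigma>3} \<and>
               satisfy_presentation p G (Gal K L) \<sigma>1 \<sigma>2 \<and>
               \<sigma>3 = group_comm (Gal K L) \<sigma>1 \<sigma>2"
      using C.\<sigma> C.action_unique C.carrier_generate C.presentation C.comm_eq
      by (intro exI[of _ \<sigma>1] exI[of _ \<sigma>2] exI[of _ \<sigma>3]) simp
  qed
qed

end
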